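(* Let $k\geq 2$ be a fixed integer and let $A\subseteq\mathcal{M}_k$ be a Borel measurable set. Then $$\lim_{n\to\infty} n^{-1}\ln(\mu_{k,n}(A))=\tfrac12\ln\|1_A\det\|_\infty.$$
   Context: $\mathcal{M}_k$ is the set of real symmetric positive semidefinite $k\times k$ matrices with $1$'s in the diagonal. For $n\geq k$, $\mu_{k,n}$ is the probability distribution on $\mathcal{M}_k$ of the random matrix $M(k,n)$ with entries $M(k,n)_{i,j}=(v_i,v_j)$, where $v_1,\dots,v_k$ are independent uniform random elements of the sphere $S_{n-1}=\{x\in\mathbb{R}^n:\|x\|_2=1\}$ and $(\cdot,\cdot)$ is the standard scalar product. $\lambda_k$ denotes the Lebesgue measure on the space of real symmetric $k\times k$ matrices with $1$'s in the diagonal (identified with $\mathbb{R}^{k(k-1)/2}$ via the entries above the diagonal). For a measurable function $f:\mathcal{M}_k\to\mathbb{R}$, $\|f\|_\infty$ denotes the essential maximum of $f$ relative to $\lambda_k$ (changes of $f$ on $\lambda_k$-null sets are ignored); $1_A\det$ is the function equal to $\det(M)$ for $M\in A$ and $0$ for $M\in\mathcal{M}_k\setminus A$. The convention $\ln 0=-\infty$ is used. *)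

theory Defs
  imports
    "HOL-Probability.Probability"
    "Jordan_Normal_Form.Determinant"
begin

section \<open>Spaces of matrices\<close>

definition sym_unit_mats :: "nat \<Rightarrow> real mat set" where
  "sym_unit_mats k = {M \<in> carrier_mat k k. transpose_mat M = M \<and> (\<forall>i<k. M $$ (i, i) = 1)}"

definition corr_mats :: "nat \<Rightarrow> real mat set" where
  "corr_mats k =
     {M \<in> sym_unit_mats k. \<forall>x \<in> carrier_vec k. 0 \<le> scalar_prod x (M *\<^sub>v x)}"

definition upper_pairs :: "nat \<Rightarrow> (nat \<times> nat) set" where
  "upper_pairs k = {(i, j). i < j \<and> j < k}"

definition upper_entries :: "nat \<Rightarrow> real mat \<Rightarrow> nat \<times> nat \<Rightarrow> real" where
  "upper_entries k M = (\<lambda>p \<in> upper_pairs k. M $$ p)"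

definition mat_of_upper :: "nat \<Rightarrow> (nat \<times> nat \<Rightarrow> real) \<Rightarrow> real mat" where
  "mat_of_upper k x =
     mat k k (\<lambda>(i, j). if i = j then 1 else if i < j then x (i, j) else x (j, i))"

text \<open>
  The type of matrices carries no topology in the library. The maps \<open>upper_entries k\<close> and
  \<open>mat_of_upper k\<close> are mutually inverse bijections between \<open>sym_unit_mats k\<close> and the
  space of real families indexed by \<open>upper_pairs k\<close>; the Borel sets and the Lebesgue
  measure are transported along this identification.
\<close>

definition borel_sym_unit :: "nat \<Rightarrow> real mat measure" where
  "borel_sym_unit k =
     vimage_algebra (sym_unit_mats k) (upper_entries k) (Pi\<^sub>M (upper_pairs k) (\<lambda>_. borel))"

definition borel_corr :: "nat \<Rightarrow> real mat measure" where
  "borel_corr k = restrict_space (borel_sym_unit k) (corr_mats k)"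

definition lebesgue_sym_unit :: "nat \<Rightarrow> real mat measure" where
  "lebesgue_sym_unit k =
     distr (Pi\<^sub>M (upper_pairs k) (\<lambda>_. lborel)) (borel_sym_unit k) (mat_of_upper k)"

section \<open>Random Gram matrices\<close>

text \<open>
  The dimension \<open>n\<close> tends to infinity, so vectors of \<open>n\<close> reals are represented as
  extensional functions on \<open>{..<n}\<close>.
\<close>

definition unit_sphere :: "nat \<Rightarrow> (nat \<Rightarrow> real) set" where
  "unit_sphere n = {x \<in> {..<n} \<rightarrow>\<^sub>E UNIV. L2_set x {..<n} = 1}"

definition punctured_ball :: "nat \<Rightarrow> (nat \<Rightarrow> real) set" where
  "punctured_ball n = {x \<in> {..<n} \<rightarrow>\<^sub>E UNIV. 0 < L2_set x {..<n} \<and> L2_set x {..<n} \<le> 1}"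

text \<open>
  The uniform distribution on the sphere is the normalised cone measure: a subset of the sphere
  has as its probability the proportion of the volume of the unit ball that lies in the cone
  over it. Equivalently, it is the law of \<open>x / \<parallel>x\<parallel>\<close> for \<open>x\<close> uniform in the unit ball. The origin
  (a null set if \<open>n \<ge> 1\<close>) is removed so that this map takes values in the sphere.
\<close>

definition uniform_sphere :: "nat \<Rightarrow> (nat \<Rightarrow> real) measure" where
  "uniform_sphere n =
     distr
       (restrict_space
         (uniform_measure (Pi\<^sub>M {..<n} (\<lambda>_. lborel)) (punctured_ball n)) (punctured_ball n))
       (restrict_space (Pi\<^sub>M {..<n} (\<lambda>_. borel)) (unit_sphere n))
       (\<lambda>x. \<lambda>i \<in> {..<n}. x i / L2_set x {..<n})"

definition gram_mat :: "nat \<Rightarrow> nat \<Rightarrow> (nat \<Rightarrow> nat \<Rightarrow> real) \<Rightarrow> real mat" where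
  "gram_mat k n v = mat k k (\<lambda>(i, j). \<Sum>l<n. v i l * v j l)"

definition gram_distr :: "nat \<Rightarrow> nat \<Rightarrow> real mat measure" where
  "gram_distr k n =
     distr (Pi\<^sub>M {..<k} (\<lambda>_. uniform_sphere n)) (borel_corr k) (gram_mat k n)"

section \<open>Essential maximum and extended logarithm\<close>

definition ess_max :: "nat \<Rightarrow> (real mat \<Rightarrow> real) \<Rightarrow> ereal" where
  "ess_max k f = esssup (restrict_space (lebesgue_sym_unit k) (corr_mats k)) (\<lambda>M. ereal (f M))"

text \<open>Only nonnegative arguments are relevant; negative ones also get the value \<open>-\<infinity>\<close>.\<close>

definition eln :: "ereal \<Rightarrow> ereal" where
  "eln x = (if x \<le> 0 then -\<infinity> else if x = \<infinity> then \<infinity> else ereal (ln (real_of_ereal x)))"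

end

theory Submission
  imports Defs "HOL-Real_Asymp.Real_Asymp"
begin

text \<open>
  Let \<open>v 0, \<dots>, v (k - 1)\<close> be unit vectors with Gram--Schmidt frame \<open>e 0, \<dots>, e (k - 1)\<close>, and let
  \<open>\<rho> i\<close> be the distance of \<open>v i\<close> from the span of its predecessors. Then
  \<open>v i = \<rho> i * (e i + (\<Sum>l<i. w (l, i) * e l))\<close>, where the gnomonic coordinates
  \<open>w (l, i) = (v i, e l) / \<rho> i\<close> can be any real numbers, and the unit length gives
  \<open>\<rho> i = 1 / sqrt (1 + (\<Sum>l<i. w (l, i)\<^sup>2))\<close>. So the Gram matrix is a function \<open>M(w) = L(w) L(w)\<^sup>T\<close>
  of \<open>w\<close> alone, with \<open>L(w)\<close> lower triangular with diagonal \<open>\<rho> 0, \<dots>, \<rho> (k - 1)\<close>; in particular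
  \<open>det M(w) = g(w)\<^sup>2\<close> for the product \<open>g(w)\<close> of the \<open>\<rho> i\<close>.

  The point of these coordinates is that the dimension enters the law of \<open>w\<close> in the simplest
  possible way: for independent uniform \<open>v i\<close> on the sphere in \<open>\<real>\<^sup>n\<close>, \<open>n \<ge> k\<close>, the density of \<open>w\<close>
  is proportional to \<open>g(w)\<^sup>n\<close> (\<open>gs_coord_law\<close>). Hence the probability of \<open>A\<close> is the integral of
  \<open>g\<^sup>n\<close> over \<open>{w. M(w) \<in> A}\<close> divided by its integral over all \<open>w\<close> (\<open>measure_gram_distr\<close>). Both are
  integrals of powers of \<open>g\<close> against the finite measure with density \<open>g\<^sup>k\<close>. As in the convergence
  of \<open>L\<^sup>p\<close> norms to the \<open>L\<^sup>\<infinity>\<close> norm, they grow at the exponential rate given by the essential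
  supremum of \<open>g\<close> on the domain of integration (\<open>ln_det_power_integral_rate\<close>). For the denominator
  this supremum is \<open>1\<close>, since \<open>g(0) = 1\<close>; no normalising constant has to be computed. For the
  numerator it is the square root of the essential supremum of the determinant on \<open>A\<close>, provided
  that null sets of \<open>w\<close> correspond to null sets of matrix entries (\<open>det_null_iff\<close>).

  Two ingredients need work. The law of a single column of \<open>w\<close> follows from the invariance of
  Lebesgue measure under translations along the frame and its scaling under dilations
  (\<open>mass_transport\<close>, \<open>ball_projection\<close>); it does not depend on the frame, so the columns are
  independent. The correspondence of null sets follows by writing \<open>w \<mapsto> M(w)\<close> as a composition of
  triangular maps, to which Fubini's theorem applies one variable at a time
  (\<open>triangular_map_null_preimage\<close>, \<open>triangular_map_null_image\<close>), and from the Cholesky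
  factorisation, by which every nonsingular correlation matrix is some \<open>M(w)\<close>
  (\<open>corr_mat_gnomonic_gram\<close>).
\<close>

section \<open>Lebesgue measure on finite powers of the line\<close>

abbreviation leb :: "'i set \<Rightarrow> ('i \<Rightarrow> real) measure" where
  "leb I \<equiv> Pi\<^sub>M I (\<lambda>_. lborel)"

interpretation lebesgue_prod: product_sigma_finite "\<lambda>_. lborel :: real measure"
  by standard

lemma sigma_finite_leb: "finite I \<Longrightarrow> sigma_finite_measure (leb I)"
  by (rule lebesgue_prod.sigma_finite)

lemma nn_integral_PiM_affine:
  fixes f :: "('i \<Rightarrow> real) \<Rightarrow> ennreal"
  assumes "finite I" and "f \<in> borel_measurable (leb I)" and "\<And>i. i \<in> I \<Longrightarrow> c i \<noteq> 0"
  shows "(\<integral>\<^sup>+x. f x \<partial>leb I)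
    = ennreal (\<Prod>i\<in>I. \<bar>c i\<bar>) * (\<integral>\<^sup>+x. f (\<lambda>i\<in>I. a i + c i * x i) \<partial>leb I)"
  using assms
proof (induction I arbitrary: f)
  case empty
  have "restrict g {} = (\<lambda>_. undefined)" for g :: "'i \<Rightarrow> real" by (auto simp: restrict_def)
  then show ?case by (simp add: PiM_empty nn_integral_count_space_finite)
next
  case (insert j I)
  note [measurable] = insert.prems(1) and [simp] = insert.hyps
  have m1: "(\<lambda>x. \<integral>\<^sup>+y. f (x(j := y)) \<partial>lborel) \<in> borel_measurable (leb I)"
    by measurable
  have aff [measurable]: "(\<lambda>x. \<lambda>i\<in>insert j I. a i + c i * x i)
      \<in> leb (insert j I) \<rightarrow>\<^sub>M leb (insert j I)"
    by (rule measurable_restrict) measurable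
  have upd: "(\<lambda>i\<in>I. a i + c i * x i)(j := a j + c j * y) = (\<lambda>i\<in>insert j I. a i + c i * (x(j := y)) i)"
    for x and y :: real using insert.hyps by (auto simp: restrict_def fun_eq_iff)
  have "(\<integral>\<^sup>+x. f x \<partial>leb (insert j I)) = (\<integral>\<^sup>+x. \<integral>\<^sup>+y. f (x(j := y)) \<partial>lborel \<partial>leb I)"
    by (rule lebesgue_prod.product_nn_integral_insert) simp_all
  also have "\<dots> = ennreal (\<Prod>i\<in>I. \<bar>c i\<bar>) *
      (\<integral>\<^sup>+x. \<integral>\<^sup>+y. f ((\<lambda>i\<in>I. a i + c i * x i)(j := y)) \<partial>lborel \<partial>leb I)"
    by (rule insert.IH[OF m1]) (simp add: insert.prems)
  also have "(\<integral>\<^sup>+x. \<integral>\<^sup>+y. f ((\<lambda>i\<in>I. a i + c i * x i)(j := y)) \<partial>lborel \<partial>leb I)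
     = (\<integral>\<^sup>+x. ennreal \<bar>c j\<bar> * (\<integral>\<^sup>+y. f ((\<lambda>i\<in>I. a i + c i * x i)(j := a j + c j * y)) \<partial>lborel) \<partial>leb I)"
  proof (rule nn_integral_cong)
    fix x assume x: "x \<in> space (leb I)"
    have [measurable]: "(\<lambda>i\<in>I. a i + c i * x i) \<in> space (leb I)" by (simp add: space_PiM)
    have "(\<lambda>y. f ((\<lambda>i\<in>I. a i + c i * x i)(j := y))) \<in> borel_measurable borel" by measurable
    then show "(\<integral>\<^sup>+y. f ((\<lambda>i\<in>I. a i + c i * x i)(j := y)) \<partial>lborel)
       = ennreal \<bar>c j\<bar> * (\<integral>\<^sup>+y. f ((\<lambda>i\<in>I. a i + c i * x i)(j := a j + c j * y)) \<partial>lborel)"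
      by (rule nn_integral_real_affine) (simp add: insert.prems)
  qed
  also have "\<dots> = ennreal \<bar>c j\<bar> *
     (\<integral>\<^sup>+x. \<integral>\<^sup>+y. f (\<lambda>i\<in>insert j I. a i + c i * (x(j := y)) i) \<partial>lborel \<partial>leb I)"
    unfolding upd by (rule nn_integral_cmult) measurable
  also have "(\<integral>\<^sup>+x. \<integral>\<^sup>+y. f (\<lambda>i\<in>insert j I. a i + c i * (x(j := y)) i) \<partial>lborel \<partial>leb I)
     = (\<integral>\<^sup>+x. f (\<lambda>i\<in>insert j I. a i + c i * x i) \<partial>leb (insert j I))"
    by (rule lebesgue_prod.product_nn_integral_insert[symmetric]) simp_all
  finally have "(\<integral>\<^sup>+x. f x \<partial>leb (insert j I)) = ennreal (\<Prod>i\<in>I. \<bar>c i\<bar>) *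
      (ennreal \<bar>c j\<bar> * (\<integral>\<^sup>+x. f (\<lambda>i\<in>insert j I. a i + c i * x i) \<partial>leb (insert j I)))" .
  moreover have "ennreal (\<Prod>i\<in>insert j I. \<bar>c i\<bar>) = ennreal (\<Prod>i\<in>I. \<bar>c i\<bar>) * ennreal \<bar>c j\<bar>"
    using insert.hyps by (simp add: ennreal_mult'[symmetric] prod_nonneg mult.commute)
  ultimately show ?case by (simp only: mult.assoc)
qed

lemma nn_integral_PiM_translation:
  fixes f :: "('i \<Rightarrow> real) \<Rightarrow> ennreal"
  assumes "finite I" and "f \<in> borel_measurable (leb I)"
  shows "(\<integral>\<^sup>+x. f (\<lambda>i\<in>I. a i + x i) \<partial>leb I) = (\<integral>\<^sup>+x. f x \<partial>leb I)"
  using nn_integral_PiM_affine[OF assms, of "\<lambda>_. 1" a] by simp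

lemma nn_integral_PiM_reflection:
  fixes f :: "('i \<Rightarrow> real) \<Rightarrow> ennreal"
  assumes "finite I" and "f \<in> borel_measurable (leb I)"
  shows "(\<integral>\<^sup>+x. f (\<lambda>i\<in>I. a i - x i) \<partial>leb I) = (\<integral>\<^sup>+x. f x \<partial>leb I)"
  using nn_integral_PiM_affine[OF assms, of "\<lambda>_. -1" a] by simp

lemma nn_integral_PiM_scale:
  fixes f :: "('i \<Rightarrow> real) \<Rightarrow> ennreal"
  assumes "finite I" and "f \<in> borel_measurable (leb I)" and "c > 0"
  shows "(\<integral>\<^sup>+x. f x \<partial>leb I)
    = ennreal (c ^ card I) * (\<integral>\<^sup>+x. f (\<lambda>i\<in>I. c * x i) \<partial>leb I)"
  using nn_integral_PiM_affine[OF assms(1,2), of "\<lambda>_. c" "\<lambda>_. 0"] assms(3) by simp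

section \<open>Coordinates along an orthonormal frame and mass transport\<close>

definition dotp :: "'c set \<Rightarrow> ('c \<Rightarrow> real) \<Rightarrow> ('c \<Rightarrow> real) \<Rightarrow> real" where
  "dotp K x y = (\<Sum>c\<in>K. x c * y c)"

lemma dotp_add_left: "dotp K (\<lambda>c. x c + y c) z = dotp K x z + dotp K y z"
  by (simp add: dotp_def distrib_right sum.distrib)

lemma dotp_diff_left: "dotp K (\<lambda>c. x c - y c) z = dotp K x z - dotp K y z"
  by (simp add: dotp_def left_diff_distrib sum_subtractf)

lemma dotp_scale_left: "dotp K (\<lambda>c. a * x c) z = a * dotp K x z"
  by (simp add: dotp_def sum_distrib_left mult.assoc)

lemma dotp_sum_left: "dotp K (\<lambda>c. \<Sum>p\<in>J. f p c) z = (\<Sum>p\<in>J. dotp K (f p) z)"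
  unfolding dotp_def sum_distrib_right by (rule sum.swap)

lemma dotp_commute: "dotp K x y = dotp K y x"
  by (simp add: dotp_def mult.commute)

lemma dotp_restrict: "dotp K (restrict x K) y = dotp K x y"
  by (simp add: dotp_def)

lemma dotp_self_nonneg: "0 \<le> dotp K x x"
  by (simp add: dotp_def sum_nonneg)

lemmas dotp_left = dotp_add_left dotp_diff_left dotp_scale_left dotp_sum_left

lemma measurable_dotp [measurable (raw)]:
  assumes "\<And>c. c \<in> K \<Longrightarrow> (\<lambda>z. f z c) \<in> borel_measurable M" "\<And>c. c \<in> K \<Longrightarrow> (\<lambda>z. g z c) \<in> borel_measurable M"
  shows "(\<lambda>z. dotp K (f z) (g z)) \<in> borel_measurable M"
  unfolding dotp_def by (intro borel_measurable_sum borel_measurable_times assms)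

locale orthonormal_family =
  fixes K :: "'c set" and J :: "'a set" and e :: "'a \<Rightarrow> 'c \<Rightarrow> real"
  assumes finite_K [simp, intro]: "finite K" and finite_J [simp, intro]: "finite J"
    and orthonormal: "p \<in> J \<Longrightarrow> q \<in> J \<Longrightarrow> dotp K (e p) (e q) = (if p = q then 1 else 0)"
begin

text \<open>
  For an orthonormal family \<open>e\<close> indexed by \<open>J\<close>, a vector splits into its component in the span of
  \<open>e\<close>, recorded by \<open>crd\<close>, and an orthogonal component, of which only the length \<open>resid\<close> matters
  below.
\<close>

definition crd :: "('c \<Rightarrow> real) \<Rightarrow> 'a \<Rightarrow> real" where
  "crd x = (\<lambda>p\<in>J. dotp K x (e p))"

definition resid :: "('c \<Rightarrow> real) \<Rightarrow> real" where
  "resid x = sqrt (dotp K x x - (\<Sum>p\<in>J. (dotp K x (e p))\<^sup>2))"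

lemma dotp_combination:
  assumes "p \<in> J" shows "dotp K (\<lambda>c. \<Sum>q\<in>J. s q * e q c) (e p) = s p"
proof -
  have "dotp K (\<lambda>c. \<Sum>q\<in>J. s q * e q c) (e p) = (\<Sum>q\<in>J. s q * dotp K (e q) (e p))"
    by (simp add: dotp_left)
  also have "\<dots> = (\<Sum>q\<in>J. if q = p then s q else 0)"
    using assms by (intro sum.cong) (auto simp: orthonormal)
  finally show ?thesis using assms by simp
qed

lemma dotp_combination_self:
  "dotp K (\<lambda>c. \<Sum>q\<in>J. s q * e q c) (\<lambda>c. \<Sum>q\<in>J. s q * e q c) = (\<Sum>q\<in>J. (s q)\<^sup>2)"
proof -
  have "dotp K (\<lambda>c. \<Sum>q\<in>J. s q * e q c) (\<lambda>c. \<Sum>q\<in>J. s q * e q c)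
     = (\<Sum>p\<in>J. s p * dotp K (e p) (\<lambda>c. \<Sum>q\<in>J. s q * e q c))" by (simp add: dotp_left)
  also have "\<dots> = (\<Sum>p\<in>J. s p * s p)"
    by (intro sum.cong refl) (subst dotp_commute, simp add: dotp_combination)
  finally show ?thesis by (simp add: power2_eq_square)
qed

lemma dotp_add_self: "dotp K (\<lambda>c. x c + y c) (\<lambda>c. x c + y c) = dotp K x x + 2 * dotp K x y + dotp K y y"
  by (simp add: dotp_left dotp_commute[of K _ "\<lambda>c. x c + y c"]) (simp add: dotp_commute)

lemma resid_sq: "dotp K x x - (\<Sum>p\<in>J. (dotp K x (e p))\<^sup>2)
   = dotp K (\<lambda>c. x c - (\<Sum>p\<in>J. dotp K x (e p) * e p c)) (\<lambda>c. x c - (\<Sum>p\<in>J. dotp K x (e p) * e p c))"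
proof -
  let ?y = "\<lambda>c. \<Sum>p\<in>J. dotp K x (e p) * e p c"
  have "dotp K ?y x = (\<Sum>p\<in>J. (dotp K x (e p))\<^sup>2)"
    by (simp add: dotp_left power2_eq_square) (simp add: dotp_commute)
  moreover have "dotp K (\<lambda>c. x c - ?y c) (\<lambda>c. x c - ?y c) = dotp K x x - 2 * dotp K ?y x + dotp K ?y ?y"
    by (simp add: dotp_left(2) dotp_commute[of K _ "\<lambda>c. x c - ?y c"]) (simp add: dotp_commute)
  ultimately show ?thesis by (simp add: dotp_combination_self)
qed

lemma resid_nonneg [simp]: "0 \<le> resid x"
  unfolding resid_def resid_sq by (simp add: dotp_self_nonneg)

lemma resid_pythagoras: "(resid x)\<^sup>2 + (\<Sum>p\<in>J. (crd x p)\<^sup>2) = dotp K x x"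
proof -
  have "0 \<le> dotp K x x - (\<Sum>p\<in>J. (dotp K x (e p))\<^sup>2)" unfolding resid_sq by (rule dotp_self_nonneg)
  then show ?thesis by (simp add: resid_def crd_def)
qed

lemma crd_translate: "crd (\<lambda>c\<in>K. (\<Sum>q\<in>J. s q * e q c) + x c) = (\<lambda>p\<in>J. crd x p + s p)"
  by (auto simp: crd_def dotp_restrict dotp_add_left dotp_combination fun_eq_iff)

lemma resid_translate: "resid (\<lambda>c\<in>K. (\<Sum>q\<in>J. s q * e q c) + x c) = resid x"
proof -
  let ?z = "\<lambda>c. \<Sum>q\<in>J. s q * e q c"
  have xz: "dotp K ?z x = (\<Sum>q\<in>J. s q * dotp K x (e q))"
    by (simp add: dotp_left) (simp add: dotp_commute)
  have "dotp K (\<lambda>c\<in>K. ?z c + x c) (\<lambda>c\<in>K. ?z c + x c) = dotp K (\<lambda>c. ?z c + x c) (\<lambda>c. ?z c + x c)"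
    by (simp add: dotp_def)
  also have "\<dots> = (\<Sum>q\<in>J. (s q)\<^sup>2) + 2 * (\<Sum>q\<in>J. s q * dotp K x (e q)) + dotp K x x"
    unfolding dotp_add_self dotp_combination_self xz ..
  finally have 1: "dotp K (\<lambda>c\<in>K. ?z c + x c) (\<lambda>c\<in>K. ?z c + x c) = \<dots>" .
  have "(\<Sum>p\<in>J. (dotp K (\<lambda>c\<in>K. ?z c + x c) (e p))\<^sup>2) = (\<Sum>p\<in>J. (s p + dotp K x (e p))\<^sup>2)"
    by (intro sum.cong refl) (simp add: dotp_restrict dotp_add_left dotp_combination)
  also have "\<dots> = (\<Sum>q\<in>J. (s q)\<^sup>2) + 2 * (\<Sum>q\<in>J. s q * dotp K x (e q)) + (\<Sum>p\<in>J. (dotp K x (e p))\<^sup>2)"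
    by (simp add: power2_sum sum.distrib sum_distrib_left algebra_simps)
  finally show ?thesis unfolding resid_def 1 by simp
qed

lemma crd_scale: "crd (\<lambda>c\<in>K. t * x c) = (\<lambda>p\<in>J. t * crd x p)"
  by (auto simp: crd_def dotp_restrict dotp_scale_left fun_eq_iff)

lemma resid_scale: "t \<ge> 0 \<Longrightarrow> resid (\<lambda>c\<in>K. t * x c) = t * resid x"
proof -
  assume "t \<ge> 0"
  have "dotp K (\<lambda>c\<in>K. t * x c) (\<lambda>c\<in>K. t * x c) - (\<Sum>p\<in>J. (dotp K (\<lambda>c\<in>K. t * x c) (e p))\<^sup>2)
     = t\<^sup>2 * (dotp K x x - (\<Sum>p\<in>J. (dotp K x (e p))\<^sup>2))"
    unfolding dotp_restrict dotp_scale_left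
    by (simp add: dotp_def sum_distrib_left power2_eq_square right_diff_distrib mult_ac)
  then show ?thesis unfolding resid_def using \<open>t \<ge> 0\<close> by (simp add: real_sqrt_mult)
qed

lemma measurable_crd_component [measurable]:
  "p \<in> J \<Longrightarrow> (\<lambda>x. crd x p) \<in> borel_measurable (leb K)"
  unfolding crd_def by simp measurable

lemma measurable_crd [measurable]: "crd \<in> leb K \<rightarrow>\<^sub>M leb J"
  unfolding crd_def by measurable

lemma measurable_resid [measurable]: "resid \<in> borel_measurable (leb K)"
  unfolding resid_def by measurable

text \<open>
  Translating \<open>x\<close> along the frame changes \<open>crd x\<close> by the translation vector and leaves \<open>resid x\<close>
  alone. So the integral of \<open>F (u, \<rho>) H (u + s, \<rho>)\<close> over \<open>x\<close> and \<open>s\<close>, where \<open>u = crd x\<close> and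
  \<open>\<rho> = resid x\<close>, can be evaluated by integrating over \<open>s\<close> first, either directly or after shifting
  \<open>x\<close> by \<open>-s\<close>. The two results are the two sides. The identity says that the joint law of \<open>(u, \<rho>)\<close>
  is a product with Lebesgue measure in \<open>u\<close>, and it makes a rotation of the frame to coordinate
  axes unnecessary.
\<close>

lemma mass_transport:
  fixes F H :: "('a \<Rightarrow> real) \<times> real \<Rightarrow> ennreal"
  assumes [measurable]: "F \<in> borel_measurable (leb J \<Otimes>\<^sub>M borel)"
    and [measurable]: "H \<in> borel_measurable (leb J \<Otimes>\<^sub>M borel)"
  shows "(\<integral>\<^sup>+x. F (crd x, resid x) * (\<integral>\<^sup>+s. H (s, resid x) \<partial>leb J) \<partial>leb K)
       = (\<integral>\<^sup>+x. H (crd x, resid x) * (\<integral>\<^sup>+s. F (s, resid x) \<partial>leb J) \<partial>leb K)"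
proof -
  interpret KJ: pair_sigma_finite "leb J" "leb K"
    by (intro pair_sigma_finite.intro sigma_finite_leb) auto
  have plus [measurable]: "(\<lambda>z. \<lambda>p\<in>J. crd (snd z) p + fst z p) \<in> leb J \<Otimes>\<^sub>M leb K \<rightarrow>\<^sub>M leb J"
    by measurable
  have minus [measurable]: "(\<lambda>z. \<lambda>p\<in>J. crd (snd z) p - fst z p) \<in> leb J \<Otimes>\<^sub>M leb K \<rightarrow>\<^sub>M leb J"
    by measurable
  have plus' [measurable]: "(\<lambda>s. \<lambda>p\<in>J. crd x p + s p) \<in> leb J \<rightarrow>\<^sub>M leb J" for x
    by measurable
  have minus' [measurable]: "(\<lambda>s. \<lambda>p\<in>J. crd x p - s p) \<in> leb J \<rightarrow>\<^sub>M leb J" for x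
    by measurable
  have minus'' [measurable]: "(\<lambda>x. \<lambda>p\<in>J. crd x p - s p) \<in> leb K \<rightarrow>\<^sub>M leb J" for s
    by measurable
  have "(\<integral>\<^sup>+x. F (crd x, resid x) * (\<integral>\<^sup>+s. H (s, resid x) \<partial>leb J) \<partial>leb K)
     = (\<integral>\<^sup>+x. (\<integral>\<^sup>+s. F (crd x, resid x) * H (\<lambda>p\<in>J. crd x p + s p, resid x) \<partial>leb J) \<partial>leb K)"
  proof (rule nn_integral_cong)
    fix x assume "x \<in> space (leb K)"
    have "(\<integral>\<^sup>+s. H (s, resid x) \<partial>leb J) = (\<integral>\<^sup>+s. H (\<lambda>p\<in>J. crd x p + s p, resid x) \<partial>leb J)"
      by (rule nn_integral_PiM_translation[symmetric, where f = "\<lambda>s. H (s, resid x)"]) (auto intro!: finite_J)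
    then show "F (crd x, resid x) * (\<integral>\<^sup>+s. H (s, resid x) \<partial>leb J)
       = (\<integral>\<^sup>+s. F (crd x, resid x) * H (\<lambda>p\<in>J. crd x p + s p, resid x) \<partial>leb J)"
      by (simp add: nn_integral_cmult)
  qed
  also have "\<dots> = (\<integral>\<^sup>+s. (\<integral>\<^sup>+x. F (crd x, resid x) * H (\<lambda>p\<in>J. crd x p + s p, resid x) \<partial>leb K) \<partial>leb J)"
    by (rule KJ.Fubini') measurable
  also have "\<dots> = (\<integral>\<^sup>+s. (\<integral>\<^sup>+x. F (\<lambda>p\<in>J. crd x p - s p, resid x) * H (crd x, resid x) \<partial>leb K) \<partial>leb J)"
  proof (rule nn_integral_cong)
    fix s :: "'a \<Rightarrow> real"
    define g where "g x = F (\<lambda>p\<in>J. crd x p - s p, resid x) * H (crd x, resid x)" for x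
    have [measurable]: "g \<in> borel_measurable (leb K)" unfolding g_def by measurable
    have "(\<lambda>p\<in>J. crd (\<lambda>c\<in>K. (\<Sum>q\<in>J. s q * e q c) + x c) p - s p) = crd x" for x
      unfolding crd_translate by (auto simp: crd_def)
    then have "g (\<lambda>c\<in>K. (\<Sum>q\<in>J. s q * e q c) + x c)
        = F (crd x, resid x) * H (\<lambda>p\<in>J. crd x p + s p, resid x)" for x
      unfolding g_def resid_translate by (simp add: crd_translate)
    then show "(\<integral>\<^sup>+x. F (crd x, resid x) * H (\<lambda>p\<in>J. crd x p + s p, resid x) \<partial>leb K)
        = (\<integral>\<^sup>+x. F (\<lambda>p\<in>J. crd x p - s p, resid x) * H (crd x, resid x) \<partial>leb K)"
      using nn_integral_PiM_translation[of K g "\<lambda>c. \<Sum>q\<in>J. s q * e q c"] by (simp add: g_def)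
  qed
  also have "\<dots> = (\<integral>\<^sup>+x. (\<integral>\<^sup>+s. F (\<lambda>p\<in>J. crd x p - s p, resid x) * H (crd x, resid x) \<partial>leb J) \<partial>leb K)"
    by (rule KJ.Fubini'[symmetric]) measurable
  also have "\<dots> = (\<integral>\<^sup>+x. H (crd x, resid x) * (\<integral>\<^sup>+s. F (s, resid x) \<partial>leb J) \<partial>leb K)"
  proof (rule nn_integral_cong)
    fix x assume "x \<in> space (leb K)"
    have "(\<integral>\<^sup>+s. F (\<lambda>p\<in>J. crd x p - s p, resid x) \<partial>leb J) = (\<integral>\<^sup>+s. F (s, resid x) \<partial>leb J)"
      by (rule nn_integral_PiM_reflection[where f = "\<lambda>s. F (s, resid x)"]) (auto intro!: finite_J)
    then show "(\<integral>\<^sup>+s. F (\<lambda>p\<in>J. crd x p - s p, resid x) * H (crd x, resid x) \<partial>leb J)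
       = H (crd x, resid x) * (\<integral>\<^sup>+s. F (s, resid x) \<partial>leb J)"
      by (subst nn_integral_multc) (simp_all add: mult.commute)
  qed
  finally show ?thesis .
qed

end

section \<open>Gnomonic projection of the unit ball\<close>

text \<open>
  The cosine of the angle between \<open>e\<close> and \<open>e + (\<Sum>p\<in>J. w p * f p)\<close> when \<open>e\<close> and the \<open>f p\<close> are
  orthonormal. A unit vector with gnomonic coordinates \<open>w\<close> has this number as its residual.
\<close>

definition cosine :: "'a set \<Rightarrow> ('a \<Rightarrow> real) \<Rightarrow> real" where
  "cosine J w = 1 / sqrt (1 + (\<Sum>p\<in>J. (w p)\<^sup>2))"

lemma cosine_pos: "0 < cosine J w"
  unfolding cosine_def by (simp add: add_pos_nonneg sum_nonneg)

lemma cosine_le_1: "cosine J w \<le> 1"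
proof -
  have "1 \<le> sqrt (1 + (\<Sum>p\<in>J. (w p)\<^sup>2))" by (simp add: sum_nonneg)
  then show ?thesis unfolding cosine_def by (subst divide_le_eq_1_pos) auto
qed

lemma le_cosine_iff: "r \<ge> 0 \<Longrightarrow> r \<le> cosine J w \<longleftrightarrow> r\<^sup>2 + (\<Sum>p\<in>J. (r * w p)\<^sup>2) \<le> 1"
proof -
  assume r: "r \<ge> 0"
  define D where "D = 1 + (\<Sum>p\<in>J. (w p)\<^sup>2)"
  have D: "D > 0" unfolding D_def by (simp add: add_pos_nonneg sum_nonneg)
  have "r \<le> cosine J w \<longleftrightarrow> r * sqrt D \<le> 1"
    using D by (simp add: cosine_def D_def[symmetric] pos_le_divide_eq)
  also have "\<dots> \<longleftrightarrow> (r * sqrt D)\<^sup>2 \<le> 1\<^sup>2"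
    using r D by (subst power_mono_iff) auto
  also have "(r * sqrt D)\<^sup>2 = r\<^sup>2 + (\<Sum>p\<in>J. (r * w p)\<^sup>2)"
    using D by (simp add: power_mult_distrib) (simp add: D_def distrib_left sum_distrib_left)
  finally show ?thesis by simp
qed

lemma measurable_cosine [measurable]: "cosine J \<in> borel_measurable (leb J)"
  unfolding cosine_def by measurable

lemma emeasure_cube:
  assumes "finite J" "c \<ge> 0"
  shows "emeasure (leb J) (Pi\<^sub>E J (\<lambda>_. {0..c})) = ennreal (c ^ card J)"
  using assms by (subst lebesgue_prod.emeasure_PiM) (auto simp: prod_ennreal ennreal_power)

lemma sets_cube [measurable]: "finite J \<Longrightarrow> Pi\<^sub>E J (\<lambda>_. {0..c::real}) \<in> sets (leb J)"
  by (rule sets_PiM_I_finite) auto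

context orthonormal_family
begin

text \<open>
  The span of the frame, where \<open>resid\<close> vanishes, is invariant under dilations and under
  translations along the frame. Let \<open>V c\<close> be the volume of its part with all coordinates in
  \<open>[0, c]\<close>. By the mass transport identity \<open>V 2 = 2 ^ card J * V 1\<close>, while dilation by \<open>2\<close> gives
  \<open>V 2 = 2 ^ card K * V 1\<close>. As \<open>V 1\<close> is finite, it is \<open>0\<close>, and a further mass transport extends
  this from the cube to the whole span.
\<close>

lemma AE_resid_pos:
  assumes "card J < card K"
  shows "AE x in leb K. 0 < resid x"
proof -
  define F :: "real \<Rightarrow> ('a \<Rightarrow> real) \<times> real \<Rightarrow> ennreal" where
    "F c = (\<lambda>(s, r). indicator (Pi\<^sub>E J (\<lambda>_. {0..c})) s * indicator {0} r)" for c
  have [measurable]: "F c \<in> borel_measurable (leb J \<Otimes>\<^sub>M borel)" for c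
    unfolding F_def by measurable
  \<comment> \<open>the volume of a cube in the span of the frame\<close>
  define V where "V c = (\<integral>\<^sup>+x. F c (crd x, resid x) \<partial>leb K)" for c
  have intF: "(\<integral>\<^sup>+s. F c (s, r) \<partial>leb J) = ennreal (c ^ card J) * indicator {0} r" if "c \<ge> 0" for c r
    unfolding F_def using that by (simp add: nn_integral_multc emeasure_cube)
  have idem: "F c (s, r) * indicator {0} r = F c (s, r)" for c s r
    by (auto simp: F_def split: split_indicator)
  have "V 2 = (\<integral>\<^sup>+x. F 2 (crd x, resid x) * (\<integral>\<^sup>+s. F 1 (s, resid x) \<partial>leb J) \<partial>leb K)"
    by (simp add: V_def intF idem)
  also have "\<dots> = (\<integral>\<^sup>+x. F 1 (crd x, resid x) * (\<integral>\<^sup>+s. F 2 (s, resid x) \<partial>leb J) \<partial>leb K)"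
    by (rule mass_transport) measurable
  also have "\<dots> = (\<integral>\<^sup>+x. ennreal (2 ^ card J) * F 1 (crd x, resid x) \<partial>leb K)"
    by (intro nn_integral_cong) (simp add: intF mult.left_commute[of _ "ennreal _"] idem)
  also have "\<dots> = ennreal (2 ^ card J) * V 1"
    unfolding V_def by (rule nn_integral_cmult) measurable
  finally have V2: "V 2 = ennreal (2 ^ card J) * V 1" .
  have "V 2 = ennreal (2 ^ card K) * (\<integral>\<^sup>+x. F 2 (crd (\<lambda>c\<in>K. 2 * x c), resid (\<lambda>c\<in>K. 2 * x c)) \<partial>leb K)"
    unfolding V_def by (rule nn_integral_PiM_scale) auto
  also have "(\<integral>\<^sup>+x. F 2 (crd (\<lambda>c\<in>K. 2 * x c), resid (\<lambda>c\<in>K. 2 * x c)) \<partial>leb K) = V 1"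
    unfolding V_def by (intro nn_integral_cong)
      (auto simp: crd_scale resid_scale F_def PiE_iff crd_def dotp_restrict dotp_scale_left split: split_indicator)
  finally have V2': "V 2 = ennreal (2 ^ card K) * V 1" .
  have "V 1 \<le> (\<integral>\<^sup>+x. indicator ({f. sqrt (\<Sum>i\<in>K. (f i)\<^sup>2) \<le> sqrt (1 + real (card J))}
        \<inter> space (leb K)) x \<partial>leb K)"
    unfolding V_def
  proof (rule nn_integral_mono)
    fix x assume x: "x \<in> space (leb K)"
    have "dotp K x x \<le> 1 + real (card J)"
      if "crd x \<in> Pi\<^sub>E J (\<lambda>_. {0..1})" and "resid x = 0"
    proof -
      have "(\<Sum>p\<in>J. (crd x p)\<^sup>2) \<le> (\<Sum>p\<in>J. 1)"
        by (rule sum_mono) (use that in \<open>auto simp: PiE_iff abs_square_le_1 power_le_one\<close>)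
      then show ?thesis using resid_pythagoras[of x] that by simp
    qed
    then show "F 1 (crd x, resid x) \<le> indicator ({f. sqrt (\<Sum>i\<in>K. (f i)\<^sup>2) \<le> sqrt (1 + real (card J))}
        \<inter> space (leb K)) x"
      using x by (auto simp: F_def dotp_def power2_eq_square split: split_indicator)
  qed
  also have "\<dots> = emeasure (leb K) ({f. sqrt (\<Sum>i\<in>K. (f i)\<^sup>2) \<le> sqrt (1 + real (card J))}
        \<inter> space (leb K))"
    by (rule nn_integral_indicator) measurable
  also have "\<dots> < \<infinity>"
    by (subst emeasure_cball_aux) auto
  finally obtain v where v: "V 1 = ennreal v" "v \<ge> 0" by (cases "V 1") auto
  have "2 ^ card K * v = 2 ^ card J * v"
    using V2 V2' v by (simp add: ennreal_mult'[symmetric])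
  moreover have "(2::real) ^ card J < 2 ^ card K" using assms by simp
  ultimately have "v = 0" by auto
  then have F1: "AE x in leb K. F 1 (crd x, resid x) = 0"
  proof -
    have "(\<integral>\<^sup>+x. F 1 (crd x, resid x) \<partial>leb K) = 0" using v(1) \<open>v = 0\<close> by (simp add: V_def)
    then show ?thesis by (subst (asm) nn_integral_0_iff_AE) auto
  qed
  let ?G = "\<lambda>(s :: 'a \<Rightarrow> real, r :: real). indicator {0} r :: ennreal"
  have "(\<integral>\<^sup>+x. ?G (crd x, resid x) * (\<integral>\<^sup>+s. F 1 (s, resid x) \<partial>leb J) \<partial>leb K)
    = (\<integral>\<^sup>+x. F 1 (crd x, resid x) * (\<integral>\<^sup>+s. ?G (s, resid x) \<partial>leb J) \<partial>leb K)"
    by (rule mass_transport) measurable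
  also have "\<dots> = 0" using F1 by (subst nn_integral_0_iff_AE) auto
  finally have "(\<integral>\<^sup>+x. indicator {0} (resid x) \<partial>leb K) = 0"
    by (subst (asm) nn_integral_cong[where v = "\<lambda>x. indicator {0} (resid x)"])
       (auto simp: intF split: split_indicator)
  then have "AE x in leb K. indicator {0} (resid x) = (0 :: ennreal)"
    by (subst (asm) nn_integral_0_iff_AE) auto
  then show ?thesis
    by eventually_elim (use resid_nonneg in \<open>auto simp: less_le split: split_indicator_asm\<close>)
qed

text \<open>
  Mass transport replaces the integral over \<open>x\<close> by one over \<open>x\<close> in a cube of side \<open>\<rho> = resid x\<close> in
  the frame directions, and over a free coordinate vector \<open>s = \<rho> w\<close>. In terms of \<open>w\<close> the ball is
  the condition \<open>\<rho> \<le> cosine J w\<close>, and since everything else is invariant under dilations, the \<open>x\<close>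
  with \<open>\<rho> \<le> t\<close> contribute a volume proportional to \<open>t ^ card K\<close>.
\<close>

lemma ball_projection:
  assumes "card J < card K"
  obtains C where "\<And>f. f \<in> borel_measurable (leb J) \<Longrightarrow>
     (\<integral>\<^sup>+x. f (\<lambda>p\<in>J. crd x p / resid x) * indicator {..1} (dotp K x x) \<partial>leb K)
      = C * (\<integral>\<^sup>+w. f w * ennreal (cosine J w ^ card K) \<partial>leb J)"
proof -
  define Q where "Q = Pi\<^sub>E J (\<lambda>_. {0..1::real})"
  have [measurable]: "Q \<in> sets (leb J)" unfolding Q_def by (rule sets_cube) simp
  define V where "V t = (\<integral>\<^sup>+x. indicator {0<..t} (resid x) * indicator Q (\<lambda>p\<in>J. crd x p / resid x)
      \<partial>leb K)" for t :: real
  have ratio [measurable]: "(\<lambda>x. \<lambda>p\<in>J. crd x p / resid x) \<in> leb K \<rightarrow>\<^sub>M leb J"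
    by measurable
  have ratio_scale: "(\<lambda>p\<in>J. crd (\<lambda>c\<in>K. t * x c) p / resid (\<lambda>c\<in>K. t * x c)) = (\<lambda>p\<in>J. crd x p / resid x)"
    if "t > 0" for t x using that by (auto simp: crd_scale resid_scale)
  have V_scale: "V t = ennreal (t ^ card K) * V 1" if t: "t > 0" for t
  proof -
    have "V t = ennreal (t ^ card K) * (\<integral>\<^sup>+x. indicator {0<..t} (resid (\<lambda>c\<in>K. t * x c)) *
        indicator Q (\<lambda>p\<in>J. crd (\<lambda>c\<in>K. t * x c) p / resid (\<lambda>c\<in>K. t * x c)) \<partial>leb K)"
      unfolding V_def by (rule nn_integral_PiM_scale) (use t in auto)
    also have "(\<integral>\<^sup>+x. indicator {0<..t} (resid (\<lambda>c\<in>K. t * x c)) *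
        indicator Q (\<lambda>p\<in>J. crd (\<lambda>c\<in>K. t * x c) p / resid (\<lambda>c\<in>K. t * x c)) \<partial>leb K) = V 1"
      unfolding V_def ratio_scale[OF t]
      by (intro nn_integral_cong)
         (use t in \<open>auto simp: resid_scale zero_less_mult_iff split: split_indicator\<close>)
    finally show ?thesis .
  qed
  show thesis
  proof (rule that[of "V 1"])
    fix f :: "('a \<Rightarrow> real) \<Rightarrow> ennreal"
    assume f [measurable]: "f \<in> borel_measurable (leb J)"
    have ratio' [measurable]: "(\<lambda>z. \<lambda>p\<in>J. fst z p / snd z) \<in> leb J \<Otimes>\<^sub>M borel \<rightarrow>\<^sub>M leb J"
      by measurable
    have ratio'' [measurable]: "(\<lambda>z. \<lambda>p\<in>J. z p / r) \<in> leb J \<rightarrow>\<^sub>M leb J" for r :: real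
      by measurable
    \<comment> \<open>the function to be integrated, in terms of coordinates and residual; the last factor is the unit ball\<close>
    define F where "F = (\<lambda>z :: ('a \<Rightarrow> real) \<times> real. indicator {0<..} (snd z) * f (\<lambda>p\<in>J. fst z p / snd z)
        * indicator {..1} ((snd z)\<^sup>2 + (\<Sum>p\<in>J. (fst z p)\<^sup>2)))"
    \<comment> \<open>the average over a cube of side \<open>\<rho>\<close>, which has total mass \<open>1\<close> for every residual \<open>\<rho> > 0\<close>\<close>
    define H where "H = (\<lambda>z :: ('a \<Rightarrow> real) \<times> real. indicator {0<..} (snd z) * ennreal ((1 / snd z) ^ card J)
        * indicator Q (\<lambda>p\<in>J. fst z p / snd z))"
    have [measurable]: "F \<in> borel_measurable (leb J \<Otimes>\<^sub>M borel)" unfolding F_def by measurable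
    have [measurable]: "H \<in> borel_measurable (leb J \<Otimes>\<^sub>M borel)" unfolding H_def by measurable
    have unscale: "(\<lambda>p\<in>J. (\<lambda>p\<in>J. r * w p) p / r) = w" if "r > 0" "w \<in> space (leb J)" for r w
      using that by (auto simp: space_PiM PiE_iff extensional_def)
    have intH: "(\<integral>\<^sup>+s. H (s, r) \<partial>leb J) = indicator {0<..} r" for r
    proof (cases "r > 0")
      case True
      have "(\<integral>\<^sup>+s. H (s, r) \<partial>leb J)
          = ennreal (r ^ card J) * (\<integral>\<^sup>+s. H (\<lambda>p\<in>J. r * s p, r) \<partial>leb J)"
        by (rule nn_integral_PiM_scale) (use True in auto)
      also have "(\<integral>\<^sup>+s. H (\<lambda>p\<in>J. r * s p, r) \<partial>leb J)
          = (\<integral>\<^sup>+s. ennreal ((1 / r) ^ card J) * indicator Q s \<partial>leb J)"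
        by (intro nn_integral_cong) (use True in \<open>simp only: H_def unscale fst_conv snd_conv, simp\<close>)
      also have "\<dots> = ennreal ((1 / r) ^ card J)"
        by (subst nn_integral_cmult_indicator) (simp_all add: Q_def emeasure_cube)
      also have "ennreal (r ^ card J) * \<dots> = 1"
        using True by (simp add: ennreal_mult'[symmetric] power_one_over)
      finally show ?thesis using True by simp
    qed (simp add: H_def)
    have intF: "(\<integral>\<^sup>+s. F (s, r) \<partial>leb J)
        = ennreal (r ^ card J) * (\<integral>\<^sup>+w. f w * indicator {..cosine J w} r \<partial>leb J)" if r: "r > 0" for r
    proof -
      have "(\<integral>\<^sup>+s. F (s, r) \<partial>leb J)
          = ennreal (r ^ card J) * (\<integral>\<^sup>+s. F (\<lambda>p\<in>J. r * s p, r) \<partial>leb J)"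
        by (rule nn_integral_PiM_scale) (use r in auto)
      also have "(\<integral>\<^sup>+s. F (\<lambda>p\<in>J. r * s p, r) \<partial>leb J)
          = (\<integral>\<^sup>+w. f w * indicator {..cosine J w} r \<partial>leb J)"
        by (intro nn_integral_cong)
           (use r in \<open>simp only: F_def unscale fst_conv snd_conv, simp add: indicator_def le_cosine_iff\<close>)
      finally show ?thesis .
    qed
    interpret KJ: pair_sigma_finite "leb J" "leb K"
      by (intro pair_sigma_finite.intro sigma_finite_leb) auto
    have "(\<integral>\<^sup>+x. f (\<lambda>p\<in>J. crd x p / resid x) * indicator {..1} (dotp K x x) \<partial>leb K)
        = (\<integral>\<^sup>+x. F (crd x, resid x) * (\<integral>\<^sup>+s. H (s, resid x) \<partial>leb J) \<partial>leb K)"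
      using AE_resid_pos[OF assms]
      by (intro nn_integral_cong_AE) (auto simp: intH F_def resid_pythagoras)
    also have "\<dots> = (\<integral>\<^sup>+x. H (crd x, resid x) * (\<integral>\<^sup>+s. F (s, resid x) \<partial>leb J) \<partial>leb K)"
      by (rule mass_transport) measurable
    also have "\<dots> = (\<integral>\<^sup>+x. (\<integral>\<^sup>+w. f w * (indicator {0<..cosine J w} (resid x) *
        indicator Q (\<lambda>p\<in>J. crd x p / resid x)) \<partial>leb J) \<partial>leb K)"
    proof (intro nn_integral_cong)
      fix x
      show "H (crd x, resid x) * (\<integral>\<^sup>+s. F (s, resid x) \<partial>leb J)
        = (\<integral>\<^sup>+w. f w * (indicator {0<..cosine J w} (resid x) *
        indicator Q (\<lambda>p\<in>J. crd x p / resid x)) \<partial>leb J)"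
      proof (cases "resid x > 0")
        case True
        have "H (crd x, resid x) * (\<integral>\<^sup>+s. F (s, resid x) \<partial>leb J)
           = (ennreal ((1 / resid x) ^ card J) * ennreal (resid x ^ card J)) * indicator Q (\<lambda>p\<in>J. crd x p / resid x)
              * (\<integral>\<^sup>+w. f w * indicator {..cosine J w} (resid x) \<partial>leb J)"
          using True by (simp add: intF H_def mult_ac)
        also have "ennreal ((1 / resid x) ^ card J) * ennreal (resid x ^ card J) = 1"
          using True by (simp add: ennreal_mult'[symmetric] power_one_over)
        also have "1 * indicator Q (\<lambda>p\<in>J. crd x p / resid x)
              * (\<integral>\<^sup>+w. f w * indicator {..cosine J w} (resid x) \<partial>leb J)
            = (\<integral>\<^sup>+w. indicator Q (\<lambda>p\<in>J. crd x p / resid x) * (f w * indicator {..cosine J w} (resid x)) \<partial>leb J)"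
          by (subst nn_integral_cmult) (simp_all add: indicator_def)
        also have "\<dots> = (\<integral>\<^sup>+w. f w * (indicator {0<..cosine J w} (resid x) *
            indicator Q (\<lambda>p\<in>J. crd x p / resid x)) \<partial>leb J)"
          using True by (intro nn_integral_cong) (auto split: split_indicator)
        finally show ?thesis .
      qed (simp add: H_def)
    qed
    also have "\<dots> = (\<integral>\<^sup>+w. (\<integral>\<^sup>+x. f w * (indicator {0<..cosine J w} (resid x) *
        indicator Q (\<lambda>p\<in>J. crd x p / resid x)) \<partial>leb K) \<partial>leb J)"
      by (rule KJ.Fubini') (simp add: indicator_def)
    also have "\<dots> = (\<integral>\<^sup>+w. f w * V (cosine J w) \<partial>leb J)"
      unfolding V_def by (intro nn_integral_cong nn_integral_cmult) measurable
    also have "\<dots> = (\<integral>\<^sup>+w. V 1 * (f w * ennreal (cosine J w ^ card K)) \<partial>leb J)"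
      by (intro nn_integral_cong) (simp add: V_scale[OF cosine_pos] mult_ac)
    also have "\<dots> = V 1 * (\<integral>\<^sup>+w. f w * ennreal (cosine J w ^ card K) \<partial>leb J)"
      by (rule nn_integral_cmult) measurable
    finally show "(\<integral>\<^sup>+x. f (\<lambda>p\<in>J. crd x p / resid x) * indicator {..1} (dotp K x x) \<partial>leb K)
      = V 1 * (\<integral>\<^sup>+w. f w * ennreal (cosine J w ^ card K) \<partial>leb J)" .
  qed
qed

end

section \<open>The uniform distribution on the sphere\<close>

lemma sets_leb: "sets (leb I) = sets (Pi\<^sub>M I (\<lambda>_. borel))"
  by (intro sets_PiM_cong) auto

lemma L2_set_eq_dotp: "L2_set x K = sqrt (dotp K x x)"
  by (simp add: L2_set_def dotp_def power2_eq_square)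

lemma dotp_normalized: "dotp K (\<lambda>i\<in>K. x i / r) (\<lambda>i\<in>K. x i / r) = dotp K x x / r\<^sup>2"
  by (simp add: dotp_def sum_divide_distrib power2_eq_square)

lemma sets_punctured_ball [measurable]: "punctured_ball n \<in> sets (leb {..<n})"
proof -
  have "punctured_ball n = {x \<in> space (leb {..<n}). 0 < sqrt (dotp {..<n} x x) \<and> sqrt (dotp {..<n} x x) \<le> 1}"
    by (auto simp: punctured_ball_def L2_set_eq_dotp space_PiM)
  also have "\<dots> \<in> sets (leb {..<n})" by measurable
  finally show ?thesis .
qed

lemma AE_dotp_pos:
  fixes n :: nat
  assumes "n > 0"
  shows "AE x in leb {..<n}. 0 < dotp {..<n} x x"
proof -
  interpret orthonormal_family "{..<n}" "{} :: unit set" "\<lambda>_ _. 0" by standard auto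
  show ?thesis using AE_resid_pos assms by (simp add: resid_def)
qed

lemma AE_mem_punctured_ball_iff:
  assumes "n > 0"
  shows "AE x in leb {..<n}. x \<in> punctured_ball n \<longleftrightarrow> dotp {..<n} x x \<le> 1"
  using AE_dotp_pos[OF assms] AE_space
  by eventually_elim (auto simp: punctured_ball_def L2_set_eq_dotp space_PiM)

lemma emeasure_punctured_ball:
  assumes "n > 0"
  shows "emeasure (leb {..<n}) (punctured_ball n) \<noteq> 0"
    and "emeasure (leb {..<n}) (punctured_ball n) \<noteq> \<infinity>"
proof -
  have "emeasure (leb {..<n}) (punctured_ball n)
      = emeasure (leb {..<n}) ({f. sqrt (\<Sum>i\<in>{..<n}. (f i)\<^sup>2) \<le> 1} \<inter> space (leb {..<n}))"
    using AE_mem_punctured_ball_iff[OF assms]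
    by (intro emeasure_eq_AE) (auto elim!: eventually_mono simp: dotp_def power2_eq_square)
  also have "\<dots> = ennreal (unit_ball_vol (real n))"
    by (subst emeasure_cball_aux) auto
  finally have "emeasure (leb {..<n}) (punctured_ball n) = ennreal (unit_ball_vol (real n))" .
  moreover have "\<not> unit_ball_vol (real n) \<le> 0" using unit_ball_vol_pos[of "real n"] by linarith
  ultimately show "emeasure (leb {..<n}) (punctured_ball n) \<noteq> 0"
    and "emeasure (leb {..<n}) (punctured_ball n) \<noteq> \<infinity>"
    by (simp_all add: ennreal_eq_0_iff)
qed

lemma measurable_normalize:
  "(\<lambda>x. \<lambda>i\<in>{..<n}. x i / L2_set x {..<n})
    \<in> restrict_space (uniform_measure (leb {..<n}) (punctured_ball n)) (punctured_ball n)
     \<rightarrow>\<^sub>M restrict_space (Pi\<^sub>M {..<n} (\<lambda>_. borel)) (unit_sphere n)"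
proof (rule measurable_restrict_space2)
  show "(\<lambda>x. \<lambda>i\<in>{..<n}. x i / L2_set x {..<n})
     \<in> space (restrict_space (uniform_measure (leb {..<n}) (punctured_ball n)) (punctured_ball n)) \<rightarrow> unit_sphere n"
    by (auto simp: unit_sphere_def punctured_ball_def space_restrict_space L2_set_eq_dotp dotp_normalized)
  have "(\<lambda>x. \<lambda>i\<in>{..<n}. x i / L2_set x {..<n}) \<in> leb {..<n} \<rightarrow>\<^sub>M Pi\<^sub>M {..<n} (\<lambda>_. borel)"
    unfolding L2_set_eq_dotp by measurable
  then show "(\<lambda>x. \<lambda>i\<in>{..<n}. x i / L2_set x {..<n}) \<in>
      restrict_space (uniform_measure (leb {..<n}) (punctured_ball n)) (punctured_ball n)
      \<rightarrow>\<^sub>M Pi\<^sub>M {..<n} (\<lambda>_. borel)"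
    by (intro measurable_restrict_space1) simp
qed

lemma prob_space_uniform_sphere:
  assumes "n > 0" shows "prob_space (uniform_sphere n)"
proof -
  note e = emeasure_punctured_ball[OF assms]
  interpret prob_space "uniform_measure (leb {..<n}) (punctured_ball n)"
    by (rule prob_space_uniform_measure) (use e in auto)
  have "prob_space (restrict_space (uniform_measure (leb {..<n}) (punctured_ball n)) (punctured_ball n))"
    by (rule prob_space_restrict_space) (use e in \<open>auto simp: ennreal_divide_self top.not_eq_extremum\<close>)
  then show ?thesis unfolding uniform_sphere_def
    by (rule prob_space.prob_space_distr) (rule measurable_normalize)
qed

lemma sets_uniform_sphere [measurable_cong]:
  "sets (uniform_sphere n) = sets (restrict_space (leb {..<n}) (unit_sphere n))"
  unfolding uniform_sphere_def using sets_leb[of "{..<n}"]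
  by (simp add: sets_restrict_space)

lemma space_uniform_sphere: "space (uniform_sphere n) = unit_sphere n"
  by (auto simp: uniform_sphere_def space_restrict_space space_PiM unit_sphere_def)

lemma measurable_uniform_sphereI:
  "f \<in> leb {..<n} \<rightarrow>\<^sub>M M \<Longrightarrow> f \<in> uniform_sphere n \<rightarrow>\<^sub>M M"
  by (subst measurable_cong_sets[OF sets_uniform_sphere refl]) (rule measurable_restrict_space1)

lemma nn_integral_uniform_sphere:
  assumes n: "n > 0" and f [measurable]: "f \<in> borel_measurable (leb {..<n})"
  shows "(\<integral>\<^sup>+v. f v \<partial>uniform_sphere n)
    = (\<integral>\<^sup>+x. f (\<lambda>i\<in>{..<n}. x i / sqrt (dotp {..<n} x x)) * indicator {..1} (dotp {..<n} x x) \<partial>leb {..<n})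
       / emeasure (leb {..<n}) (punctured_ball n)"
proof -
  let ?B = "punctured_ball n" and ?P = "leb {..<n}"
  let ?N = "\<lambda>x. \<lambda>i\<in>{..<n}. x i / L2_set x {..<n}"
  have N [measurable]: "?N \<in> ?P \<rightarrow>\<^sub>M ?P" unfolding L2_set_eq_dotp by measurable
  have "f \<in> borel_measurable (Pi\<^sub>M {..<n} (\<lambda>_. borel))"
    using f by (subst measurable_cong_sets[OF sets_leb[symmetric] refl])
  then have "(\<integral>\<^sup>+v. f v \<partial>uniform_sphere n) = (\<integral>\<^sup>+x. f (?N x) \<partial>restrict_space (uniform_measure ?P ?B) ?B)"
    unfolding uniform_sphere_def
    by (intro nn_integral_distr measurable_normalize) (simp add: measurable_restrict_space1)
  also have "\<dots> = (\<integral>\<^sup>+x. f (?N x) * indicator ?B x \<partial>uniform_measure ?P ?B)"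
    by (rule nn_integral_restrict_space) simp
  also have "\<dots> = (\<integral>\<^sup>+x. f (?N x) * indicator ?B x * indicator ?B x \<partial>?P) / emeasure ?P ?B"
    by (rule nn_integral_uniform_measure) measurable
  also have "(\<integral>\<^sup>+x. f (?N x) * indicator ?B x * indicator ?B x \<partial>?P)
      = (\<integral>\<^sup>+x. f (\<lambda>i\<in>{..<n}. x i / sqrt (dotp {..<n} x x)) * indicator {..1} (dotp {..<n} x x) \<partial>?P)"
    using AE_mem_punctured_ball_iff[OF n]
    by (intro nn_integral_cong_AE) (auto elim!: eventually_mono simp: L2_set_eq_dotp indicator_def)
  finally show ?thesis .
qed

context orthonormal_family
begin

lemma ratio_normalized:
  assumes "0 < dotp K x x"
  shows "(\<lambda>p\<in>J. crd (\<lambda>i\<in>K. x i / sqrt (dotp K x x)) p / resid (\<lambda>i\<in>K. x i / sqrt (dotp K x x)))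
     = (\<lambda>p\<in>J. crd x p / resid x)"
proof -
  define r where "r = 1 / sqrt (dotp K x x)"
  have eq: "(\<lambda>i\<in>K. x i / sqrt (dotp K x x)) = (\<lambda>i\<in>K. r * x i)" by (simp add: r_def)
  have "r > 0" using assms by (simp add: r_def)
  then show ?thesis unfolding eq crd_scale by (simp add: resid_scale cong: restrict_cong)
qed

lemma resid_normalized:
  assumes "0 < resid x" "0 < dotp K x x"
  shows "0 < resid (\<lambda>i\<in>K. x i / sqrt (dotp K x x))"
proof -
  have eq: "(\<lambda>i\<in>K. x i / sqrt (dotp K x x)) = (\<lambda>i\<in>K. (1 / sqrt (dotp K x x)) * x i)" by simp
  show ?thesis unfolding eq using assms by (subst resid_scale) auto
qed

end

lemma AE_uniform_sphere_resid_pos: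
  assumes "orthonormal_family {..<n} J e" and "card J < n"
  shows "AE v in uniform_sphere n. 0 < orthonormal_family.resid {..<n} J e v"
proof -
  interpret orthonormal_family "{..<n}" J e by fact
  have n: "n > 0" using assms(2) by simp
  have [measurable]: "resid \<in> borel_measurable (uniform_sphere n)"
    by (rule measurable_uniform_sphereI) measurable
  have "(\<integral>\<^sup>+v. indicator {..0} (resid v) \<partial>uniform_sphere n)
      = (\<integral>\<^sup>+x. indicator {..0} (resid (\<lambda>i\<in>{..<n}. x i / sqrt (dotp {..<n} x x))) * indicator {..1} (dotp {..<n} x x) \<partial>leb {..<n})
       / emeasure (leb {..<n}) (punctured_ball n)"
    by (rule nn_integral_uniform_sphere[OF n]) measurable
  also have "(\<integral>\<^sup>+x. indicator {..0} (resid (\<lambda>i\<in>{..<n}. x i / sqrt (dotp {..<n} x x))) * indicator {..1} (dotp {..<n} x x) \<partial>leb {..<n})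
      = (\<integral>\<^sup>+x. 0 \<partial>leb {..<n})"
  proof (rule nn_integral_cong_AE)
    have "AE x in leb {..<n}. 0 < resid x" by (rule AE_resid_pos) (simp add: assms(2))
    then show "AE x in leb {..<n}. indicator {..0} (resid (\<lambda>i\<in>{..<n}. x i / sqrt (dotp {..<n} x x)))
        * indicator {..1} (dotp {..<n} x x) = (0 :: ennreal)"
      using AE_dotp_pos[OF n] by eventually_elim (auto dest: resid_normalized split: split_indicator)
  qed
  finally have "(\<integral>\<^sup>+v. indicator {..0} (resid v) \<partial>uniform_sphere n) = 0" by simp
  then have "AE v in uniform_sphere n. indicator {..0} (resid v) = (0 :: ennreal)"
    by (subst (asm) nn_integral_0_iff_AE) auto
  then show ?thesis by eventually_elim (auto split: split_indicator_asm)
qed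

text \<open>
  The ratios \<open>crd / resid\<close> do not change when a vector is normalised, so their law on the sphere
  is their law in the ball. The constant is forced by the total mass \<open>1\<close>; that also shows that the
  denominator is positive and finite.
\<close>

lemma uniform_sphere_gnomonic:
  assumes "orthonormal_family {..<n} J e" and "card J < n"
    and f [measurable]: "f \<in> borel_measurable (leb J)"
  shows "(\<integral>\<^sup>+v. f (\<lambda>p\<in>J. orthonormal_family.crd {..<n} J e v p / orthonormal_family.resid {..<n} J e v) \<partial>uniform_sphere n)
     = (\<integral>\<^sup>+w. f w * ennreal (cosine J w ^ n) \<partial>leb J) / (\<integral>\<^sup>+w. ennreal (cosine J w ^ n) \<partial>leb J)"
proof -
  interpret orthonormal_family "{..<n}" J e by fact
  let ?P = "leb {..<n}" and ?I = "\<integral>\<^sup>+w. ennreal (cosine J w ^ n) \<partial>leb J"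
  have n: "n > 0" using assms(2) by simp
  obtain C where C: "\<And>f. f \<in> borel_measurable (leb J) \<Longrightarrow>
     (\<integral>\<^sup>+x. f (\<lambda>p\<in>J. crd x p / resid x) * indicator {..1} (dotp {..<n} x x) \<partial>?P)
      = C * (\<integral>\<^sup>+w. f w * ennreal (cosine J w ^ n) \<partial>leb J)"
    using ball_projection assms(2) by auto
  define D where "D = C / emeasure ?P (punctured_ball n)"
  have ratio [measurable]: "(\<lambda>x. \<lambda>p\<in>J. crd x p / resid x) \<in> ?P \<rightarrow>\<^sub>M leb J"
    by measurable
  have D: "(\<integral>\<^sup>+v. f (\<lambda>p\<in>J. crd v p / resid v) \<partial>uniform_sphere n)
      = D * (\<integral>\<^sup>+w. f w * ennreal (cosine J w ^ n) \<partial>leb J)"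
    if [measurable]: "f \<in> borel_measurable (leb J)" for f
  proof -
    have "(\<integral>\<^sup>+v. f (\<lambda>p\<in>J. crd v p / resid v) \<partial>uniform_sphere n) =
      (\<integral>\<^sup>+x. f (\<lambda>p\<in>J. crd (\<lambda>i\<in>{..<n}. x i / sqrt (dotp {..<n} x x)) p / resid (\<lambda>i\<in>{..<n}. x i / sqrt (dotp {..<n} x x)))
         * indicator {..1} (dotp {..<n} x x) \<partial>?P) / emeasure ?P (punctured_ball n)"
      by (rule nn_integral_uniform_sphere[OF n]) measurable
    also have "(\<integral>\<^sup>+x. f (\<lambda>p\<in>J. crd (\<lambda>i\<in>{..<n}. x i / sqrt (dotp {..<n} x x)) p / resid (\<lambda>i\<in>{..<n}. x i / sqrt (dotp {..<n} x x)))
         * indicator {..1} (dotp {..<n} x x) \<partial>?P)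
      = (\<integral>\<^sup>+x. f (\<lambda>p\<in>J. crd x p / resid x) * indicator {..1} (dotp {..<n} x x) \<partial>?P)"
      using AE_dotp_pos[OF n] by (intro nn_integral_cong_AE) (auto elim!: eventually_mono simp: ratio_normalized)
    also have "\<dots> = C * (\<integral>\<^sup>+w. f w * ennreal (cosine J w ^ n) \<partial>leb J)"
      by (rule C) measurable
    finally show ?thesis by (simp only: D_def ennreal_divide_times ennreal_times_divide)
  qed
  interpret U: prob_space "uniform_sphere n" by (rule prob_space_uniform_sphere[OF n])
  have one: "D * ?I = 1"
    using D[of "\<lambda>_. 1"] by (simp add: U.emeasure_space_1)
  then have "?I \<noteq> 0" "?I \<noteq> \<infinity>" by (auto simp: ennreal_mult_eq_top_iff ennreal_top_mult ennreal_mult_top split: if_splits)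
  then have "D = (D * ?I) / ?I"
    by (simp add: ennreal_times_divide[symmetric] ennreal_divide_self top.not_eq_extremum)
  then have "D = 1 / ?I" by (simp only: one)
  then show ?thesis unfolding D[OF f] by (simp add: ennreal_divide_times)
qed

section \<open>Gram-Schmidt coordinates of a family of unit vectors\<close>

abbreviation col_pairs :: "nat \<Rightarrow> (nat \<times> nat) set" where
  "col_pairs i \<equiv> {..<i} \<times> {i}"

lemma upper_pairs_0: "upper_pairs 0 = {}"
  by (auto simp: upper_pairs_def)

lemma upper_pairs_Suc: "upper_pairs (Suc k) = upper_pairs k \<union> col_pairs k"
  by (auto simp: upper_pairs_def)

lemma upper_pairs_disjoint: "upper_pairs k \<inter> col_pairs k = {}"
  by (auto simp: upper_pairs_def)

lemma finite_upper_pairs [simp, intro]: "finite (upper_pairs k)"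
  by (rule finite_subset[of _ "{..<k} \<times> {..<k}"]) (auto simp: upper_pairs_def)

lemma col_pairs_subset: "i < k \<Longrightarrow> col_pairs i \<subseteq> upper_pairs k"
  by (auto simp: upper_pairs_def)

lemma measurable_cosine_sub [measurable]:
  assumes "J \<subseteq> I" shows "cosine J \<in> borel_measurable (leb I)"
proof -
  have [measurable]: "(\<lambda>w. w p) \<in> borel_measurable (leb I)" if "p \<in> J" for p
    using measurable_component_singleton[of p I "\<lambda>_. lborel"] that assms by auto
  then show ?thesis unfolding cosine_def
    by measurable
qed

text \<open>
  A vector in the span of its predecessors has residual \<open>0\<close> and is sent to \<open>0\<close>, as division by
  zero yields zero. For random vectors this happens with probability zero only.
\<close>

fun gram_schmidt_vec :: "nat \<Rightarrow> (nat \<Rightarrow> nat \<Rightarrow> real) \<Rightarrow> nat \<Rightarrow> nat \<Rightarrow> real" where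
  "gram_schmidt_vec n v i = (\<lambda>c.
     (v i c - (\<Sum>l<i. dotp {..<n} (v i) (gram_schmidt_vec n v l) * gram_schmidt_vec n v l c))
     / sqrt (dotp {..<n} (v i) (v i) - (\<Sum>l<i. (dotp {..<n} (v i) (gram_schmidt_vec n v l))\<^sup>2)))"

declare gram_schmidt_vec.simps [simp del]

definition gs_resid :: "nat \<Rightarrow> (nat \<Rightarrow> nat \<Rightarrow> real) \<Rightarrow> nat \<Rightarrow> real" where
  "gs_resid n v i = sqrt (dotp {..<n} (v i) (v i) - (\<Sum>l<i. (dotp {..<n} (v i) (gram_schmidt_vec n v l))\<^sup>2))"

text \<open>
  The gnomonic coordinates of \<open>v i\<close> with respect to the frame made from its predecessors, indexed
  like the entries of the Gram matrix above the diagonal.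
\<close>

definition gs_coord :: "nat \<Rightarrow> (nat \<Rightarrow> nat \<Rightarrow> real) \<Rightarrow> nat \<times> nat \<Rightarrow> real" where
  "gs_coord n v = (\<lambda>(l, i). dotp {..<n} (v i) (gram_schmidt_vec n v l) / gs_resid n v i)"

lemma gram_schmidt_vec_eq:
  "gram_schmidt_vec n v i = (\<lambda>c.
     (v i c - (\<Sum>l<i. dotp {..<n} (v i) (gram_schmidt_vec n v l) * gram_schmidt_vec n v l c)) / gs_resid n v i)"
  by (subst gram_schmidt_vec.simps) (simp add: gs_resid_def)

lemma gram_schmidt_vec_cong:
  "(\<And>j. j \<le> i \<Longrightarrow> v j = v' j) \<Longrightarrow> gram_schmidt_vec n v i = gram_schmidt_vec n v' i"
proof (induction i rule: less_induct)
  case (less i)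
  have "gram_schmidt_vec n v l = gram_schmidt_vec n v' l" if "l < i" for l
    using less that by simp
  moreover have "v i = v' i" using less by simp
  ultimately show ?case by (subst (1 2) gram_schmidt_vec.simps) simp
qed

lemma gs_resid_cong: "(\<And>j. j \<le> i \<Longrightarrow> v j = v' j) \<Longrightarrow> gs_resid n v i = gs_resid n v' i"
  unfolding gs_resid_def using gram_schmidt_vec_cong[of _ v v' n] by (auto intro!: sum.cong arg_cong[where f = sqrt])

lemma gs_coord_cong: "l < i \<Longrightarrow> (\<And>j. j \<le> i \<Longrightarrow> v j = v' j) \<Longrightarrow> gs_coord n v (l, i) = gs_coord n v' (l, i)"
  unfolding gs_coord_def using gram_schmidt_vec_cong[of l v v' n] gs_resid_cong[of i v v' n] by simp

lemma gram_schmidt_orthonormal: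
  assumes "\<And>i. i < j \<Longrightarrow> 0 < gs_resid n v i" and "a < j" "b < j"
  shows "dotp {..<n} (gram_schmidt_vec n v a) (gram_schmidt_vec n v b) = (if a = b then 1 else 0)"
  using assms
proof (induction j arbitrary: a b)
  case (Suc j)
  let ?e = "gram_schmidt_vec n v" and ?K = "{..<n}"
  have IH: "dotp ?K (?e a) (?e b) = (if a = b then 1 else 0)" if "a < j" "b < j" for a b
    using Suc.IH[of a b] Suc.prems(1) that by simp
  interpret orthonormal_family ?K "{..<j}" ?e by standard (auto simp: IH)
  have pos: "0 < gs_resid n v j" using Suc.prems(1) by simp
  let ?y = "\<lambda>c. \<Sum>l<j. dotp ?K (v j) (?e l) * ?e l c"
  have ej: "?e j = (\<lambda>c. inverse (gs_resid n v j) * (v j c - ?y c))"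
    by (subst gram_schmidt_vec_eq) (simp add: divide_inverse mult.commute)
  have old: "dotp ?K (?e j) (?e b) = 0" if "b < j" for b
    unfolding ej dotp_scale_left dotp_diff_left
    using that dotp_combination[of b "\<lambda>l. dotp ?K (v j) (?e l)"] by simp
  have "dotp ?K (?e j) (?e j) = (inverse (gs_resid n v j))\<^sup>2 * dotp ?K (\<lambda>c. v j c - ?y c) (\<lambda>c. v j c - ?y c)"
    unfolding ej dotp_scale_left dotp_commute[of _ _ "\<lambda>c. inverse (gs_resid n v j) * (v j c - ?y c)"]
    by (simp add: power2_eq_square)
  also have "dotp ?K (\<lambda>c. v j c - ?y c) (\<lambda>c. v j c - ?y c) = (resid (v j))\<^sup>2"
    unfolding resid_def by (subst real_sqrt_pow2) (simp_all add: resid_sq dotp_self_nonneg)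
  also have "resid (v j) = gs_resid n v j" by (simp add: resid_def gs_resid_def)
  finally have new: "dotp ?K (?e j) (?e j) = 1" using pos by (simp add: power_mult_distrib[symmetric])
  show ?case using Suc.prems(2,3) IH old new dotp_commute[of ?K "?e a" "?e b"]
    by (cases "a = j"; cases "b = j") (auto simp: less_Suc_eq)
qed simp

lemma gs_frame:
  assumes "\<And>i. i < j \<Longrightarrow> 0 < gs_resid n v i"
  shows "orthonormal_family {..<n} (col_pairs j) (\<lambda>p. gram_schmidt_vec n v (fst p))"
  by standard (auto simp: gram_schmidt_orthonormal[OF assms] split: if_splits)

lemma sum_col_pairs: "(\<Sum>p\<in>col_pairs j. f p) = (\<Sum>l<j. f (l, j))"
  by (rule sum.reindex_bij_witness[of _ "\<lambda>l. (l, j)" fst]) auto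

lemma sphere_gs_row:
  assumes pos: "\<And>i. i < k \<Longrightarrow> 0 < gs_resid n v i" and i: "i < k"
    and unit: "dotp {..<n} (v i) (v i) = 1"
  shows "gs_resid n v i = cosine (col_pairs i) (gs_coord n v)"
    and "v i c = (\<Sum>l<i. gs_resid n v i * gs_coord n v (l, i) * gram_schmidt_vec n v l c)
       + gs_resid n v i * gram_schmidt_vec n v i c"
proof -
  have pi: "0 < gs_resid n v i" using pos i by simp
  have coord: "dotp {..<n} (v i) (gram_schmidt_vec n v l) = gs_resid n v i * gs_coord n v (l, i)" for l
    using pi by (simp add: gs_coord_def)
  have "0 < 1 - (\<Sum>l<i. (dotp {..<n} (v i) (gram_schmidt_vec n v l))\<^sup>2)"
    using pi unit by (simp add: gs_resid_def)
  then have "(gs_resid n v i)\<^sup>2 = 1 - (\<Sum>l<i. (dotp {..<n} (v i) (gram_schmidt_vec n v l))\<^sup>2)"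
    unfolding gs_resid_def unit by simp
  also have "\<dots> = 1 - (gs_resid n v i)\<^sup>2 * (\<Sum>l<i. (gs_coord n v (l, i))\<^sup>2)"
    unfolding coord by (simp add: power_mult_distrib sum_distrib_left)
  finally have "(gs_resid n v i)\<^sup>2 * (1 + (\<Sum>l<i. (gs_coord n v (l, i))\<^sup>2)) = 1"
    by (simp add: algebra_simps)
  then have "sqrt ((gs_resid n v i)\<^sup>2 * (1 + (\<Sum>l<i. (gs_coord n v (l, i))\<^sup>2))) = 1" by simp
  then have "gs_resid n v i * sqrt (1 + (\<Sum>l<i. (gs_coord n v (l, i))\<^sup>2)) = 1"
    using pi by (simp add: real_sqrt_mult)
  then show "gs_resid n v i = cosine (col_pairs i) (gs_coord n v)"
    unfolding cosine_def sum_col_pairs by (metis mult_zero_right nonzero_eq_divide_eq zero_neq_one)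
  show "v i c = (\<Sum>l<i. gs_resid n v i * gs_coord n v (l, i) * gram_schmidt_vec n v l c)
       + gs_resid n v i * gram_schmidt_vec n v i c"
    unfolding coord[symmetric] using pi by (subst (2) gram_schmidt_vec_eq) simp
qed

text \<open>
  The lower triangular factor \<open>L(w)\<close>; its row \<open>i\<close> lists the components of a unit vector with
  gnomonic coordinates \<open>w (0, i), \<dots>, w (i - 1, i)\<close> in an orthonormal frame.
\<close>

definition chol :: "(nat \<times> nat \<Rightarrow> real) \<Rightarrow> nat \<Rightarrow> nat \<Rightarrow> real" where
  "chol w i l = cosine (col_pairs i) w * (if l < i then w (l, i) else if l = i then 1 else 0)"

definition gnomonic_gram :: "nat \<Rightarrow> (nat \<times> nat \<Rightarrow> real) \<Rightarrow> real mat" where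
  "gnomonic_gram k w = mat k k (\<lambda>(i, j). \<Sum>l<k. chol w i l * chol w j l)"

lemma gram_mat_eq_gnomonic_gram:
  assumes pos: "\<And>i. i < k \<Longrightarrow> 0 < gs_resid n v i"
    and unit: "\<And>i. i < k \<Longrightarrow> dotp {..<n} (v i) (v i) = 1"
  shows "gram_mat k n v = gnomonic_gram k (gs_coord n v)"
proof -
  let ?w = "gs_coord n v" and ?e = "gram_schmidt_vec n v"
  interpret orthonormal_family "{..<n}" "{..<k}" ?e
    by standard (auto simp: gram_schmidt_orthonormal[OF pos])
  have exp: "v i c = (\<Sum>l<k. chol ?w i l * ?e l c)" if "i < k" "c < n" for i c
  proof -
    have "(\<Sum>l<k. chol ?w i l * ?e l c) = (\<Sum>l\<in>insert i {..<i}. chol ?w i l * ?e l c)"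
      by (rule sum.mono_neutral_right) (use that in \<open>auto simp: chol_def\<close>)
    also have "\<dots> = v i c"
      using sphere_gs_row[of k n v i] that pos unit by (simp add: chol_def mult_ac)
    finally show ?thesis ..
  qed
  have "(\<Sum>c<n. v i c * v j c) = (\<Sum>l<k. chol ?w i l * chol ?w j l)" if "i < k" "j < k" for i j
  proof -
    define y where "y = (\<lambda>c. \<Sum>l<k. chol ?w j l * ?e l c)"
    have "(\<Sum>c<n. v i c * v j c) = dotp {..<n} (\<lambda>c. \<Sum>l<k. chol ?w i l * ?e l c) y"
      unfolding dotp_def y_def by (intro sum.cong) (use that exp in auto)
    also have "\<dots> = (\<Sum>l<k. chol ?w i l * dotp {..<n} y (?e l))"
      unfolding dotp_sum_left dotp_scale_left by (simp add: dotp_commute)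
    finally show ?thesis by (simp add: dotp_combination y_def)
  qed
  then show ?thesis
    by (auto simp: gram_mat_def gnomonic_gram_def intro!: eq_matI)
qed

section \<open>The joint law of the Gram-Schmidt coordinates\<close>

abbreviation sphere_PiM :: "nat \<Rightarrow> nat \<Rightarrow> (nat \<Rightarrow> nat \<Rightarrow> real) measure" where
  "sphere_PiM n k \<equiv> Pi\<^sub>M {..<k} (\<lambda>_. uniform_sphere n)"

definition cosine_prod :: "nat \<Rightarrow> (nat \<times> nat \<Rightarrow> real) \<Rightarrow> real" where
  "cosine_prod k w = (\<Prod>i<k. cosine (col_pairs i) w)"

lemma measurable_sphere_component [measurable]:
  assumes "i < k" "c < n"
  shows "(\<lambda>v. v i c) \<in> borel_measurable (sphere_PiM n k)"
proof -
  have "(\<lambda>x. x c) \<in> borel_measurable (uniform_sphere n)"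
    using measurable_component_singleton[of c "{..<n}" "\<lambda>_. lborel :: real measure"] assms
    by (intro measurable_uniform_sphereI) auto
  then show ?thesis
    using measurable_compose[OF measurable_component_singleton[of i "{..<k}" "\<lambda>_. uniform_sphere n"]] assms by auto
qed

lemma measurable_gram_schmidt_vec [measurable]:
  "i < k \<Longrightarrow> c < n \<Longrightarrow> (\<lambda>v. gram_schmidt_vec n v i c) \<in> borel_measurable (sphere_PiM n k)"
proof (induction i arbitrary: c rule: less_induct)
  case (less i)
  have [measurable]: "(\<lambda>v. gram_schmidt_vec n v l c) \<in> borel_measurable (sphere_PiM n k)" if "l < i" "c < n" for l c
    using less that by simp
  have [measurable]: "(\<lambda>v. dotp {..<n} (v i) (gram_schmidt_vec n v l)) \<in> borel_measurable (sphere_PiM n k)" if "l < i" for l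
    by (rule measurable_dotp) (use less.prems that in measurable)
  have [measurable]: "(\<lambda>v. dotp {..<n} (v i) (v i)) \<in> borel_measurable (sphere_PiM n k)"
    by (rule measurable_dotp) (use less.prems in measurable)
  have [measurable]: "(\<lambda>v. v i c) \<in> borel_measurable (sphere_PiM n k)"
    by (rule measurable_sphere_component) (use less.prems in auto)
  show ?case using less.prems(2) by (subst gram_schmidt_vec.simps) measurable
qed

lemma measurable_gs_resid [measurable]:
  "i < k \<Longrightarrow> (\<lambda>v. gs_resid n v i) \<in> borel_measurable (sphere_PiM n k)"
  unfolding gs_resid_def by measurable

lemma measurable_gs_coord_component [measurable]:
  assumes "p \<in> upper_pairs k" shows "(\<lambda>v. gs_coord n v p) \<in> borel_measurable (sphere_PiM n k)"
proof -
  obtain l i where p: "p = (l, i)" "l < i" "i < k" using assms by (auto simp: upper_pairs_def)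
  then have [measurable]: "l < k" "i < k" by auto
  have "(\<lambda>v. dotp {..<n} (v i) (gram_schmidt_vec n v l) / gs_resid n v i) \<in> borel_measurable (sphere_PiM n k)"
    by measurable
  then show ?thesis by (simp add: gs_coord_def p)
qed

lemma measurable_gs_coord [measurable]:
  "(\<lambda>v. \<lambda>p\<in>upper_pairs k. gs_coord n v p) \<in> sphere_PiM n k \<rightarrow>\<^sub>M leb (upper_pairs k)"
  by measurable

lemma measurable_cosine_prod [measurable]:
  "cosine_prod k \<in> borel_measurable (leb (upper_pairs k))"
  unfolding cosine_prod_def by (intro borel_measurable_prod measurable_cosine_sub col_pairs_subset) simp

lemma gs_resid_upd:
  assumes "\<And>i. i < k \<Longrightarrow> 0 < gs_resid n v i"
  shows "gs_resid n (v(k := y)) k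
     = orthonormal_family.resid {..<n} (col_pairs k) (\<lambda>p. gram_schmidt_vec n v (fst p)) y"
proof -
  have [simp]: "l < k \<Longrightarrow> gram_schmidt_vec n (v(k := y)) l = gram_schmidt_vec n v l" for l
    by (rule gram_schmidt_vec_cong) auto
  show ?thesis
    by (simp add: orthonormal_family.resid_def[OF gs_frame[OF assms]] gs_resid_def sum_col_pairs)
qed

lemma gs_coord_upd:
  assumes "\<And>i. i < k \<Longrightarrow> 0 < gs_resid n v i" and "l < k"
  shows "gs_coord n (v(k := y)) (l, k)
     = orthonormal_family.crd {..<n} (col_pairs k) (\<lambda>p. gram_schmidt_vec n v (fst p)) y (l, k)
     / orthonormal_family.resid {..<n} (col_pairs k) (\<lambda>p. gram_schmidt_vec n v (fst p)) y"
proof -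
  have [simp]: "gram_schmidt_vec n (v(k := y)) l = gram_schmidt_vec n v l"
    by (rule gram_schmidt_vec_cong) (use assms(2) in auto)
  show ?thesis using assms(2)
    by (simp add: gs_coord_def gs_resid_upd[OF assms(1)] orthonormal_family.crd_def[OF gs_frame[OF assms(1)]])
qed

lemma AE_gs_resid_pos:
  assumes "k \<le> n" "0 < n"
  shows "AE v in sphere_PiM n k. \<forall>i<k. 0 < gs_resid n v i"
  using assms(1)
proof (induction k)
  case (Suc k)
  interpret U: prob_space "uniform_sphere n" by (rule prob_space_uniform_sphere) fact
  interpret product_sigma_finite "\<lambda>_ :: nat. uniform_sphere n" by standard
  have ins: "{..<Suc k} = insert k {..<k}" by auto
  define f :: "(nat \<Rightarrow> nat \<Rightarrow> real) \<Rightarrow> ennreal" where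
    "f v = (if \<forall>i<Suc k. 0 < gs_resid n v i then 0 else 1)" for v
  have f [measurable]: "f \<in> borel_measurable (sphere_PiM n (Suc k))"
    unfolding f_def by measurable
  have "(\<integral>\<^sup>+v. f v \<partial>sphere_PiM n (Suc k)) = (\<integral>\<^sup>+v. (\<integral>\<^sup>+y. f (v(k := y)) \<partial>uniform_sphere n) \<partial>sphere_PiM n k)"
    unfolding ins by (rule product_nn_integral_insert) (use f ins in auto)
  also have "\<dots> = (\<integral>\<^sup>+v. 0 \<partial>sphere_PiM n k)"
  proof (rule nn_integral_cong_AE)
    have "AE v in sphere_PiM n k. \<forall>i<k. 0 < gs_resid n v i" using Suc by simp
    then show "AE v in sphere_PiM n k. (\<integral>\<^sup>+y. f (v(k := y)) \<partial>uniform_sphere n) = 0"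
    proof eventually_elim
      case (elim v)
      then have pos: "\<And>i. i < k \<Longrightarrow> 0 < gs_resid n v i" by simp
      have "AE y in uniform_sphere n. 0 < gs_resid n (v(k := y)) k"
        using AE_uniform_sphere_resid_pos[OF gs_frame[OF pos]] Suc.prems gs_resid_upd[OF pos] by simp
      then have "AE y in uniform_sphere n. f (v(k := y)) = 0"
      proof eventually_elim
        case (elim y)
        have "gs_resid n (v(k := y)) i = gs_resid n v i" if "i < k" for i
          by (rule gs_resid_cong) (use that in auto)
        then show ?case using elim pos by (auto simp: f_def less_Suc_eq)
      qed
      then have "(\<integral>\<^sup>+y. f (v(k := y)) \<partial>uniform_sphere n) = (\<integral>\<^sup>+y. 0 \<partial>uniform_sphere n)"
        by (rule nn_integral_cong_AE)
      then show ?case by simp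
    qed
  qed
  finally have "(\<integral>\<^sup>+v. f v \<partial>sphere_PiM n (Suc k)) = 0" by simp
  then have "AE v in sphere_PiM n (Suc k). f v = 0"
    by (subst (asm) nn_integral_0_iff_AE) auto
  then show ?case by eventually_elim (simp add: f_def split: if_splits)
qed simp

text \<open>
  By induction on \<open>k\<close>: given the first \<open>k\<close> vectors, the column of coordinates contributed by the
  next vector has the law of \<open>uniform_sphere_gnomonic\<close>, whose density is the \<open>n\<close>-th power of the
  cosine factor of that column and which does not depend on the given vectors.
\<close>

lemma gs_coord_law:
  assumes "k \<le> n" "0 < n"
  shows "\<exists>C. \<forall>f \<in> borel_measurable (leb (upper_pairs k)).
     (\<integral>\<^sup>+v. f (\<lambda>p\<in>upper_pairs k. gs_coord n v p) \<partial>sphere_PiM n k)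
      = C * (\<integral>\<^sup>+w. f w * ennreal (cosine_prod k w ^ n) \<partial>leb (upper_pairs k))"
  using assms(1)
proof (induction k)
  case 0
  have "restrict g {} = (\<lambda>_. undefined)" for g :: "nat \<times> nat \<Rightarrow> real" by (auto simp: restrict_def)
  then show ?case
    by (intro exI[of _ 1]) (simp add: upper_pairs_0 PiM_empty nn_integral_count_space_finite cosine_prod_def)
next
  case (Suc k)
  interpret U: prob_space "uniform_sphere n" by (rule prob_space_uniform_sphere) fact
  interpret product_sigma_finite "\<lambda>_ :: nat. uniform_sphere n" by standard
  have ins: "{..<Suc k} = insert k {..<k}" by auto
  let ?I = "upper_pairs k" and ?J = "col_pairs k"
  let ?Z = "\<integral>\<^sup>+w. ennreal (cosine ?J w ^ n) \<partial>leb ?J"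
  obtain C where C: "\<And>f. f \<in> borel_measurable (leb ?I) \<Longrightarrow>
     (\<integral>\<^sup>+v. f (\<lambda>p\<in>?I. gs_coord n v p) \<partial>sphere_PiM n k)
      = C * (\<integral>\<^sup>+w. f w * ennreal (cosine_prod k w ^ n) \<partial>leb ?I)"
    using Suc by fastforce
  show ?case
  proof (rule exI[of _ "C / ?Z"], rule ballI)
    fix f :: "(nat \<times> nat \<Rightarrow> real) \<Rightarrow> ennreal"
    assume f0: "f \<in> borel_measurable (leb (upper_pairs (Suc k)))"
    then have f [measurable]: "f \<in> borel_measurable (leb (?I \<union> ?J))" by (simp add: upper_pairs_Suc)
    have mrg [measurable]: "merge ?I ?J \<in> leb ?I \<Otimes>\<^sub>M leb ?J \<rightarrow>\<^sub>M leb (?I \<union> ?J)"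
      by (rule measurable_merge)
    interpret J: sigma_finite_measure "leb ?J" by (rule sigma_finite_leb) auto
    define h where "h w = (\<integral>\<^sup>+u. f (merge ?I ?J (w, u)) * ennreal (cosine ?J u ^ n) \<partial>leb ?J)" for w
    have [measurable]: "h \<in> borel_measurable (leb ?I)" unfolding h_def by measurable
    have m: "(\<lambda>v. f (\<lambda>p\<in>upper_pairs (Suc k). gs_coord n v p)) \<in> borel_measurable (sphere_PiM n (Suc k))"
      by (rule measurable_compose[OF measurable_gs_coord f0])
    have "(\<integral>\<^sup>+v. f (\<lambda>p\<in>upper_pairs (Suc k). gs_coord n v p) \<partial>sphere_PiM n (Suc k))
       = (\<integral>\<^sup>+v. (\<integral>\<^sup>+y. f (\<lambda>p\<in>upper_pairs (Suc k). gs_coord n (v(k := y)) p) \<partial>uniform_sphere n) \<partial>sphere_PiM n k)"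
      unfolding ins by (rule product_nn_integral_insert) (use m ins in auto)
    also have "\<dots> = (\<integral>\<^sup>+v. h (\<lambda>p\<in>?I. gs_coord n v p) / ?Z \<partial>sphere_PiM n k)"
    proof (rule nn_integral_cong_AE)
      have "AE v in sphere_PiM n k. \<forall>i<k. 0 < gs_resid n v i"
        using AE_gs_resid_pos assms(2) Suc.prems by simp
      then show "AE v in sphere_PiM n k. (\<integral>\<^sup>+y. f (\<lambda>p\<in>upper_pairs (Suc k). gs_coord n (v(k := y)) p) \<partial>uniform_sphere n)
          = h (\<lambda>p\<in>?I. gs_coord n v p) / ?Z"
      proof eventually_elim
        case (elim v)
        then have pos: "\<And>i. i < k \<Longrightarrow> 0 < gs_resid n v i" by simp
        let ?w = "\<lambda>p\<in>?I. gs_coord n v p"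
        interpret fr: orthonormal_family "{..<n}" ?J "\<lambda>p. gram_schmidt_vec n v (fst p)"
          by (rule gs_frame) fact
        have w: "?w \<in> space (leb ?I)" by (simp add: space_PiM)
        have slice: "(\<lambda>u. f (merge ?I ?J (?w, u))) \<in> borel_measurable (leb ?J)"
          by (rule measurable_compose[OF _ f]) (use w in measurable)
        have coords: "(\<lambda>p\<in>upper_pairs (Suc k). gs_coord n (v(k := y)) p)
            = merge ?I ?J (?w, \<lambda>p\<in>?J. fr.crd y p / fr.resid y)" for y
        proof
          fix p
          show "(\<lambda>p\<in>upper_pairs (Suc k). gs_coord n (v(k := y)) p) p
            = merge ?I ?J (?w, \<lambda>p\<in>?J. fr.crd y p / fr.resid y) p"
          proof (cases "p \<in> ?I")
            case True
            then obtain l i where "p = (l, i)" "l < i" "i < k" by (auto simp: upper_pairs_def)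
            moreover from this have "gs_coord n (v(k := y)) (l, i) = gs_coord n v (l, i)"
              by (intro gs_coord_cong) auto
            ultimately show ?thesis using True by (auto simp: merge_def upper_pairs_Suc)
          next
            case False
            then show ?thesis
              by (auto simp: merge_def upper_pairs_Suc gs_coord_upd[OF pos])
          qed
        qed
        show ?case
          unfolding coords h_def
          by (rule uniform_sphere_gnomonic[OF fr.orthonormal_family_axioms _ slice]) (use Suc.prems in simp)
      qed
    qed
    also have "\<dots> = C * (\<integral>\<^sup>+w. (h w / ?Z) * ennreal (cosine_prod k w ^ n) \<partial>leb ?I)"
      by (rule C) measurable
    also have "(\<integral>\<^sup>+w. (h w / ?Z) * ennreal (cosine_prod k w ^ n) \<partial>leb ?I)
       = (\<integral>\<^sup>+w. h w * ennreal (cosine_prod k w ^ n) \<partial>leb ?I) / ?Z"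
      by (subst nn_integral_divide[symmetric])
         (auto simp: ennreal_divide_times ennreal_times_divide mult_ac intro!: nn_integral_cong)
    also have "(\<integral>\<^sup>+w. h w * ennreal (cosine_prod k w ^ n) \<partial>leb ?I)
       = (\<integral>\<^sup>+w. f w * ennreal (cosine_prod (Suc k) w ^ n) \<partial>leb (upper_pairs (Suc k)))"
    proof -
      have cs: "cosine_prod (Suc k) (merge ?I ?J (w, u)) = cosine_prod k w * cosine ?J u" for w u
      proof -
        have "cosine (col_pairs i) (merge ?I ?J (w, u)) = cosine (col_pairs i) w" if "i < k" for i
          unfolding cosine_def
          by (intro arg_cong[where f = "\<lambda>s. 1 / sqrt (1 + s)"] sum.cong)
             (use that in \<open>auto simp: merge_def upper_pairs_def\<close>)
        moreover have "cosine ?J (merge ?I ?J (w, u)) = cosine ?J u"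
          unfolding cosine_def
          by (intro arg_cong[where f = "\<lambda>s. 1 / sqrt (1 + s)"] sum.cong)
             (auto simp: merge_def upper_pairs_def)
        ultimately show ?thesis by (simp add: cosine_prod_def)
      qed
      have nonneg: "0 \<le> cosine_prod k w" for w
        unfolding cosine_prod_def by (intro prod_nonneg) (simp add: less_imp_le[OF cosine_pos])
      have [measurable]: "cosine_prod (Suc k) \<in> borel_measurable (leb (?I \<union> ?J))"
        using measurable_cosine_prod[of "Suc k"] by (simp add: upper_pairs_Suc)
      have "(\<integral>\<^sup>+w. f w * ennreal (cosine_prod (Suc k) w ^ n) \<partial>leb (?I \<union> ?J))
         = (\<integral>\<^sup>+w. (\<integral>\<^sup>+u. f (merge ?I ?J (w, u)) * ennreal (cosine_prod (Suc k) (merge ?I ?J (w, u)) ^ n)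
              \<partial>leb ?J) \<partial>leb ?I)"
        by (rule lebesgue_prod.product_nn_integral_fold) (auto simp: upper_pairs_disjoint)
      also have "\<dots> = (\<integral>\<^sup>+w. h w * ennreal (cosine_prod k w ^ n) \<partial>leb ?I)"
      proof (rule nn_integral_cong)
        fix w assume [measurable]: "w \<in> space (leb ?I)"
        have [measurable]: "(\<lambda>u. f (merge ?I ?J (w, u))) \<in> borel_measurable (leb ?J)"
          by (rule measurable_compose[OF _ f]) measurable
        show "(\<integral>\<^sup>+u. f (merge ?I ?J (w, u)) * ennreal (cosine_prod (Suc k) (merge ?I ?J (w, u)) ^ n) \<partial>leb ?J)
          = h w * ennreal (cosine_prod k w ^ n)"
          unfolding h_def cs
          by (subst nn_integral_multc[symmetric])
             (auto intro!: nn_integral_cong simp: power_mult_distrib ennreal_mult nonneg less_imp_le[OF cosine_pos] mult_ac)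
      qed
      finally show ?thesis by (simp add: upper_pairs_Suc)
    qed
    finally show "(\<integral>\<^sup>+v. f (\<lambda>p\<in>upper_pairs (Suc k). gs_coord n v p) \<partial>sphere_PiM n (Suc k))
       = C / ?Z * (\<integral>\<^sup>+w. f w * ennreal (cosine_prod (Suc k) w ^ n) \<partial>leb (upper_pairs (Suc k)))"
      by (simp only: ennreal_divide_times)
  qed
qed

section \<open>Null sets under triangular maps\<close>

definition nonsingular :: "(real \<Rightarrow> real) \<Rightarrow> bool" where
  "nonsingular f \<longleftrightarrow> (\<forall>N \<in> null_sets lborel. f -` N \<in> null_sets lborel)"

definition triangular :: "'i set \<Rightarrow> ('i \<Rightarrow> nat) \<Rightarrow> ('i \<Rightarrow> ('i \<Rightarrow> real) \<Rightarrow> real \<Rightarrow> real) \<Rightarrow> bool" where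
  "triangular I r \<phi> \<longleftrightarrow> (\<forall>p\<in>I. \<forall>x y s. (\<forall>q\<in>I. r q < r p \<longrightarrow> x q = y q) \<longrightarrow> \<phi> p x s = \<phi> p y s)"

lemma triangular_cong:
  "triangular I r \<phi> \<Longrightarrow> p \<in> I \<Longrightarrow> (\<And>q. q \<in> I \<Longrightarrow> r q < r p \<Longrightarrow> x q = y q) \<Longrightarrow> \<phi> p x s = \<phi> p y s"
  unfolding triangular_def by blast

definition triangular_map :: "'i set \<Rightarrow> ('i \<Rightarrow> ('i \<Rightarrow> real) \<Rightarrow> real \<Rightarrow> real) \<Rightarrow> ('i \<Rightarrow> real) \<Rightarrow> 'i \<Rightarrow> real" where
  "triangular_map I \<phi> x = (\<lambda>p\<in>I. \<phi> p x (x p))"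

lemma null_sets_insert_iff:
  assumes "finite I" "p \<notin> I" and N [measurable]: "N \<in> sets (leb (insert p I))"
  shows "N \<in> null_sets (leb (insert p I)) \<longleftrightarrow>
     (AE x in leb I. (\<lambda>s. x(p := s)) -` N \<in> null_sets lborel)"
proof -
  have sec: "(\<lambda>s. x(p := s)) -` N \<in> sets borel" if "x \<in> space (leb I)" for x
  proof -
    have "(\<lambda>s. x(p := s)) \<in> borel \<rightarrow>\<^sub>M leb (insert p I)"
      using measurable_component_update[OF that assms(2)] by simp
    from measurable_sets[OF this N] show ?thesis by simp
  qed
  have "emeasure (leb (insert p I)) N = (\<integral>\<^sup>+x. indicator N x \<partial>leb (insert p I))"
    by simp
  also have "\<dots> = (\<integral>\<^sup>+x. (\<integral>\<^sup>+s. indicator N (x(p := s)) \<partial>lborel) \<partial>leb I)"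
    by (rule lebesgue_prod.product_nn_integral_insert) (use assms in auto)
  also have "\<dots> = 0 \<longleftrightarrow> (AE x in leb I. (\<integral>\<^sup>+s. indicator N (x(p := s)) \<partial>lborel) = 0)"
    by (rule nn_integral_0_iff_AE) (use assms in measurable)
  also have "\<dots> \<longleftrightarrow> (AE x in leb I. (\<lambda>s. x(p := s)) -` N \<in> null_sets lborel)"
  proof (rule AE_cong)
    fix x assume "x \<in> space (leb I)"
    have "(\<integral>\<^sup>+s. indicator N (x(p := s)) \<partial>lborel) = (\<integral>\<^sup>+s. indicator ((\<lambda>s. x(p := s)) -` N) s \<partial>lborel)"
      by (intro nn_integral_cong) (auto split: split_indicator)
    also have "\<dots> = emeasure lborel ((\<lambda>s. x(p := s)) -` N)"
      using sec[OF \<open>x \<in> _\<close>] by simp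
    finally show "(\<integral>\<^sup>+s. indicator N (x(p := s)) \<partial>lborel) = 0 \<longleftrightarrow> (\<lambda>s. x(p := s)) -` N \<in> null_sets lborel"
      using sec[OF \<open>x \<in> _\<close>] by (auto simp: null_sets_def)
  qed
  finally show ?thesis using N by (auto simp: null_sets_def)
qed

text \<open>
  Remove a variable \<open>p\<close> of the highest rank: no other component of the map depends on it. For
  almost every point of the remaining variables the section of \<open>N\<close> is a null set in the variable
  \<open>p\<close>, by the induction hypothesis this persists at the image point, and nonsingularity pulls the
  section back.
\<close>

lemma triangular_map_null_preimage:
  assumes "finite I" "triangular I r \<phi>"
    and "\<And>p. p \<in> I \<Longrightarrow> (\<lambda>x. \<phi> p x (x p)) \<in> borel_measurable (leb I)"
    and "\<And>p x. p \<in> I \<Longrightarrow> nonsingular (\<phi> p x)"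
    and "N \<in> null_sets (leb I)"
  shows "triangular_map I \<phi> -` N \<inter> space (leb I) \<in> null_sets (leb I)"
  using assms
proof (induction I arbitrary: N rule: finite_ranking_induct[where f = r])
  case empty
  then have "N \<inter> space (leb {}) = {}"
    by (auto simp: PiM_empty null_sets_count_space)
  moreover have "triangular_map {} \<phi> x \<in> space (leb {})" for x
    by (auto simp: triangular_map_def space_PiM restrict_def)
  ultimately have "triangular_map {} \<phi> -` N \<inter> space (leb {}) = {}" by blast
  then show ?case by (simp only: null_sets.empty_sets)
next
  case (insert p I)
  show ?case
  proof (cases "p \<in> I")
    case True
    then have ins: "insert p I = I" by auto
    show ?thesis using insert.prems unfolding ins by (rule insert.IH)
  next
    case False
    note meas = insert.prems(2) and nons = insert.prems(3) and N = insert.prems(4)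
    have dep: "\<phi> q x s = \<phi> q y s" if "q \<in> insert p I" "\<And>q'. q' \<in> I \<Longrightarrow> r q' < r q \<Longrightarrow> x q' = y q'" for q x y s
    proof (rule triangular_cong[OF insert.prems(1) that(1)])
      fix q' assume q': "q' \<in> insert p I" "r q' < r q"
      have "r q \<le> r p" using that(1) insert.hyps(2)[of q] by (elim insertE) simp_all
      then have "q' \<in> I" using q' by (elim insertE) simp_all
      then show "x q' = y q'" using q'(2) by (rule that(2))
    qed
    have upd: "\<phi> q (x(p := a)) s = \<phi> q x s" if "q \<in> insert p I" for q x a s
      by (rule dep[OF that]) (use False in auto)
    have tri: "triangular I r \<phi>"
      unfolding triangular_def
    proof (intro ballI allI impI)
      fix q and x y :: "'a \<Rightarrow> real" and s
      assume "q \<in> I" "\<forall>q'\<in>I. r q' < r q \<longrightarrow> x q' = y q'"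
      then show "\<phi> q x s = \<phi> q y s" by (intro dep) simp_all
    qed
    have zero [measurable]: "(\<lambda>x. x(p := 0)) \<in> leb I \<rightarrow>\<^sub>M leb (insert p I)"
      by (rule measurable_fun_upd[where J = I]) auto
    have meas': "(\<lambda>x. \<phi> q x (x q)) \<in> borel_measurable (leb I)" if "q \<in> I" for q
    proof -
      have "(\<lambda>x. \<phi> q (x(p := 0)) ((x(p := 0)) q)) \<in> borel_measurable (leb I)"
        by (rule measurable_compose[OF zero meas]) (use that in simp)
      moreover have "q \<noteq> p" using that False by auto
      ultimately show ?thesis using that by (simp add: upd)
    qed
    have T [measurable]: "triangular_map I \<phi> \<in> leb I \<rightarrow>\<^sub>M leb I"
      unfolding triangular_map_def by (rule measurable_restrict) (use meas' in simp)
    have "triangular_map (insert p I) \<phi> \<in> leb (insert p I) \<rightarrow>\<^sub>M leb (insert p I)"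
      unfolding triangular_map_def by (rule measurable_restrict) (use meas in simp)
    then have sets: "triangular_map (insert p I) \<phi> -` N \<inter> space (leb (insert p I)) \<in> sets (leb (insert p I))"
      by (rule measurable_sets) (use N in auto)
    have split: "triangular_map (insert p I) \<phi> (x(p := s)) = (triangular_map I \<phi> x)(p := \<phi> p x s)" for x s
      using False by (auto simp: triangular_map_def upd fun_eq_iff)
    have "AE y in leb I. (\<lambda>s. y(p := s)) -` N \<in> null_sets lborel"
      using null_sets_insert_iff[OF insert.hyps(1) False] N by auto
    then obtain G where G: "G \<in> null_sets (leb I)"
      "{y \<in> space (leb I). (\<lambda>s. y(p := s)) -` N \<notin> null_sets lborel} \<subseteq> G"
      by (auto simp: eventually_ae_filter)
    have "triangular_map I \<phi> -` G \<inter> space (leb I) \<in> null_sets (leb I)"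
      by (rule insert.IH[OF tri meas' _ G(1)]) (simp_all add: nons)
    then have "AE x in leb I. x \<notin> triangular_map I \<phi> -` G \<inter> space (leb I)"
      by (rule AE_not_in)
    then have "AE x in leb I.
      (\<lambda>s. x(p := s)) -` (triangular_map (insert p I) \<phi> -` N \<inter> space (leb (insert p I))) \<in> null_sets lborel"
      using AE_space
    proof eventually_elim
      case (elim x)
      have "triangular_map I \<phi> x \<in> space (leb I)" using measurable_space[OF T elim(2)] .
      then have "(\<lambda>s. (triangular_map I \<phi> x)(p := s)) -` N \<in> null_sets lborel" using elim G(2) by blast
      then have "\<phi> p x -` ((\<lambda>s. (triangular_map I \<phi> x)(p := s)) -` N) \<in> null_sets lborel"
        using nons[of p x] by (simp add: nonsingular_def)
      also have "\<phi> p x -` ((\<lambda>s. (triangular_map I \<phi> x)(p := s)) -` N)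
          = (\<lambda>s. x(p := s)) -` (triangular_map (insert p I) \<phi> -` N \<inter> space (leb (insert p I)))"
        using elim(2) split by (auto simp: space_PiM PiE_iff extensional_def)
      finally show ?case .
    qed
    then show ?thesis using null_sets_insert_iff[OF insert.hyps(1) False sets] by simp
  qed
qed

text \<open>
  The inverse of a triangular map, computed in the order of the ranks: \<open>\<psi> p x\<close> is to invert
  \<open>\<phi> p x\<close> and may use only the components of \<open>x\<close> of lower rank, which have been found already. The
  value \<open>0\<close> is an arbitrary filler for the others.
\<close>

function triangular_inv :: "('i \<Rightarrow> nat) \<Rightarrow> ('i \<Rightarrow> ('i \<Rightarrow> real) \<Rightarrow> real \<Rightarrow> real) \<Rightarrow> ('i \<Rightarrow> real) \<Rightarrow> 'i \<Rightarrow> real" where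
  "triangular_inv r \<psi> y p = \<psi> p (\<lambda>q. if r q < r p then triangular_inv r \<psi> y q else 0) (y p)"
  by auto
termination by (relation "Wellfounded.measure (\<lambda>(r, \<psi>, y, p). r p)") auto

declare triangular_inv.simps [simp del]

lemma triangular_inv_cong:
  "(\<And>q. r q \<le> r p \<Longrightarrow> y q = y' q) \<Longrightarrow> triangular_inv r \<psi> y p = triangular_inv r \<psi> y' p"
proof (induction "r p" arbitrary: p rule: less_induct)
  case less
  have "(\<lambda>q. if r q < r p then triangular_inv r \<psi> y q else 0) = (\<lambda>q. if r q < r p then triangular_inv r \<psi> y' q else 0)"
    using less by (auto simp: fun_eq_iff)
  then show ?case using less.prems[of p] by (subst (1 2) triangular_inv.simps) simp
qed

text \<open>
  The left inverse is itself triangular in the variables of the image, and pulls the preimage of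
  \<open>B\<close> under \<open>\<phi>\<close> back to a set that contains \<open>B\<close>. A left inverse on the range is enough because \<open>B\<close>
  is assumed to lie in the range; outside of it \<open>\<psi>\<close> only has to be nonsingular.
\<close>

lemma triangular_map_null_image:
  fixes I :: "'a set"
  assumes fin: "finite I" and tri: "triangular I r \<phi>" "triangular I r \<psi>"
    and meas_\<phi>: "\<And>p. p \<in> I \<Longrightarrow> (\<lambda>x. \<phi> p x (x p)) \<in> borel_measurable (leb I)"
    and meas_\<psi>: "\<And>p. p \<in> I \<Longrightarrow> (\<lambda>(x, s). \<psi> p x s) \<in> borel_measurable (leb I \<Otimes>\<^sub>M borel)"
    and nons: "\<And>p x. p \<in> I \<Longrightarrow> nonsingular (\<psi> p x)"
    and inv: "\<And>p x s. p \<in> I \<Longrightarrow> \<psi> p x (\<phi> p x s) = s"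
    and B: "B \<in> sets (leb I)" "B \<subseteq> triangular_map I \<phi> ` space (leb I)"
    and null: "triangular_map I \<phi> -` B \<inter> space (leb I) \<in> null_sets (leb I)"
  shows "B \<in> null_sets (leb I)"
proof -
  let ?inv = "triangular_inv r \<psi>"
  define \<psi>' where "\<psi>' p y s = \<psi> p (\<lambda>q\<in>I. if r q < r p then ?inv (restrict y I) q else 0) s" for p y s
  have eq: "?inv (restrict y I) p = \<psi>' p y (y p)" if "p \<in> I" for p y
    unfolding \<psi>'_def using that by (subst triangular_inv.simps) (auto intro!: triangular_cong[OF tri(2) that])
  have tri': "triangular I r \<psi>'"
    unfolding triangular_def
  proof (intro ballI allI impI)
    fix p and x y :: "'a \<Rightarrow> real" and s assume "p \<in> I" and xy: "\<forall>q\<in>I. r q < r p \<longrightarrow> x q = y q"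
    have "?inv (restrict x I) q = ?inv (restrict y I) q" if "r q < r p" for q
      by (rule triangular_inv_cong) (use xy that in auto)
    then show "\<psi>' p x s = \<psi>' p y s" unfolding \<psi>'_def
      by (intro arg_cong[where f = "\<lambda>x. \<psi> p x s"]) auto
  qed
  have meas_inv: "(\<lambda>y. ?inv (restrict y I) p) \<in> borel_measurable (leb I)" if "p \<in> I" for p
    using that
  proof (induction "r p" arbitrary: p rule: less_induct)
    case less
    have lower: "(\<lambda>y. if r q < r p then ?inv (restrict y I) q else 0) \<in> borel_measurable (leb I)" if "q \<in> I" for q
      using less that by (cases "r q < r p") auto
    have "(\<lambda>y. \<lambda>q\<in>I. if r q < r p then ?inv (restrict y I) q else 0) \<in> leb I \<rightarrow>\<^sub>M leb I"
      by (rule measurable_restrict) (use lower in simp)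
    moreover have "(\<lambda>y. y p) \<in> borel_measurable (leb I)"
      using measurable_component_singleton[of p I "\<lambda>_. lborel"] less.prems by auto
    ultimately have "(\<lambda>y. (\<lambda>q\<in>I. if r q < r p then ?inv (restrict y I) q else 0, y p)) \<in> leb I \<rightarrow>\<^sub>M leb I \<Otimes>\<^sub>M borel"
      by (rule measurable_Pair)
    from measurable_compose[OF this meas_\<psi>[OF less.prems]] show ?case
      unfolding eq[OF less.prems] \<psi>'_def by simp
  qed
  have "triangular_map I \<psi>' -` (triangular_map I \<phi> -` B \<inter> space (leb I)) \<inter> space (leb I)
      \<in> null_sets (leb I)"
  proof (rule triangular_map_null_preimage[OF fin tri' _ _ null])
    show "(\<lambda>y. \<psi>' p y (y p)) \<in> borel_measurable (leb I)" if "p \<in> I" for p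
      using meas_inv[OF that] eq[OF that] by simp
    show "nonsingular (\<psi>' p y)" if "p \<in> I" for p y
    proof -
      have "\<psi>' p y = \<psi> p (\<lambda>q\<in>I. if r q < r p then ?inv (restrict y I) q else 0)"
        by (rule ext) (simp add: \<psi>'_def)
      then show ?thesis using nons[OF that] by simp
    qed
  qed
  moreover have "B \<subseteq> triangular_map I \<psi>' -` (triangular_map I \<phi> -` B \<inter> space (leb I)) \<inter> space (leb I)"
  proof
    fix y assume y: "y \<in> B"
    then obtain x where x: "x \<in> space (leb I)" "y = triangular_map I \<phi> x" using B(2) by auto
    have ys: "y \<in> space (leb I)" using sets.sets_into_space[OF B(1)] y by auto
    then have res: "restrict y I = y" by (auto simp: space_PiM PiE_iff extensional_restrict)
    have "?inv y p = x p" if "p \<in> I" for p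
      using that
    proof (induction "r p" arbitrary: p rule: less_induct)
      case less
      have "?inv y p = \<psi> p (\<lambda>q. if r q < r p then ?inv y q else 0) (y p)" by (rule triangular_inv.simps)
      also have "\<dots> = \<psi> p x (y p)"
        by (rule triangular_cong[OF tri(2) less.prems]) (use less in auto)
      also have "\<dots> = x p" using inv less.prems by (simp add: x(2) triangular_map_def)
      finally show ?case .
    qed
    then have "triangular_map I \<psi>' y = x"
      using x(1) eq[of _ y] by (auto simp: triangular_map_def res space_PiM PiE_iff extensional_def fun_eq_iff)
    then show "y \<in> triangular_map I \<psi>' -` (triangular_map I \<phi> -` B \<inter> space (leb I)) \<inter> space (leb I)"
      using x y ys by auto
  qed
  ultimately show ?thesis by (rule null_sets_subset[OF _ B(1)])
qed

text \<open>
  The preimage of a null set is its image under the inverse function, and differentiable images of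
  null sets are null. Where the inverse is not available, \<open>f\<close> is assumed to be the identity.
\<close>

lemma nonsingularI:
  fixes f g :: "real \<Rightarrow> real"
  assumes f [measurable]: "f \<in> borel_measurable borel"
    and inv: "\<And>s. P s \<Longrightarrow> g (f s) = s" and diff: "\<And>s. P s \<Longrightarrow> g differentiable (at (f s))"
    and [measurable]: "Measurable.pred borel P"
    and id: "\<And>s. \<not> P s \<Longrightarrow> f s = s"
  shows "nonsingular f"
  unfolding nonsingular_def
proof
  fix N :: "real set" assume N: "N \<in> null_sets lborel"
  then have [measurable]: "N \<in> sets borel" by auto
  have neg: "negligible N" using N by (simp add: negligible_iff_null_sets null_sets_completionI)
  have "negligible (N \<inter> f ` {s. P s})" by (rule negligible_subset[OF neg]) auto
  then have "negligible (g ` (N \<inter> f ` {s. P s}))"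
  proof (rule negligible_differentiable_image_negligible[rotated])
    show "g differentiable_on N \<inter> f ` {s. P s}"
      unfolding differentiable_on_def using diff differentiable_at_withinI by blast
  qed simp
  then have "negligible (N \<union> g ` (N \<inter> f ` {s. P s}))" using neg by (rule negligible_Un[rotated])
  moreover have "f -` N \<subseteq> N \<union> g ` (N \<inter> f ` {s. P s})"
  proof
    fix s assume s: "s \<in> f -` N"
    show "s \<in> N \<union> g ` (N \<inter> f ` {s. P s})"
    proof (cases "P s")
      case True
      then have "g (f s) \<in> g ` (N \<inter> f ` {s. P s})" using s by blast
      then show ?thesis using inv[OF True] by simp
    qed (use s id in simp)
  qed
  ultimately have "negligible (f -` N)" by (rule negligible_subset)
  moreover have "f -` N \<in> sets borel" using measurable_sets[OF f, of N] by simp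
  ultimately show "f -` N \<in> null_sets lborel"
    by (simp add: negligible_iff_null_sets null_sets_completion_iff)
qed

section \<open>Null sets of coordinates and null sets of matrix entries\<close>

lemma measurable_upper_component [measurable]:
  "m < i \<Longrightarrow> i < k \<Longrightarrow> (\<lambda>x. x (m, i)) \<in> borel_measurable (leb (upper_pairs k))"
  using measurable_component_singleton[of "(m, i)" "upper_pairs k" "\<lambda>_. lborel :: real measure"]
  by (auto simp: upper_pairs_def)

text \<open>
  All coordinates of column \<open>i\<close> occur in the normalising factor of row \<open>i\<close> of \<open>L(w)\<close>, so
  \<open>w \<mapsto> M(w)\<close> is not triangular. It becomes triangular in the variables
  \<open>t (l, i) = w (l, i) / sqrt (1 + (\<Sum>m\<in>{l<..<i}. w (m, i)\<^sup>2))\<close>. These are the tangents of the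
  angles in spherical coordinates of the row, because the partial sums of squares turn into
  products \<open>\<Prod>m\<in>{l..<i}. 1 + t (m, i)\<^sup>2\<close>. The passage between \<open>w\<close> and \<open>t\<close> is triangular with the
  larger first index coming first.
\<close>

definition tangent_step :: "nat \<times> nat \<Rightarrow> (nat \<times> nat \<Rightarrow> real) \<Rightarrow> real \<Rightarrow> real" where
  "tangent_step = (\<lambda>(l, i) w s. s * (1 / sqrt (1 + (\<Sum>m\<in>{Suc l..<i}. (w (m, i))\<^sup>2))))"

definition gnomonic_step :: "nat \<times> nat \<Rightarrow> (nat \<times> nat \<Rightarrow> real) \<Rightarrow> real \<Rightarrow> real" where
  "gnomonic_step = (\<lambda>(l, i) t s. s * sqrt (\<Prod>m\<in>{Suc l..<i}. 1 + (t (m, i))\<^sup>2))"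

abbreviation tangents :: "nat \<Rightarrow> (nat \<times> nat \<Rightarrow> real) \<Rightarrow> nat \<times> nat \<Rightarrow> real" where
  "tangents k \<equiv> triangular_map (upper_pairs k) tangent_step"

abbreviation gnomonic :: "nat \<Rightarrow> (nat \<times> nat \<Rightarrow> real) \<Rightarrow> nat \<times> nat \<Rightarrow> real" where
  "gnomonic k \<equiv> triangular_map (upper_pairs k) gnomonic_step"

lemma prod_one_plus_pos: "0 < (\<Prod>m\<in>S. 1 + (f m :: real)\<^sup>2)"
  by (intro prod_pos) (simp add: add_pos_nonneg)

lemma one_plus_sum_pos: "0 < 1 + (\<Sum>m\<in>S. (f m :: real)\<^sup>2)"
  by (simp add: add_pos_nonneg sum_nonneg)

lemma sum_gnomonic:
  assumes "i < k" "l \<le> i"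
  shows "1 + (\<Sum>m\<in>{l..<i}. (gnomonic k t (m, i))\<^sup>2) = (\<Prod>m\<in>{l..<i}. 1 + (t (m, i))\<^sup>2)"
  using assms(2)
proof (induction l rule: inc_induct)
  case (step l)
  have "{l..<i} = insert l {Suc l..<i}" using step.hyps by auto
  moreover have "(gnomonic k t (l, i))\<^sup>2 = (t (l, i))\<^sup>2 * (\<Prod>m\<in>{Suc l..<i}. 1 + (t (m, i))\<^sup>2)"
    using step.hyps assms(1) prod_one_plus_pos[of "\<lambda>m. t (m, i)" "{Suc l..<i}"]
    by (simp add: triangular_map_def gnomonic_step_def upper_pairs_def power_mult_distrib)
  ultimately show ?case using step.IH by (simp add: algebra_simps)
qed simp

lemma prod_tangents:
  assumes "i < k" "l \<le> i"
  shows "(\<Prod>m\<in>{l..<i}. 1 + (tangents k w (m, i))\<^sup>2) = 1 + (\<Sum>m\<in>{l..<i}. (w (m, i))\<^sup>2)"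
  using assms(2)
proof (induction l rule: inc_induct)
  case (step l)
  let ?A = "1 + (\<Sum>m\<in>{Suc l..<i}. (w (m, i))\<^sup>2)"
  have A: "0 < ?A" by (rule one_plus_sum_pos)
  have ins: "{l..<i} = insert l {Suc l..<i}" using step.hyps by auto
  have "(tangents k w (l, i))\<^sup>2 = (w (l, i))\<^sup>2 / ?A"
    using step.hyps assms(1) A
    by (simp add: triangular_map_def tangent_step_def upper_pairs_def power_divide)
  then have "(1 + (tangents k w (l, i))\<^sup>2) * ?A = ?A + (w (l, i))\<^sup>2"
    using A by (simp add: field_simps)
  then show ?case using step.IH ins by simp
qed simp

lemma gnomonic_tangents:
  assumes "w \<in> space (leb (upper_pairs k))"
  shows "gnomonic k (tangents k w) = w"
proof
  fix p
  show "gnomonic k (tangents k w) p = w p"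
  proof (cases "p \<in> upper_pairs k")
    case True
    then obtain l i where p: "p = (l, i)" "l < i" "i < k" by (auto simp: upper_pairs_def)
    have "gnomonic k x p = x p * sqrt (\<Prod>m\<in>{Suc l..<i}. 1 + (x (m, i))\<^sup>2)" for x
      using True p by (simp add: triangular_map_def gnomonic_step_def)
    then have "gnomonic k (tangents k w) p = tangents k w p * sqrt (1 + (\<Sum>m\<in>{Suc l..<i}. (w (m, i))\<^sup>2))"
      using p prod_tangents[of i k "Suc l" w] by simp
    also have "\<dots> = w p"
      using True p one_plus_sum_pos[of "\<lambda>m. w (m, i)" "{Suc l..<i}"]
      by (simp add: triangular_map_def tangent_step_def)
    finally show ?thesis .
  next
    case False
    then show ?thesis using assms by (cases p) (simp add: triangular_map_def space_PiM PiE_iff extensional_def)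
  qed
qed

lemma triangular_tangent_step: "triangular (upper_pairs k) (\<lambda>p. k - fst p) tangent_step"
  unfolding triangular_def
proof (intro ballI allI impI)
  fix p s and x y :: "nat \<times> nat \<Rightarrow> real"
  assume p: "p \<in> upper_pairs k" and eq: "\<forall>q\<in>upper_pairs k. k - fst q < k - fst p \<longrightarrow> x q = y q"
  obtain l i where li: "p = (l, i)" "l < i" "i < k" using p by (auto simp: upper_pairs_def)
  have "x (m, i) = y (m, i)" if "m \<in> {Suc l..<i}" for m
    by (rule eq[rule_format]) (use that li in \<open>auto simp: upper_pairs_def\<close>)
  then show "tangent_step p x s = tangent_step p y s" by (simp add: tangent_step_def li)
qed

lemma triangular_gnomonic_step: "triangular (upper_pairs k) (\<lambda>p. k - fst p) gnomonic_step"
  unfolding triangular_def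
proof (intro ballI allI impI)
  fix p s and x y :: "nat \<times> nat \<Rightarrow> real"
  assume p: "p \<in> upper_pairs k" and eq: "\<forall>q\<in>upper_pairs k. k - fst q < k - fst p \<longrightarrow> x q = y q"
  obtain l i where li: "p = (l, i)" "l < i" "i < k" using p by (auto simp: upper_pairs_def)
  have "x (m, i) = y (m, i)" if "m \<in> {Suc l..<i}" for m
    by (rule eq[rule_format]) (use that li in \<open>auto simp: upper_pairs_def\<close>)
  then show "gnomonic_step p x s = gnomonic_step p y s" by (simp add: gnomonic_step_def li)
qed

lemma nonsingular_scale:
  assumes "0 < c" shows "nonsingular (\<lambda>s. s * c)"
  by (rule nonsingularI[where P = "\<lambda>_. True" and g = "\<lambda>y. y / c"]) (use assms in auto)

lemma nonsingular_tangent_step: "nonsingular (tangent_step p x)"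
proof -
  obtain l i where p: "p = (l, i)" by force
  have "0 < 1 / sqrt (1 + (\<Sum>m\<in>{Suc l..<i}. (x (m, i))\<^sup>2))"
    using one_plus_sum_pos[of "\<lambda>m. x (m, i)" "{Suc l..<i}"] by simp
  then show ?thesis unfolding p tangent_step_def prod.case by (rule nonsingular_scale)
qed

lemma nonsingular_gnomonic_step: "nonsingular (gnomonic_step p x)"
proof -
  obtain l i where p: "p = (l, i)" by force
  have "0 < sqrt (\<Prod>m\<in>{Suc l..<i}. 1 + (x (m, i))\<^sup>2)"
    using prod_one_plus_pos[of "\<lambda>m. x (m, i)" "{Suc l..<i}"] by (rule real_sqrt_gt_zero)
  then show ?thesis unfolding p gnomonic_step_def prod.case by (rule nonsingular_scale)
qed

lemma measurable_tangent_step: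
  assumes "p \<in> upper_pairs k"
  shows "(\<lambda>x. tangent_step p x (x p)) \<in> borel_measurable (leb (upper_pairs k))"
proof -
  obtain l i where li [simp]: "p = (l, i)" "l < i" "i < k" using assms by (auto simp: upper_pairs_def)
  have [measurable]: "(\<lambda>x. x (m, i)) \<in> borel_measurable (leb (upper_pairs k))" if "m \<in> {l..<i}" for m
    by (rule measurable_upper_component) (use that in auto)
  have [measurable]: "m \<in> {Suc l..<i} \<Longrightarrow> m \<in> {l..<i}" "l \<in> {l..<i}" for m by auto
  have "(\<lambda>x. x (l, i) * (1 / sqrt (1 + (\<Sum>m\<in>{Suc l..<i}. (x (m, i))\<^sup>2)))) \<in> borel_measurable (leb (upper_pairs k))"
    by measurable
  then show ?thesis by (simp add: tangent_step_def)
qed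

lemma measurable_gnomonic_step:
  assumes "p \<in> upper_pairs k"
  shows "(\<lambda>x. gnomonic_step p x (x p)) \<in> borel_measurable (leb (upper_pairs k))"
proof -
  obtain l i where li [simp]: "p = (l, i)" "l < i" "i < k" using assms by (auto simp: upper_pairs_def)
  have [measurable]: "(\<lambda>x. x (m, i)) \<in> borel_measurable (leb (upper_pairs k))" if "m \<in> {l..<i}" for m
    by (rule measurable_upper_component) (use that in auto)
  have [measurable]: "m \<in> {Suc l..<i} \<Longrightarrow> m \<in> {l..<i}" "l \<in> {l..<i}" for m by auto
  have "(\<lambda>x. x (l, i) * sqrt (\<Prod>m\<in>{Suc l..<i}. 1 + (x (m, i))\<^sup>2)) \<in> borel_measurable (leb (upper_pairs k))"
    by measurable
  then show ?thesis by (simp add: gnomonic_step_def)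
qed

text \<open>
  The entries of \<open>L\<close> in terms of \<open>t\<close>: the entry \<open>(i, l)\<close> depends only on the \<open>t (m, i)\<close> with
  \<open>m \<le> l\<close>.
\<close>

definition tangent_chol :: "(nat \<times> nat \<Rightarrow> real) \<Rightarrow> nat \<Rightarrow> nat \<Rightarrow> real" where
  "tangent_chol t i l = t (l, i) / sqrt (\<Prod>m\<in>{..l}. 1 + (t (m, i))\<^sup>2)"

definition tangent_diag :: "(nat \<times> nat \<Rightarrow> real) \<Rightarrow> nat \<Rightarrow> nat \<Rightarrow> real" where
  "tangent_diag t i j = 1 / sqrt (\<Prod>m\<in>{..<j}. 1 + (t (m, i))\<^sup>2)"

lemma tangent_diag_pos: "0 < tangent_diag t i j"
  unfolding tangent_diag_def using prod_one_plus_pos[of "\<lambda>m. t (m, i)" "{..<j}"] by simp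

lemma cosine_gnomonic: "i < k \<Longrightarrow> cosine (col_pairs i) (gnomonic k t) = tangent_diag t i i"
  unfolding cosine_def tangent_diag_def sum_col_pairs using sum_gnomonic[of i k 0 t]
  by (simp add: lessThan_atLeast0)

lemma chol_gnomonic:
  assumes "l < i" "i < k"
  shows "chol (gnomonic k t) i l = tangent_chol t i l"
proof -
  let ?P = "\<lambda>S. \<Prod>m\<in>S. 1 + (t (m, i))\<^sup>2"
  have eq: "{..<i} = {..l} \<union> {Suc l..<i}" using assms by auto
  have "?P {..<i} = ?P {..l} * ?P {Suc l..<i}"
    unfolding eq by (rule prod.union_disjoint) auto
  then have cos: "cosine (col_pairs i) (gnomonic k t) = 1 / (sqrt (?P {..l}) * sqrt (?P {Suc l..<i}))"
    unfolding cosine_gnomonic[OF assms(2)] tangent_diag_def by (simp only: real_sqrt_mult)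
  have gno: "gnomonic k t (l, i) = t (l, i) * sqrt (?P {Suc l..<i})"
    using assms by (simp add: triangular_map_def gnomonic_step_def upper_pairs_def)
  have pos: "0 < sqrt (?P {Suc l..<i})" by (rule real_sqrt_gt_zero) (rule prod_one_plus_pos)
  have "1 / (A * s) * (x * s) = x / A" if "0 < s" for A x s :: real using that by simp
  from this[OF pos] have "1 / (A * sqrt (?P {Suc l..<i})) * (x * sqrt (?P {Suc l..<i})) = x / A" for A x :: real .
  then show ?thesis using assms(1) unfolding chol_def cos gno tangent_chol_def by (simp only: if_True)
qed

definition gram_entries :: "nat \<Rightarrow> (nat \<times> nat \<Rightarrow> real) \<Rightarrow> nat \<times> nat \<Rightarrow> real" where
  "gram_entries k w = (\<lambda>(j, i)\<in>upper_pairs k. \<Sum>l<k. chol w j l * chol w i l)"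

lemma upper_entries_gnomonic_gram: "upper_entries k (gnomonic_gram k w) = gram_entries k w"
  by (auto simp: upper_entries_def gnomonic_gram_def gram_entries_def upper_pairs_def fun_eq_iff)

text \<open>
  For \<open>j < i\<close>, the entry \<open>(j, i)\<close> of the matrix is \<open>\<Sum>l\<le>j. L j l * L i l\<close>. Only the last summand
  contains \<open>t (j, i)\<close>, through the sine \<open>t / sqrt (1 + t\<^sup>2)\<close>, and the other variables that occur
  have first index below \<open>j\<close>. So the entry is an affine function of that sine, with these two
  coefficients.
\<close>

definition gram_offset :: "(nat \<times> nat \<Rightarrow> real) \<Rightarrow> nat \<times> nat \<Rightarrow> real" where
  "gram_offset t = (\<lambda>(j, i). \<Sum>l<j. tangent_chol t j l * tangent_chol t i l)"

definition gram_slope :: "(nat \<times> nat \<Rightarrow> real) \<Rightarrow> nat \<times> nat \<Rightarrow> real" where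
  "gram_slope t = (\<lambda>(j, i). tangent_diag t j j * tangent_diag t i j)"

definition gram_step :: "nat \<times> nat \<Rightarrow> (nat \<times> nat \<Rightarrow> real) \<Rightarrow> real \<Rightarrow> real" where
  "gram_step p t s = gram_offset t p + gram_slope t p * (s / sqrt (1 + s\<^sup>2))"

text \<open>
  Outside the range of \<open>gram_step\<close> the value \<open>y\<close> is arbitrary, chosen to keep the map nonsingular.
\<close>

definition gram_step_inv :: "nat \<times> nat \<Rightarrow> (nat \<times> nat \<Rightarrow> real) \<Rightarrow> real \<Rightarrow> real" where
  "gram_step_inv p t y =
     (let z = (y - gram_offset t p) / gram_slope t p in if \<bar>z\<bar> < 1 then z / sqrt (1 - z\<^sup>2) else y)"

lemma gram_slope_pos: "0 < gram_slope t p"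
  by (cases p) (simp add: gram_slope_def tangent_diag_pos)

lemma gram_entries_gnomonic: "gram_entries k (gnomonic k t) = triangular_map (upper_pairs k) gram_step t"
proof
  fix p
  show "gram_entries k (gnomonic k t) p = triangular_map (upper_pairs k) gram_step t p"
  proof (cases "p \<in> upper_pairs k")
    case True
    then obtain j i where p: "p = (j, i)" "j < i" "i < k" by (auto simp: upper_pairs_def)
    let ?L = "chol (gnomonic k t)"
    have "(\<Sum>l<k. ?L j l * ?L i l) = (\<Sum>l\<in>insert j {..<j}. ?L j l * ?L i l)"
      by (rule sum.mono_neutral_right) (use p in \<open>auto simp: chol_def\<close>)
    also have "\<dots> = ?L j j * ?L i j + (\<Sum>l<j. ?L j l * ?L i l)" by simp
    also have "(\<Sum>l<j. ?L j l * ?L i l) = gram_offset t p"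
      unfolding gram_offset_def p prod.case by (intro sum.cong refl) (use p in \<open>simp add: chol_gnomonic\<close>)
    also have "?L j j = tangent_diag t j j" using p by (simp add: chol_def cosine_gnomonic)
    also have "?L i j = tangent_chol t i j" by (rule chol_gnomonic) (use p in auto)
    also have "tangent_chol t i j = tangent_diag t i j * (t p / sqrt (1 + (t p)\<^sup>2))"
      by (simp add: tangent_chol_def tangent_diag_def p lessThan_Suc_atMost[symmetric] real_sqrt_mult)
    finally have "(\<Sum>l<k. ?L j l * ?L i l) = gram_step p t (t p)"
      by (simp add: gram_step_def gram_slope_def p)
    moreover have "gram_entries k (gnomonic k t) p = (\<Sum>l<k. ?L j l * ?L i l)"
      using True by (simp add: gram_entries_def p)
    moreover have "triangular_map (upper_pairs k) gram_step t p = gram_step p t (t p)"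
      using True by (simp add: triangular_map_def)
    ultimately show ?thesis by (simp only:)
  next
    case False
    then show ?thesis by (simp add: gram_entries_def triangular_map_def)
  qed
qed

lemma tangent_chol_cong: "(\<And>m. m \<le> l \<Longrightarrow> x (m, i) = y (m, i)) \<Longrightarrow> tangent_chol x i l = tangent_chol y i l"
  unfolding tangent_chol_def by simp

lemma tangent_diag_cong: "(\<And>m. m < j \<Longrightarrow> x (m, i) = y (m, i)) \<Longrightarrow> tangent_diag x i j = tangent_diag y i j"
  unfolding tangent_diag_def by simp

lemma gram_coeffs_cong:
  assumes "p \<in> upper_pairs k" and eq: "\<forall>q\<in>upper_pairs k. fst q < fst p \<longrightarrow> x q = y q"
  shows "gram_offset x p = gram_offset y p" and "gram_slope x p = gram_slope y p"
proof -
  obtain j i where p: "p = (j, i)" "j < i" "i < k" using assms(1) by (auto simp: upper_pairs_def)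
  have 1: "x (m, i) = y (m, i)" "x (m, j) = y (m, j)" if "m < j" for m
    using that p eq[rule_format, of "(m, i)"] eq[rule_format, of "(m, j)"] by (simp_all add: upper_pairs_def)
  show "gram_offset x p = gram_offset y p"
    unfolding gram_offset_def p prod.case
    by (intro sum.cong arg_cong2[where f = "(*)"] tangent_chol_cong 1 refl) auto
  show "gram_slope x p = gram_slope y p"
    unfolding gram_slope_def p prod.case
    by (intro arg_cong2[where f = "(*)"] tangent_diag_cong 1)
qed

lemma triangular_gram_step: "triangular (upper_pairs k) fst gram_step"
  unfolding triangular_def
proof (intro ballI allI impI)
  fix p s and x y :: "nat \<times> nat \<Rightarrow> real"
  assume "p \<in> upper_pairs k" "\<forall>q\<in>upper_pairs k. fst q < fst p \<longrightarrow> x q = y q"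
  note c = gram_coeffs_cong[OF this]
  show "gram_step p x s = gram_step p y s" unfolding gram_step_def c ..
qed

lemma triangular_gram_step_inv: "triangular (upper_pairs k) fst gram_step_inv"
  unfolding triangular_def
proof (intro ballI allI impI)
  fix p s and x y :: "nat \<times> nat \<Rightarrow> real"
  assume "p \<in> upper_pairs k" "\<forall>q\<in>upper_pairs k. fst q < fst p \<longrightarrow> x q = y q"
  note c = gram_coeffs_cong[OF this]
  show "gram_step_inv p x s = gram_step_inv p y s" unfolding gram_step_inv_def c ..
qed

lemma measurable_gram_coeffs:
  assumes "p \<in> upper_pairs k"
  shows "(\<lambda>x. gram_offset x p) \<in> borel_measurable (leb (upper_pairs k))"
    and "(\<lambda>x. gram_slope x p) \<in> borel_measurable (leb (upper_pairs k))"
proof -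
  obtain j i where p: "p = (j, i)" "j < i" "i < k" using assms by (auto simp: upper_pairs_def)
  have c: "(\<lambda>x. tangent_chol x i' l) \<in> borel_measurable (leb (upper_pairs k))" if "l < i'" "i' < k" for l i'
  proof -
    have [measurable]: "(\<lambda>x. x (m, i')) \<in> borel_measurable (leb (upper_pairs k))" if "m \<le> l" for m
      by (rule measurable_upper_component) (use that \<open>l < i'\<close> \<open>i' < k\<close> in auto)
    show ?thesis unfolding tangent_chol_def by measurable
  qed
  have d: "(\<lambda>x. tangent_diag x i' l) \<in> borel_measurable (leb (upper_pairs k))" if "l \<le> i'" "i' < k" for l i'
  proof -
    have [measurable]: "(\<lambda>x. x (m, i')) \<in> borel_measurable (leb (upper_pairs k))" if "m < l" for m
      by (rule measurable_upper_component) (use that \<open>l \<le> i'\<close> \<open>i' < k\<close> in auto)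
    show ?thesis unfolding tangent_diag_def by measurable
  qed
  show "(\<lambda>x. gram_offset x p) \<in> borel_measurable (leb (upper_pairs k))"
    unfolding gram_offset_def p prod.case
    by (intro borel_measurable_sum borel_measurable_times c) (use p in auto)
  show "(\<lambda>x. gram_slope x p) \<in> borel_measurable (leb (upper_pairs k))"
    unfolding gram_slope_def p prod.case
    by (intro borel_measurable_times d) (use p in auto)
qed

lemma abs_sin_arctan_less_1: "\<bar>s / sqrt (1 + s\<^sup>2)\<bar> < (1 :: real)"
proof -
  have "\<bar>s\<bar> = sqrt (s\<^sup>2)" by simp
  also have "\<dots> < sqrt (1 + s\<^sup>2)" by (subst real_sqrt_less_iff) simp
  finally show ?thesis by (simp add: abs_divide add_pos_nonneg)
qed

lemma tan_of_sin: "(s / sqrt (1 + s\<^sup>2)) / sqrt (1 - (s / sqrt (1 + s\<^sup>2))\<^sup>2) = (s :: real)"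
proof -
  have pos: "0 < 1 + s\<^sup>2" by (simp add: add_pos_nonneg)
  then have "1 - (s / sqrt (1 + s\<^sup>2))\<^sup>2 = 1 / (1 + s\<^sup>2)" by (simp add: power_divide field_simps)
  then show ?thesis using pos by (simp add: real_sqrt_divide)
qed

lemma sin_of_tan:
  assumes "\<bar>z :: real\<bar> < 1"
  shows "(z / sqrt (1 - z\<^sup>2)) / sqrt (1 + (z / sqrt (1 - z\<^sup>2))\<^sup>2) = z"
proof -
  have pos: "0 < 1 - z\<^sup>2" using assms by (simp add: abs_square_less_1)
  then have "1 + (z / sqrt (1 - z\<^sup>2))\<^sup>2 = 1 / (1 - z\<^sup>2)" by (simp add: power_divide field_simps)
  then show ?thesis using pos by (simp add: real_sqrt_divide)
qed

lemma gram_step_inv_gram_step: "gram_step_inv p t (gram_step p t s) = s"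
proof -
  have "(gram_step p t s - gram_offset t p) / gram_slope t p = s / sqrt (1 + s\<^sup>2)"
    using gram_slope_pos[of t p] by (simp add: gram_step_def)
  then show ?thesis
    using abs_sin_arctan_less_1[of s] tan_of_sin[of s] by (simp add: gram_step_inv_def)
qed

lemma gram_step_gram_step_inv:
  assumes "\<bar>(y - gram_offset t p) / gram_slope t p\<bar> < 1"
  shows "gram_step p t (gram_step_inv p t y) = y"
  using gram_slope_pos[of t p] sin_of_tan[OF assms]
  by (simp only: gram_step_inv_def Let_def assms if_True gram_step_def) simp

lemma differentiable_real_sqrt: "0 < x \<Longrightarrow> sqrt differentiable (at x)"
  by (metis DERIV_real_sqrt real_differentiable_def)

lemma nonsingular_gram_step: "nonsingular (gram_step p t)"
proof (rule nonsingularI[where P = "\<lambda>_. True" and g = "\<lambda>y. ((y - gram_offset t p) / gram_slope t p)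
     / sqrt (1 - ((y - gram_offset t p) / gram_slope t p)\<^sup>2)"])
  show "gram_step p t \<in> borel_measurable borel" unfolding gram_step_def by measurable
  fix s :: real
  have eq: "(gram_step p t s - gram_offset t p) / gram_slope t p = s / sqrt (1 + s\<^sup>2)"
    using gram_slope_pos[of t p] by (simp add: gram_step_def)
  then show "((gram_step p t s - gram_offset t p) / gram_slope t p)
     / sqrt (1 - ((gram_step p t s - gram_offset t p) / gram_slope t p)\<^sup>2) = s"
    by (simp only: tan_of_sin)
  have "0 < 1 - ((gram_step p t s - gram_offset t p) / gram_slope t p)\<^sup>2"
    unfolding eq using abs_sin_arctan_less_1[of s] by (simp add: abs_square_less_1 del: abs_divide)
  then show "(\<lambda>y. ((y - gram_offset t p) / gram_slope t p)
     / sqrt (1 - ((y - gram_offset t p) / gram_slope t p)\<^sup>2)) differentiable (at (gram_step p t s))"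
    using gram_slope_pos[of t p]
    by (intro derivative_intros differentiable_compose[of sqrt, OF differentiable_real_sqrt]) auto
qed auto

lemma nonsingular_gram_step_inv: "nonsingular (gram_step_inv p t)"
proof (rule nonsingularI[where P = "\<lambda>y. \<bar>(y - gram_offset t p) / gram_slope t p\<bar> < 1" and g = "gram_step p t"])
  show "gram_step_inv p t \<in> borel_measurable borel" unfolding gram_step_inv_def Let_def by measurable
  fix y :: real
  have "(\<lambda>s. s / sqrt (1 + s\<^sup>2)) differentiable (at u)" for u :: real
    using one_plus_sum_pos[of "\<lambda>_. u" "{()}"]
    by (intro derivative_intros differentiable_compose[of sqrt, OF differentiable_real_sqrt]) auto
  then have "(\<lambda>s. gram_offset t p + gram_slope t p * (s / sqrt (1 + s\<^sup>2))) differentiable (at (gram_step_inv p t y))"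
    by (rule differentiable_add[OF differentiable_const differentiable_mult[OF differentiable_const]])
  then show "gram_step p t differentiable (at (gram_step_inv p t y))"
    unfolding gram_step_def[abs_def] .
  show "gram_step_inv p t y = y" if "\<not> \<bar>(y - gram_offset t p) / gram_slope t p\<bar> < 1"
    unfolding gram_step_inv_def Let_def if_not_P[OF that] ..
qed (rule gram_step_gram_step_inv, assumption, measurable)

lemma measurable_gram_entries [measurable]:
  "gram_entries k \<in> leb (upper_pairs k) \<rightarrow>\<^sub>M leb (upper_pairs k)"
proof -
  have "(\<lambda>w. chol w i l) \<in> borel_measurable (leb (upper_pairs k))" if "i < k" for i l
  proof -
    have [measurable]: "cosine (col_pairs i) \<in> borel_measurable (leb (upper_pairs k))"
      by (rule measurable_cosine_sub) (use that col_pairs_subset in auto)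
    show ?thesis
    proof (cases "l < i")
      case True
      then have [measurable]: "(\<lambda>w. w (l, i)) \<in> borel_measurable (leb (upper_pairs k))"
        using that by (rule measurable_upper_component)
      show ?thesis unfolding chol_def if_P[OF True] by measurable
    next
      case False
      show ?thesis unfolding chol_def if_not_P[OF False] by measurable
    qed
  qed
  then have "(\<lambda>w. case p of (j, i) \<Rightarrow> \<Sum>l<k. chol w j l * chol w i l) \<in> borel_measurable (leb (upper_pairs k))"
    if "p \<in> upper_pairs k" for p
    using that by (cases p) (auto simp: upper_pairs_def intro!: borel_measurable_sum borel_measurable_times)
  then show ?thesis unfolding gram_entries_def by (intro measurable_restrict) simp
qed

text \<open>
  The entries are reached from \<open>w\<close> in two triangular steps, first to the tangents and then to the
  matrix.
\<close>

lemma gram_entries_null_preimage: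
  assumes B: "B \<in> null_sets (leb (upper_pairs k))"
  shows "gram_entries k -` B \<inter> space (leb (upper_pairs k)) \<in> null_sets (leb (upper_pairs k))"
proof -
  let ?S = "space (leb (upper_pairs k))"
  have "triangular_map (upper_pairs k) gram_step -` B \<inter> ?S \<in> null_sets (leb (upper_pairs k))"
  proof (rule triangular_map_null_preimage[OF finite_upper_pairs triangular_gram_step _ nonsingular_gram_step B])
    fix p assume p: "p \<in> upper_pairs k"
    have [measurable]: "(\<lambda>x. x p) \<in> borel_measurable (leb (upper_pairs k))"
      using p measurable_upper_component by (cases p) (auto simp: upper_pairs_def)
    note [measurable] = measurable_gram_coeffs[OF p]
    show "(\<lambda>x. gram_step p x (x p)) \<in> borel_measurable (leb (upper_pairs k))"
      unfolding gram_step_def by measurable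
  qed
  from triangular_map_null_preimage[OF finite_upper_pairs triangular_tangent_step measurable_tangent_step nonsingular_tangent_step this]
  have "tangents k -` (triangular_map (upper_pairs k) gram_step -` B \<inter> ?S) \<inter> ?S
      \<in> null_sets (leb (upper_pairs k))" .
  also have "tangents k -` (triangular_map (upper_pairs k) gram_step -` B \<inter> ?S) \<inter> ?S = gram_entries k -` B \<inter> ?S"
  proof -
    have 1: "triangular_map (upper_pairs k) gram_step (tangents k w) = gram_entries k w" if "w \<in> ?S" for w
      using gram_entries_gnomonic[of k "tangents k w"] gnomonic_tangents[OF that] by simp
    have 2: "tangents k w \<in> ?S" for w by (simp add: triangular_map_def space_PiM)
    show ?thesis
    proof (rule Set.set_eqI)
      fix w
      show "w \<in> tangents k -` (triangular_map (upper_pairs k) gram_step -` B \<inter> ?S) \<inter> ?S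
          \<longleftrightarrow> w \<in> gram_entries k -` B \<inter> ?S"
        using 1[of w] 2[of w] by (cases "w \<in> ?S") simp_all
    qed
  qed
  finally show ?thesis .
qed

lemma gram_entries_null_image:
  assumes B: "B \<in> sets (leb (upper_pairs k))" "B \<subseteq> gram_entries k ` space (leb (upper_pairs k))"
    and null: "gram_entries k -` B \<inter> space (leb (upper_pairs k)) \<in> null_sets (leb (upper_pairs k))"
  shows "B \<in> null_sets (leb (upper_pairs k))"
proof (rule triangular_map_null_image[OF finite_upper_pairs triangular_gram_step triangular_gram_step_inv])
  let ?S = "space (leb (upper_pairs k))"
  have sp: "triangular_map (upper_pairs k) \<phi> x \<in> ?S" for \<phi> x
    by (simp add: triangular_map_def space_PiM)
  have "gnomonic k -` (gram_entries k -` B \<inter> ?S) \<inter> ?S \<in> null_sets (leb (upper_pairs k))"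
    by (rule triangular_map_null_preimage[OF finite_upper_pairs triangular_gnomonic_step measurable_gnomonic_step nonsingular_gnomonic_step null])
  also have "gnomonic k -` (gram_entries k -` B \<inter> ?S) \<inter> ?S = triangular_map (upper_pairs k) gram_step -` B \<inter> ?S"
    using sp by (auto simp: gram_entries_gnomonic)
  finally show "triangular_map (upper_pairs k) gram_step -` B \<inter> ?S \<in> null_sets (leb (upper_pairs k))" .
  show "B \<subseteq> triangular_map (upper_pairs k) gram_step ` ?S"
  proof
    fix y assume "y \<in> B"
    then obtain w where w: "w \<in> ?S" "y = gram_entries k w" using B(2) by auto
    then have "y = triangular_map (upper_pairs k) gram_step (tangents k w)"
      using gram_entries_gnomonic[of k "tangents k w"] gnomonic_tangents by simp
    then show "y \<in> triangular_map (upper_pairs k) gram_step ` ?S" using sp by blast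
  qed
  fix p assume p: "p \<in> upper_pairs k"
  have [measurable]: "(\<lambda>x. x p) \<in> borel_measurable (leb (upper_pairs k))"
    using p measurable_upper_component by (cases p) (auto simp: upper_pairs_def)
  note [measurable] = measurable_gram_coeffs[OF p]
  show "(\<lambda>x. gram_step p x (x p)) \<in> borel_measurable (leb (upper_pairs k))"
    unfolding gram_step_def by measurable
  show "(\<lambda>(x, s). gram_step_inv p x s) \<in> borel_measurable (leb (upper_pairs k) \<Otimes>\<^sub>M borel)"
    unfolding gram_step_inv_def Let_def by measurable
qed (auto intro: nonsingular_gram_step_inv simp: gram_step_inv_gram_step B)

section \<open>Correlation matrices and Cholesky factors\<close>

lemma chol_row_unit:
  assumes "i < k" shows "(\<Sum>l<k. chol w i l * chol w i l) = 1"
proof -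
  have D: "0 < 1 + (\<Sum>l<i. (w (l, i))\<^sup>2)" by (simp add: add_pos_nonneg sum_nonneg)
  have "(\<Sum>l<k. chol w i l * chol w i l) = (\<Sum>l\<in>insert i {..<i}. (chol w i l)\<^sup>2)"
    unfolding power2_eq_square
    by (rule sum.mono_neutral_right) (use assms in \<open>auto simp: chol_def\<close>)
  also have "\<dots> = (cosine (col_pairs i) w)\<^sup>2 * (1 + (\<Sum>l<i. (w (l, i))\<^sup>2))"
    by (simp add: chol_def power_mult_distrib sum_distrib_left distrib_left)
  also have "\<dots> = 1"
    using D unfolding cosine_def sum_col_pairs by (simp add: power_divide)
  finally show ?thesis .
qed

lemma quadratic_form_eq_sum:
  assumes "M \<in> carrier_mat k k" "x \<in> carrier_vec k"
  shows "scalar_prod x (M *\<^sub>v x) = (\<Sum>i<k. \<Sum>j<k. x $ i * M $$ (i, j) * x $ j)"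
  using assms by (auto simp: scalar_prod_def lessThan_atLeast0 sum_distrib_left mult.assoc intro!: sum.cong)

lemma gram_quadratic_form:
  fixes L :: "nat \<Rightarrow> nat \<Rightarrow> real"
  shows "(\<Sum>i<k. \<Sum>j<k. x i * (\<Sum>l<m. L i l * L j l) * x j) = (\<Sum>l<m. (\<Sum>i<k. x i * L i l)\<^sup>2)"
proof -
  have "(\<Sum>l<m. (\<Sum>i<k. x i * L i l)\<^sup>2) = (\<Sum>l<m. \<Sum>i<k. \<Sum>j<k. (x i * L i l) * (x j * L j l))"
    by (simp add: power2_eq_square sum_product)
  also have "\<dots> = (\<Sum>i<k. \<Sum>l<m. \<Sum>j<k. (x i * L i l) * (x j * L j l))" by (rule sum.swap)
  also have "\<dots> = (\<Sum>i<k. \<Sum>j<k. \<Sum>l<m. (x i * L i l) * (x j * L j l))"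
    by (intro sum.cong refl sum.swap)
  also have "\<dots> = (\<Sum>i<k. \<Sum>j<k. x i * (\<Sum>l<m. L i l * L j l) * x j)"
    by (intro sum.cong refl) (simp add: sum_distrib_left sum_distrib_right mult_ac)
  finally show ?thesis ..
qed

lemma corr_matI:
  fixes L :: "nat \<Rightarrow> nat \<Rightarrow> real"
  assumes M: "M = mat k k (\<lambda>(i, j). \<Sum>l<m. L i l * L j l)" and unit: "\<And>i. i < k \<Longrightarrow> (\<Sum>l<m. L i l * L i l) = 1"
  shows "M \<in> corr_mats k"
proof -
  have car: "M \<in> carrier_mat k k" unfolding M by simp
  have "0 \<le> scalar_prod x (M *\<^sub>v x)" if x: "x \<in> carrier_vec k" for x
  proof -
    have "scalar_prod x (M *\<^sub>v x) = (\<Sum>i<k. \<Sum>j<k. x $ i * (\<Sum>l<m. L i l * L j l) * x $ j)"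
      unfolding quadratic_form_eq_sum[OF car x] by (intro sum.cong refl) (simp add: M)
    also have "\<dots> = (\<Sum>l<m. (\<Sum>i<k. x $ i * L i l)\<^sup>2)" by (rule gram_quadratic_form)
    also have "\<dots> \<ge> 0" by (intro sum_nonneg) simp
    finally show ?thesis .
  qed
  moreover have "transpose_mat M = M" unfolding M by (auto intro!: eq_matI simp: mult.commute)
  ultimately show ?thesis using car unit by (auto simp: corr_mats_def sym_unit_mats_def M)
qed

lemma gnomonic_gram_corr: "gnomonic_gram k w \<in> corr_mats k"
  by (rule corr_matI[OF gnomonic_gram_def chol_row_unit])

lemma det_gnomonic_gram: "Determinant.det (gnomonic_gram k w) = (cosine_prod k w)\<^sup>2"
proof -
  define L where "L = mat k k (\<lambda>(i, l). chol w i l)"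
  have L: "L \<in> carrier_mat k k" unfolding L_def by simp
  have "gnomonic_gram k w = L * transpose_mat L"
    by (rule eq_matI) (auto simp: gnomonic_gram_def L_def scalar_prod_def lessThan_atLeast0 intro!: sum.cong)
  moreover have "Determinant.det L = cosine_prod k w"
  proof -
    have "Determinant.det L = prod_list (diag_mat L)"
      by (rule det_lower_triangular[OF _ L]) (auto simp: L_def chol_def)
    also have "diag_mat L = map (\<lambda>i. cosine (col_pairs i) w) [0..<k]"
      by (auto simp: diag_mat_def L_def chol_def)
    also have "prod_list \<dots> = cosine_prod k w"
      unfolding cosine_prod_def by (simp add: prod.distinct_set_conv_list[symmetric] lessThan_atLeast0)
    finally show ?thesis .
  qed
  ultimately show ?thesis using L by (simp add: det_mult[OF L] Determinant.det_transpose[OF L] power2_eq_square)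
qed

definition pos_def_form :: "nat \<Rightarrow> (nat \<Rightarrow> nat \<Rightarrow> real) \<Rightarrow> bool" where
  "pos_def_form k a \<longleftrightarrow> (\<forall>x. (\<exists>i<k. x i \<noteq> 0) \<longrightarrow> 0 < (\<Sum>i<k. \<Sum>j<k. x i * a i j * x j))"

lemma forward_substitution:
  fixes L :: "nat \<Rightarrow> nat \<Rightarrow> real"
  assumes "\<And>i. i < k \<Longrightarrow> L i i \<noteq> 0"
  shows "\<exists>y. \<forall>i<k. (\<Sum>l\<le>i. L i l * y l) = m i"
  using assms
proof (induction k)
  case (Suc k)
  then obtain y where y: "\<forall>i<k. (\<Sum>l\<le>i. L i l * y l) = m i" by auto
  define z where "z = y(k := (m k - (\<Sum>l<k. L k l * y l)) / L k k)"
  have "(\<Sum>l\<le>i. L i l * z l) = m i" if "i < Suc k" for i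
  proof (cases "i = k")
    case True
    have "(\<Sum>l<k. L k l * z l) = (\<Sum>l<k. L k l * y l)" by (rule sum.cong) (auto simp: z_def)
    then show ?thesis using True Suc.prems by (simp add: lessThan_Suc_atMost[symmetric]) (simp add: z_def)
  next
    case False
    then have "i < k" using that by simp
    moreover have "(\<Sum>l\<le>i. L i l * z l) = (\<Sum>l\<le>i. L i l * y l)"
      by (rule sum.cong) (use \<open>i < k\<close> in \<open>auto simp: z_def\<close>)
    ultimately show ?thesis using y by simp
  qed
  then show ?case by blast
qed simp

lemma backward_substitution:
  fixes L :: "nat \<Rightarrow> nat \<Rightarrow> real"
  assumes "\<And>i. i < k \<Longrightarrow> L i i \<noteq> 0"
  shows "\<exists>x. \<forall>l<k. (\<Sum>i\<in>{l..<k}. x i * L i l) = y l"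
  using assms
proof (induction k arbitrary: y)
  case (Suc k)
  define c where "c = y k / L k k"
  obtain x where x: "\<forall>l<k. (\<Sum>i\<in>{l..<k}. x i * L i l) = y l - c * L k l"
    using Suc.IH[of "\<lambda>l. y l - c * L k l"] Suc.prems by auto
  have "(\<Sum>i\<in>{l..<Suc k}. (x(k := c)) i * L i l) = y l" if "l < Suc k" for l
  proof (cases "l = k")
    case True
    then show ?thesis using Suc.prems[of k] by (simp add: c_def)
  next
    case False
    then have "l < k" using that by simp
    moreover have "(\<Sum>i\<in>{l..<k}. (x(k := c)) i * L i l) = (\<Sum>i\<in>{l..<k}. x i * L i l)"
      by (rule sum.cong) auto
    ultimately show ?thesis using x by (simp add: fun_upd_def)
  qed
  then show ?case by blast
qed simp

text \<open>
  Bordering: if \<open>L\<close> is the factor of the leading block, the new row \<open>y\<close> solves \<open>L y = m\<close>, where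
  \<open>m\<close> is the new column of the matrix, and the new diagonal entry is the square root of
  \<open>a k k - \<parallel>y\<parallel>\<^sup>2\<close>. This number is positive because it is the value of the form at \<open>(x, -1)\<close>, where
  \<open>L\<^sup>T x = y\<close>.
\<close>

lemma cholesky_exists:
  fixes a :: "nat \<Rightarrow> nat \<Rightarrow> real"
  assumes "pos_def_form k a" and sym: "\<And>i j. i < k \<Longrightarrow> j < k \<Longrightarrow> a i j = a j i"
  shows "\<exists>L. (\<forall>i<k. 0 < L i i) \<and> (\<forall>i l. i < l \<longrightarrow> L i l = 0) \<and> (\<forall>i<k. \<forall>j<k. a i j = (\<Sum>l<k. L i l * L j l))"
  using assms
proof (induction k)
  case 0
  show ?case by (rule exI[of _ "\<lambda>_ _. 0"]) simp
next
  case (Suc k)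
  have quad: "(\<Sum>i<Suc k. \<Sum>j<Suc k. x i * a i j * x j)
     = (\<Sum>i<k. \<Sum>j<k. x i * a i j * x j) + 2 * x k * (\<Sum>i<k. a k i * x i) + a k k * (x k)\<^sup>2" for x
  proof -
    have "(\<Sum>i<k. x i * a i k * x k) = x k * (\<Sum>i<k. a k i * x i)"
      unfolding sum_distrib_left by (intro sum.cong refl) (use Suc.prems(2) in \<open>simp add: mult_ac\<close>)
    moreover have "(\<Sum>i<k. x k * a k i * x i) = x k * (\<Sum>i<k. a k i * x i)"
      unfolding sum_distrib_left by (intro sum.cong refl) (simp add: mult_ac)
    ultimately show ?thesis by (simp add: sum.distrib power2_eq_square)
  qed
  have "pos_def_form k a"
    unfolding pos_def_form_def
  proof (intro allI impI)
    fix x :: "nat \<Rightarrow> real" assume "\<exists>i<k. x i \<noteq> 0"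
    then have "\<exists>i<Suc k. (x(k := 0)) i \<noteq> 0" by (auto intro!: less_SucI)
    then have "0 < (\<Sum>i<Suc k. \<Sum>j<Suc k. (x(k := 0)) i * a i j * (x(k := 0)) j)"
      using Suc.prems(1) unfolding pos_def_form_def by blast
    also have "\<dots> = (\<Sum>i<k. \<Sum>j<k. x i * a i j * x j)"
      unfolding quad by (auto intro!: sum.cong)
    finally show "0 < (\<Sum>i<k. \<Sum>j<k. x i * a i j * x j)" .
  qed
  then obtain L where L: "\<forall>i<k. 0 < L i i" "\<forall>i l. i < l \<longrightarrow> L i l = 0" "\<forall>i<k. \<forall>j<k. a i j = (\<Sum>l<k. L i l * L j l)"
    using Suc.IH Suc.prems(2) by (metis less_SucI)
  have Lnz: "L i i \<noteq> 0" if "i < k" for i using L(1) that by fastforce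
  obtain y where y: "\<forall>i<k. (\<Sum>l\<le>i. L i l * y l) = a k i"
    using forward_substitution[of k L "a k"] Lnz by blast
  have y': "(\<Sum>l<k. L i l * y l) = a k i" if "i < k" for i
  proof -
    have "(\<Sum>l<k. L i l * y l) = (\<Sum>l\<le>i. L i l * y l)"
      by (rule sum.mono_neutral_right) (use that L(2) in auto)
    then show ?thesis using y that by simp
  qed
  obtain x where x: "\<forall>l<k. (\<Sum>i\<in>{l..<k}. x i * L i l) = y l"
    using backward_substitution[of k L y] Lnz by blast
  have x': "(\<Sum>i<k. x i * L i l) = y l" if "l < k" for l
  proof -
    have "(\<Sum>i<k. x i * L i l) = (\<Sum>i\<in>{l..<k}. x i * L i l)"
      by (rule sum.mono_neutral_right) (use that L(2) in auto)
    then show ?thesis using x that by simp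
  qed
  have pos: "0 < a k k - (\<Sum>l<k. (y l)\<^sup>2)"
  proof -
    have "0 < (\<Sum>i<Suc k. \<Sum>j<Suc k. (x(k := -1)) i * a i j * (x(k := -1)) j)"
    proof -
      have "\<exists>i<Suc k. (x(k := -1)) i \<noteq> 0" by (rule exI[of _ k]) simp
      then show ?thesis using Suc.prems(1) unfolding pos_def_form_def by blast
    qed
    also have "\<dots> = (\<Sum>i<k. \<Sum>j<k. x i * a i j * x j) - 2 * (\<Sum>i<k. a k i * x i) + a k k"
    proof -
      have "(\<Sum>i<k. \<Sum>j<k. (x(k := -1)) i * a i j * (x(k := -1)) j) = (\<Sum>i<k. \<Sum>j<k. x i * a i j * x j)"
        by (intro sum.cong refl) auto
      moreover have "(\<Sum>i<k. a k i * (x(k := -1)) i) = (\<Sum>i<k. a k i * x i)"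
        by (intro sum.cong refl) auto
      ultimately show ?thesis unfolding quad by simp
    qed
    also have "(\<Sum>i<k. \<Sum>j<k. x i * a i j * x j) = (\<Sum>i<k. \<Sum>j<k. x i * (\<Sum>l<k. L i l * L j l) * x j)"
      by (intro sum.cong refl) (use L(3) in auto)
    also have "\<dots> = (\<Sum>l<k. (y l)\<^sup>2)"
      unfolding gram_quadratic_form by (intro sum.cong refl) (simp add: x')
    also have "(\<Sum>i<k. a k i * x i) = (\<Sum>i<k. \<Sum>l<k. L i l * y l * x i)"
      by (intro sum.cong refl) (simp add: y'[symmetric] sum_distrib_right)
    also have "\<dots> = (\<Sum>l<k. \<Sum>i<k. L i l * y l * x i)" by (rule sum.swap)
    also have "\<dots> = (\<Sum>l<k. (y l)\<^sup>2)"
    proof (intro sum.cong refl)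
      fix l assume "l \<in> {..<k}"
      have "(\<Sum>i<k. L i l * y l * x i) = y l * (\<Sum>i<k. x i * L i l)"
        by (simp add: sum_distrib_left mult_ac)
      then show "(\<Sum>i<k. L i l * y l * x i) = (y l)\<^sup>2" using x' \<open>l \<in> _\<close> by (simp add: power2_eq_square)
    qed
    finally show ?thesis by simp
  qed
  define d where "d = sqrt (a k k - (\<Sum>l<k. (y l)\<^sup>2))"
  have d: "0 < d" "d * d = a k k - (\<Sum>l<k. (y l)\<^sup>2)" using pos by (auto simp: d_def)
  define L' where "L' i l = (if i < k then L i l else if i = k then (if l < k then y l else if l = k then d else 0) else 0)" for i l
  have "a i j = (\<Sum>l<Suc k. L' i l * L' j l)" if ij: "i < Suc k" "j < Suc k" for i j
  proof -
    consider "i < k" "j < k" | "i < k" "j = k" | "i = k" "j < k" | "i = k" "j = k" using ij by linarith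
    then show ?thesis
    proof cases
      case 1
      then have "(\<Sum>l<k. L' i l * L' j l) = a i j" using L(3) by (simp add: L'_def)
      moreover have "L' i k = 0" using 1 L(2) by (simp add: L'_def)
      ultimately show ?thesis by simp
    next
      case 2
      then have "(\<Sum>l<k. L' i l * L' j l) = a k i" using y'[of i] by (simp add: L'_def)
      moreover have "L' i k = 0" using 2 L(2) by (simp add: L'_def)
      ultimately show ?thesis using Suc.prems(2)[of i j] 2 by simp
    next
      case 3
      then have "(\<Sum>l<k. L' i l * L' j l) = a k j" using y'[of j] by (simp add: L'_def mult.commute)
      moreover have "L' j k = 0" using 3 L(2) by (simp add: L'_def)
      ultimately show ?thesis using 3 by simp
    next
      case 4
      then have "(\<Sum>l<k. L' i l * L' j l) = (\<Sum>l<k. (y l)\<^sup>2)" by (simp add: L'_def power2_eq_square)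
      moreover have "L' k k = d" by (simp add: L'_def)
      ultimately show ?thesis using 4 d(2) by simp
    qed
  qed
  moreover have "\<forall>i<Suc k. 0 < L' i i" using L(1) d(1) by (auto simp: L'_def less_Suc_eq)
  moreover have "\<forall>i l. i < l \<longrightarrow> L' i l = 0" using L(2) by (auto simp: L'_def)
  ultimately show ?case by blast
qed

text \<open>
  A zero \<open>x\<close> of a nonnegative quadratic form is a minimum, so the gradient \<open>2 M x\<close> vanishes there;
  if \<open>x \<noteq> 0\<close> then \<open>M\<close> is singular.
\<close>

lemma corr_mat_pos_def:
  assumes M: "M \<in> corr_mats k" and det: "Determinant.det M \<noteq> 0"
  shows "pos_def_form k (\<lambda>i j. M $$ (i, j))"
proof -
  have car: "M \<in> carrier_mat k k" and psd: "\<And>x. x \<in> carrier_vec k \<Longrightarrow> 0 \<le> scalar_prod x (M *\<^sub>v x)"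
    and tr: "transpose_mat M = M"
    using M by (auto simp: corr_mats_def sym_unit_mats_def)
  have sym: "M $$ (i, j) = M $$ (j, i)" if "i < k" "j < k" for i j
    using that car tr by (metis carrier_matD index_transpose_mat(1))
  define Q where "Q x = (\<Sum>i<k. \<Sum>j<k. x i * M $$ (i, j) * x j)" for x
  have Q: "0 \<le> Q x" for x
  proof -
    have "scalar_prod (vec k x) (M *\<^sub>v vec k x) = Q x"
      unfolding Q_def using quadratic_form_eq_sum[OF car, of "vec k x"] by (simp cong: sum.cong_simp)
    then show ?thesis using psd[of "vec k x"] by simp
  qed
  have expand: "Q (\<lambda>i. x i + t * z i) = Q x + 2 * t * (\<Sum>i<k. z i * (\<Sum>j<k. M $$ (i, j) * x j)) + t\<^sup>2 * Q z" for x z t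
  proof -
    have "(\<Sum>i<k. \<Sum>j<k. x i * M $$ (i, j) * z j) = (\<Sum>i<k. \<Sum>j<k. z i * M $$ (i, j) * x j)"
      by (subst sum.swap) (intro sum.cong refl, use sym in \<open>simp add: mult_ac\<close>)
    moreover have "Q (\<lambda>i. x i + t * z i) = Q x + t * (\<Sum>i<k. \<Sum>j<k. x i * M $$ (i, j) * z j)
        + t * (\<Sum>i<k. \<Sum>j<k. z i * M $$ (i, j) * x j) + t\<^sup>2 * Q z"
      by (simp add: Q_def algebra_simps sum.distrib sum_distrib_left power2_eq_square)
    moreover have "(\<Sum>i<k. \<Sum>j<k. z i * M $$ (i, j) * x j) = (\<Sum>i<k. z i * (\<Sum>j<k. M $$ (i, j) * x j))"
      by (simp add: sum_distrib_left mult.assoc)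
    ultimately show ?thesis by simp
  qed
  show ?thesis
    unfolding pos_def_form_def
  proof (intro allI impI)
    fix x :: "nat \<Rightarrow> real" assume nz: "\<exists>i<k. x i \<noteq> 0"
    have "Q x \<noteq> 0"
    proof
      assume Qx: "Q x = 0"
      define z where "z i = (\<Sum>j<k. M $$ (i, j) * x j)" for i
      define S where "S = (\<Sum>i<k. z i * z i)"
      have S0: "0 \<le> S" unfolding S_def by (intro sum_nonneg) simp
      have "S = 0"
      proof (rule ccontr)
        assume "S \<noteq> 0"
        then have S: "0 < S" using S0 by simp
        \<comment> \<open>a step against the gradient \<open>z\<close>; the \<open>1\<close> guards against \<open>Q z = 0\<close>\<close>
        define t where "t = - S / (Q z + 1)"
        have q: "0 < Q z + 1" using Q[of z] by simp
        have "Q (\<lambda>i. x i + t * z i) = 2 * t * S + t\<^sup>2 * Q z"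
          using expand[of x t z] Qx by (simp add: S_def z_def)
        also have "\<dots> \<le> 2 * t * S + t\<^sup>2 * (Q z + 1)" by (simp add: distrib_left)
        also have "t\<^sup>2 * (Q z + 1) = - t * S" using q by (simp add: t_def power2_eq_square)
        also have "2 * t * S + - t * S = t * S" by simp
        also have "t * S < 0" using S q by (simp add: t_def divide_neg_pos mult_neg_pos)
        finally show False using Q[of "\<lambda>i. x i + t * z i"] by simp
      qed
      then have "z i = 0" if "i < k" for i
        using that unfolding S_def by (subst (asm) sum_nonneg_eq_0_iff) auto
      then have "M *\<^sub>v vec k x = 0\<^sub>v k"
        using car by (intro eq_vecI) (auto simp: scalar_prod_def z_def lessThan_atLeast0)
      moreover have "vec k x \<noteq> 0\<^sub>v k" using nz by (metis index_vec index_zero_vec(1))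
      ultimately have "Determinant.det M = 0"
        using det_0_iff_vec_prod_zero_field[OF car] vec_carrier by blast
      then show False using det by simp
    qed
    then show "0 < (\<Sum>i<k. \<Sum>j<k. x i * M $$ (i, j) * x j)" using Q[of x] by (simp add: Q_def)
  qed
qed

text \<open>
  Dividing each row of a Cholesky factor by its diagonal entry yields the gnomonic coordinates, as
  the rows of the factor of a correlation matrix are unit vectors.
\<close>

lemma corr_mat_gnomonic_gram:
  assumes M: "M \<in> corr_mats k" and det: "Determinant.det M \<noteq> 0"
  obtains w where "w \<in> space (leb (upper_pairs k))" "M = gnomonic_gram k w"
proof -
  have car: "M \<in> carrier_mat k k" and tr: "transpose_mat M = M" and unit: "\<And>i. i < k \<Longrightarrow> M $$ (i, i) = 1"
    using M by (auto simp: corr_mats_def sym_unit_mats_def)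
  have sym: "M $$ (i, j) = M $$ (j, i)" if "i < k" "j < k" for i j
    using that car tr by (metis carrier_matD index_transpose_mat(1))
  obtain L where L: "\<forall>i<k. 0 < L i i" "\<forall>i l. i < l \<longrightarrow> L i l = 0"
    "\<forall>i<k. \<forall>j<k. M $$ (i, j) = (\<Sum>l<k. L i l * L j l)"
    using cholesky_exists[OF corr_mat_pos_def[OF M det] sym] by auto
  define w where "w = (\<lambda>(l, i)\<in>upper_pairs k. L i l / L i i)"
  have chol: "chol w i l = L i l" if "i < k" "l < k" for i l
  proof -
    have pos: "0 < L i i" using L(1) that by simp
    have "1 = (\<Sum>l<k. (L i l)\<^sup>2)" using L(3) unit that by (simp add: power2_eq_square)
    also have "\<dots> = (\<Sum>l\<in>insert i {..<i}. (L i l)\<^sup>2)"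
      by (rule sum.mono_neutral_right) (use that L(2) in auto)
    also have "\<dots> = (L i i)\<^sup>2 * (1 + (\<Sum>p\<in>col_pairs i. (w p)\<^sup>2))"
      unfolding sum_col_pairs using that pos
      by (simp add: w_def upper_pairs_def power_divide distrib_left sum_distrib_left)
    finally have eq: "(L i i)\<^sup>2 * (1 + (\<Sum>p\<in>col_pairs i. (w p)\<^sup>2)) = 1" ..
    have "L i i * sqrt (1 + (\<Sum>p\<in>col_pairs i. (w p)\<^sup>2)) = sqrt ((L i i)\<^sup>2 * (1 + (\<Sum>p\<in>col_pairs i. (w p)\<^sup>2)))"
      using pos by (simp add: real_sqrt_mult)
    also have "\<dots> = 1" unfolding eq by simp
    finally have "cosine (col_pairs i) w = L i i"
      unfolding cosine_def by (metis mult_zero_right nonzero_eq_divide_eq zero_neq_one)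
    then show ?thesis using that pos L(2) by (auto simp: chol_def w_def upper_pairs_def)
  qed
  have "M = gnomonic_gram k w"
    using car L(3) chol by (intro eq_matI) (auto simp: gnomonic_gram_def)
  moreover have "w \<in> space (leb (upper_pairs k))" by (simp add: w_def space_PiM)
  ultimately show thesis using that by blast
qed

section \<open>Measurability of matrix functions\<close>

lemma space_borel_sym_unit: "space (borel_sym_unit k) = sym_unit_mats k"
  by (simp add: borel_sym_unit_def)

lemma upper_entries_mat_of_upper:
  "x \<in> space (leb (upper_pairs k)) \<Longrightarrow> upper_entries k (mat_of_upper k x) = x"
  by (auto simp: upper_entries_def mat_of_upper_def upper_pairs_def space_PiM PiE_iff extensional_def fun_eq_iff)

lemma mat_of_upper_upper_entries:
  assumes "M \<in> sym_unit_mats k" shows "mat_of_upper k (upper_entries k M) = M"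
proof -
  have car: "M \<in> carrier_mat k k" and tr: "transpose_mat M = M" and unit: "\<And>i. i < k \<Longrightarrow> M $$ (i, i) = 1"
    using assms by (auto simp: sym_unit_mats_def)
  have sym: "M $$ (i, j) = M $$ (j, i)" if "i < k" "j < k" for i j
    using that car tr by (metis carrier_matD index_transpose_mat(1))
  show ?thesis
    using car unit sym by (intro eq_matI) (auto simp: mat_of_upper_def upper_entries_def upper_pairs_def)
qed

lemma mat_of_upper_sym_unit: "mat_of_upper k x \<in> sym_unit_mats k"
  by (auto simp: mat_of_upper_def sym_unit_mats_def intro!: eq_matI)

lemma measurable_into_borel_sym_unit:
  assumes "\<And>z. z \<in> space N \<Longrightarrow> f z \<in> sym_unit_mats k"
    and "(\<lambda>z. upper_entries k (f z)) \<in> N \<rightarrow>\<^sub>M leb (upper_pairs k)"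
  shows "f \<in> N \<rightarrow>\<^sub>M borel_sym_unit k"
  unfolding borel_sym_unit_def
proof (rule measurable_vimage_algebra2)
  show "(\<lambda>z. upper_entries k (f z)) \<in> N \<rightarrow>\<^sub>M Pi\<^sub>M (upper_pairs k) (\<lambda>_. borel)"
    using assms(2) by (subst measurable_cong_sets[OF refl sets_leb[symmetric]])
qed (use assms(1) in auto)

lemma measurable_mat_of_upper [measurable]:
  "mat_of_upper k \<in> leb (upper_pairs k) \<rightarrow>\<^sub>M borel_sym_unit k"
proof (rule measurable_into_borel_sym_unit)
  show "(\<lambda>x. upper_entries k (mat_of_upper k x)) \<in> leb (upper_pairs k) \<rightarrow>\<^sub>M leb (upper_pairs k)"
    by (subst measurable_cong[where g = "\<lambda>x. x"]) (auto simp: upper_entries_mat_of_upper)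
qed (rule mat_of_upper_sym_unit)

lemma measurable_upper_entries:
  "upper_entries k \<in> borel_sym_unit k \<rightarrow>\<^sub>M leb (upper_pairs k)"
proof -
  have "upper_entries k \<in> borel_sym_unit k \<rightarrow>\<^sub>M Pi\<^sub>M (upper_pairs k) (\<lambda>_. borel)"
    unfolding borel_sym_unit_def
    by (rule measurable_vimage_algebra1) (auto simp: upper_entries_def space_PiM)
  then show ?thesis by (subst measurable_cong_sets[OF refl sets_leb])
qed

lemma measurable_entry:
  assumes "i < k" "j < k"
  shows "(\<lambda>M. M $$ (i, j)) \<in> borel_measurable (borel_sym_unit k)"
proof -
  have up: "(\<lambda>M. M $$ (a, b)) \<in> borel_measurable (borel_sym_unit k)" if ab: "a < b" "b < k" for a b
  proof -
    have "(\<lambda>M. upper_entries k M (a, b)) \<in> borel_measurable (borel_sym_unit k)"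
      using measurable_compose[OF measurable_upper_entries measurable_upper_component[OF ab]] .
    then show ?thesis using ab by (simp add: upper_entries_def upper_pairs_def)
  qed
  consider "i < j" | "i = j" | "j < i" by linarith
  then show ?thesis
  proof cases
    case 1
    then show ?thesis using up assms by simp
  next
    case 2
    have "(\<lambda>M. 1 :: real) \<in> borel_measurable (borel_sym_unit k)" by simp
    then show ?thesis
      by (rule measurable_cong[THEN iffD1, rotated])
         (use 2 assms in \<open>auto simp: space_borel_sym_unit sym_unit_mats_def\<close>)
  next
    case 3
    show ?thesis
    proof (rule measurable_cong[THEN iffD1, OF _ up[OF 3 assms(1)]])
      fix M assume "M \<in> space (borel_sym_unit k)"
      then have "M \<in> carrier_mat k k" "transpose_mat M = M" by (auto simp: space_borel_sym_unit sym_unit_mats_def)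
      then show "M $$ (j, i) = M $$ (i, j)" using assms by (metis carrier_matD index_transpose_mat(1))
    qed
  qed
qed

lemma measurable_det:
  "Determinant.det \<in> borel_measurable (borel_sym_unit k)"
proof -
  have "(\<lambda>M. \<Sum>p | p permutes {0..<k}. signof p * (\<Prod>i = 0..<k. M $$ (i, p i))) \<in> borel_measurable (borel_sym_unit k)"
  proof (intro borel_measurable_sum borel_measurable_times borel_measurable_prod borel_measurable_const measurable_entry)
    fix p i assume "p \<in> {p. p permutes {0..<k}}" "i \<in> {0..<k}"
    then show "i < k" "p i < k" using permutes_in_image[of p "{0..<k}" i] by auto
  qed
  then show ?thesis
    by (rule measurable_cong[THEN iffD1, rotated])
       (auto simp: space_borel_sym_unit sym_unit_mats_def det_def')
qed

text \<open>
  Continuity and homogeneity of the form reduce semidefiniteness to integer vectors. These are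
  countably many conditions, which makes the set of correlation matrices measurable.
\<close>

lemma psd_iff_integer_vectors:
  fixes a :: "nat \<Rightarrow> nat \<Rightarrow> real"
  shows "(\<forall>x. 0 \<le> (\<Sum>i<k. \<Sum>j<k. x i * a i j * x j))
     \<longleftrightarrow> (\<forall>zs :: int list. 0 \<le> (\<Sum>i<k. \<Sum>j<k. real_of_int (zs ! i) * a i j * real_of_int (zs ! j)))"
proof (intro iffI allI)
  fix x :: "nat \<Rightarrow> real"
  assume int: "\<forall>zs :: int list. 0 \<le> (\<Sum>i<k. \<Sum>j<k. real_of_int (zs ! i) * a i j * real_of_int (zs ! j))"
  define q where "q m i = real_of_int \<lfloor>real m * x i\<rfloor> / real m" for m i
  have lim: "(\<lambda>m. q m i) \<longlonglongrightarrow> x i" for i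
  proof (rule real_tendsto_sandwich[where f = "\<lambda>m. x i - 1 / real m" and h = "\<lambda>_. x i"])
    show "\<forall>\<^sub>F m in sequentially. x i - 1 / real m \<le> q m i"
      using eventually_gt_at_top[of 0]
    proof eventually_elim
      case (elim m)
      have "(real m * x i - 1) / real m \<le> real_of_int \<lfloor>real m * x i\<rfloor> / real m"
        by (intro divide_right_mono) linarith+
      then show ?case using elim by (simp add: q_def diff_divide_distrib)
    qed
    show "\<forall>\<^sub>F m in sequentially. q m i \<le> x i"
      using eventually_gt_at_top[of 0]
    proof eventually_elim
      case (elim m)
      have "real_of_int \<lfloor>real m * x i\<rfloor> \<le> real m * x i" by linarith
      then show ?case using elim by (simp add: q_def field_simps)
    qed
  qed real_asymp+
  have "(\<lambda>m. \<Sum>i<k. \<Sum>j<k. q m i * a i j * q m j) \<longlonglongrightarrow> (\<Sum>i<k. \<Sum>j<k. x i * a i j * x j)"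
    by (intro tendsto_intros lim)
  moreover have "0 \<le> (\<Sum>i<k. \<Sum>j<k. q m i * a i j * q m j)" for m
  proof -
    define zs where "zs = map (\<lambda>i. \<lfloor>real m * x i\<rfloor>) [0..<k]"
    have "(\<Sum>i<k. \<Sum>j<k. q m i * a i j * q m j)
        = (\<Sum>i<k. \<Sum>j<k. real_of_int (zs ! i) * a i j * real_of_int (zs ! j)) * (1 / (real m)\<^sup>2)"
      unfolding sum_distrib_right
      by (intro sum.cong refl) (simp add: q_def zs_def power2_eq_square)
    then show ?thesis using int by simp
  qed
  ultimately show "0 \<le> (\<Sum>i<k. \<Sum>j<k. x i * a i j * x j)"
    by (intro LIMSEQ_le_const) auto
qed auto

lemma corr_mats_iff:
  assumes "M \<in> sym_unit_mats k"
  shows "M \<in> corr_mats k \<longleftrightarrow> (\<forall>x. 0 \<le> (\<Sum>i<k. \<Sum>j<k. x i * M $$ (i, j) * x j))"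
proof -
  have car: "M \<in> carrier_mat k k" using assms by (auto simp: sym_unit_mats_def)
  have vec: "scalar_prod (vec k x) (M *\<^sub>v vec k x) = (\<Sum>i<k. \<Sum>j<k. x i * M $$ (i, j) * x j)" for x
    using quadratic_form_eq_sum[OF car, of "vec k x"] by (simp cong: sum.cong_simp)
  show ?thesis
  proof
    assume "M \<in> corr_mats k"
    then have "0 \<le> scalar_prod (vec k x) (M *\<^sub>v vec k x)" for x by (simp add: corr_mats_def)
    then show "\<forall>x. 0 \<le> (\<Sum>i<k. \<Sum>j<k. x i * M $$ (i, j) * x j)" unfolding vec by blast
  next
    assume "\<forall>x. 0 \<le> (\<Sum>i<k. \<Sum>j<k. x i * M $$ (i, j) * x j)"
    then show "M \<in> corr_mats k"
      using assms quadratic_form_eq_sum[OF car] by (simp add: corr_mats_def)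
  qed
qed

lemma sets_corr_mats [measurable]: "corr_mats k \<in> sets (borel_sym_unit k)"
proof -
  have "corr_mats k = {M \<in> space (borel_sym_unit k).
      \<forall>zs :: int list. 0 \<le> (\<Sum>i<k. \<Sum>j<k. real_of_int (zs ! i) * M $$ (i, j) * real_of_int (zs ! j))}"
    using corr_mats_iff psd_iff_integer_vectors
    by (auto simp: space_borel_sym_unit corr_mats_def)
  also have "\<dots> \<in> sets (borel_sym_unit k)"
  proof (rule sets.sets_Collect_countable_All)
    fix zs :: "int list"
    have [measurable]: "(\<lambda>M. \<Sum>i<k. \<Sum>j<k. real_of_int (zs ! i) * M $$ (i, j) * real_of_int (zs ! j)) \<in> borel_measurable (borel_sym_unit k)"
      by (intro borel_measurable_sum borel_measurable_times borel_measurable_const measurable_entry) auto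
    show "{M \<in> space (borel_sym_unit k). 0 \<le> (\<Sum>i<k. \<Sum>j<k. real_of_int (zs ! i) * M $$ (i, j) * real_of_int (zs ! j))} \<in> sets (borel_sym_unit k)"
      by measurable
  qed
  finally show ?thesis .
qed

lemma corr_mats_subset: "corr_mats k \<subseteq> sym_unit_mats k"
  by (auto simp: corr_mats_def)

lemma sets_borel_corr_iff: "A \<in> sets (borel_corr k) \<longleftrightarrow> A \<in> sets (borel_sym_unit k) \<and> A \<subseteq> corr_mats k"
  unfolding borel_corr_def by (subst sets_restrict_space_iff) (auto simp: Int_absorb2 corr_mats_subset space_borel_sym_unit)

lemma measurable_gnomonic_gram [measurable]:
  "gnomonic_gram k \<in> leb (upper_pairs k) \<rightarrow>\<^sub>M borel_sym_unit k"
  by (rule measurable_into_borel_sym_unit)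
     (use gnomonic_gram_corr corr_mats_subset measurable_gram_entries upper_entries_gnomonic_gram in auto)

section \<open>The law of the random Gram matrix\<close>

lemma sphere_unit: "v \<in> space (sphere_PiM n k) \<Longrightarrow> i < k \<Longrightarrow> dotp {..<n} (v i) (v i) = 1"
  by (auto simp: space_PiM space_uniform_sphere unit_sphere_def L2_set_eq_dotp PiE_iff)

lemma gram_mat_corr: "v \<in> space (sphere_PiM n k) \<Longrightarrow> gram_mat k n v \<in> corr_mats k"
  by (rule corr_matI[OF gram_mat_def]) (use sphere_unit in \<open>auto simp: dotp_def\<close>)

lemma measurable_gram_mat: "gram_mat k n \<in> sphere_PiM n k \<rightarrow>\<^sub>M borel_corr k"
  unfolding borel_corr_def
proof (rule measurable_restrict_space2)
  show "gram_mat k n \<in> space (sphere_PiM n k) \<rightarrow> corr_mats k" using gram_mat_corr by auto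
  show "gram_mat k n \<in> sphere_PiM n k \<rightarrow>\<^sub>M borel_sym_unit k"
  proof (rule measurable_into_borel_sym_unit)
    show "gram_mat k n v \<in> sym_unit_mats k" if "v \<in> space (sphere_PiM n k)" for v
      using gram_mat_corr[OF that] corr_mats_subset by auto
    have "(\<lambda>v. \<Sum>l<n. v i l * v j l) \<in> borel_measurable (sphere_PiM n k)" if "i < j" "j < k" for i j
      by (intro borel_measurable_sum borel_measurable_times measurable_sphere_component) (use that in auto)
    then have "(\<lambda>v. gram_mat k n v $$ p) \<in> borel_measurable (sphere_PiM n k)" if "p \<in> upper_pairs k" for p
      using that by (cases p) (auto simp: gram_mat_def upper_pairs_def)
    then show "(\<lambda>v. upper_entries k (gram_mat k n v)) \<in> sphere_PiM n k \<rightarrow>\<^sub>M leb (upper_pairs k)"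
      unfolding upper_entries_def by (intro measurable_restrict) simp
  qed
qed

lemma gnomonic_gram_restrict: "gnomonic_gram k (restrict w (upper_pairs k)) = gnomonic_gram k w"
proof -
  have "chol (restrict w (upper_pairs k)) i l = chol w i l" if "i < k" for i l
  proof -
    have "cosine (col_pairs i) (restrict w (upper_pairs k)) = cosine (col_pairs i) w"
      unfolding cosine_def
      by (intro arg_cong[where f = "\<lambda>s. 1 / sqrt (1 + s)"] sum.cong) (use that in \<open>auto simp: upper_pairs_def\<close>)
    then show ?thesis using that by (auto simp: chol_def upper_pairs_def)
  qed
  then show ?thesis unfolding gnomonic_gram_def by (intro eq_matI) auto
qed

text \<open>
  The integral of \<open>det(M(w)) powr (n / 2)\<close> over the coordinates of the matrices in \<open>A\<close>.
\<close>

definition det_power_integral :: "nat \<Rightarrow> nat \<Rightarrow> real mat set \<Rightarrow> ennreal" where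
  "det_power_integral k n A = (\<integral>\<^sup>+w. indicator A (gnomonic_gram k w) * ennreal (cosine_prod k w ^ n) \<partial>leb (upper_pairs k))"

lemma emeasure_gram_distr:
  assumes "k \<le> n" "0 < n"
  shows "\<exists>C. \<forall>A \<in> sets (borel_corr k). emeasure (gram_distr k n) A = C * det_power_integral k n A"
proof -
  obtain C where C: "\<And>f. f \<in> borel_measurable (leb (upper_pairs k)) \<Longrightarrow>
     (\<integral>\<^sup>+v. f (\<lambda>p\<in>upper_pairs k. gs_coord n v p) \<partial>sphere_PiM n k)
      = C * (\<integral>\<^sup>+w. f w * ennreal (cosine_prod k w ^ n) \<partial>leb (upper_pairs k))"
    using gs_coord_law[OF assms] by blast
  show ?thesis
  proof (intro exI[of _ C] ballI)
    fix A assume A: "A \<in> sets (borel_corr k)"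
    then have [measurable]: "A \<in> sets (borel_sym_unit k)" by (simp add: sets_borel_corr_iff)
    have pre: "gram_mat k n -` A \<inter> space (sphere_PiM n k) \<in> sets (sphere_PiM n k)"
      using measurable_sets[OF measurable_gram_mat A] .
    have "emeasure (gram_distr k n) A = emeasure (sphere_PiM n k) (gram_mat k n -` A \<inter> space (sphere_PiM n k))"
      unfolding gram_distr_def by (rule emeasure_distr[OF measurable_gram_mat A])
    also have "\<dots> = (\<integral>\<^sup>+v. indicator (gram_mat k n -` A \<inter> space (sphere_PiM n k)) v \<partial>sphere_PiM n k)"
      using pre by simp
    also have "\<dots> = (\<integral>\<^sup>+v. indicator A (gnomonic_gram k (\<lambda>p\<in>upper_pairs k. gs_coord n v p)) \<partial>sphere_PiM n k)"
    proof (rule nn_integral_cong_AE)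
      show "AE v in sphere_PiM n k. indicator (gram_mat k n -` A \<inter> space (sphere_PiM n k)) v
          = (indicator A (gnomonic_gram k (\<lambda>p\<in>upper_pairs k. gs_coord n v p)) :: ennreal)"
        using AE_gs_resid_pos[OF assms] AE_space
      proof eventually_elim
        case (elim v)
        then have "gram_mat k n v = gnomonic_gram k (gs_coord n v)"
          by (intro gram_mat_eq_gnomonic_gram sphere_unit) auto
        then show ?case using elim(2) by (simp add: gnomonic_gram_restrict indicator_def)
      qed
    qed
    also have "\<dots> = C * det_power_integral k n A"
      unfolding det_power_integral_def by (rule C) measurable
    finally show "emeasure (gram_distr k n) A = C * det_power_integral k n A" .
  qed
qed

lemma space_gram_distr: "space (gram_distr k n) = corr_mats k"
  by (auto simp: gram_distr_def borel_corr_def space_restrict_space space_borel_sym_unit corr_mats_def)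

lemma prob_space_gram_distr: "0 < n \<Longrightarrow> prob_space (gram_distr k n)"
  unfolding gram_distr_def
  by (intro prob_space.prob_space_distr measurable_gram_mat prob_space_PiM prob_space_uniform_sphere)

text \<open>
  The unknown constant in the density cancels, because the set of all correlation matrices has
  probability \<open>1\<close>. That this integral is finite is a by-product.
\<close>

lemma measure_gram_distr:
  assumes "k \<le> n" "0 < n" and A: "A \<in> sets (borel_corr k)"
  shows "measure (gram_distr k n) A = enn2real (det_power_integral k n A) / enn2real (det_power_integral k n (corr_mats k))"
    and "det_power_integral k n (corr_mats k) < \<infinity>"
proof -
  obtain C where C: "\<And>A. A \<in> sets (borel_corr k) \<Longrightarrow> emeasure (gram_distr k n) A = C * det_power_integral k n A"
    using emeasure_gram_distr[OF assms(1,2)] by blast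
  let ?Z = "det_power_integral k n (corr_mats k)"
  interpret prob_space "gram_distr k n" by (rule prob_space_gram_distr) fact
  have one: "C * ?Z = 1"
    using C[of "corr_mats k"] emeasure_space_1 by (simp add: space_gram_distr sets_borel_corr_iff)
  then have "?Z \<noteq> 0" "?Z \<noteq> \<infinity>" "C \<noteq> \<infinity>"
    by (auto simp: ennreal_mult_eq_top_iff ennreal_top_mult ennreal_mult_top split: if_splits)
  then show fin: "?Z < \<infinity>" by (simp add: less_top)
  have r1: "enn2real C * enn2real ?Z = 1" using one by (metis enn2real_mult enn2real_1)
  then have "enn2real C = 1 / enn2real ?Z" by (metis mult_zero_right nonzero_eq_divide_eq zero_neq_one)
  then show "measure (gram_distr k n) A = enn2real (det_power_integral k n A) / enn2real ?Z"
    unfolding measure_def C[OF A] enn2real_mult by simp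
qed

section \<open>Exponential rates\<close>

lemma cosine_prod_pos: "0 < cosine_prod k w"
  unfolding cosine_prod_def by (intro prod_pos) (simp add: cosine_pos)

lemma cosine_prod_le_1: "cosine_prod k w \<le> 1"
  unfolding cosine_prod_def by (intro prod_le_1) (simp add: cosine_le_1 less_imp_le[OF cosine_pos])

text \<open>
  The number \<open>k\<close> of powers split off makes no difference to the rate, but it allows for a function
  that becomes integrable only when raised to a power.
\<close>

lemma exponential_rate:
  fixes b :: "nat \<Rightarrow> real"
  assumes \<tau>: "0 < \<tau>"
    and upper: "\<And>n. n \<ge> k \<Longrightarrow> b n \<le> \<tau> ^ (n - k) * B"
    and lower: "\<And>c. 0 < c \<Longrightarrow> c < \<tau> \<Longrightarrow> \<exists>\<delta>>0. \<forall>n\<ge>k. c ^ (n - k) * \<delta> \<le> b n"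
  shows "(\<lambda>n. ln (b n) / real n) \<longlonglongrightarrow> ln \<tau>"
proof (rule order_tendstoI)
  have lim: "(\<lambda>n. ((real n - real k) * a + d) / real n) \<longlonglongrightarrow> a" for a d :: real
    by real_asymp
  have pos: "0 < b n" if "n \<ge> k" for n
  proof -
    obtain \<delta> where "0 < \<delta>" "\<forall>n\<ge>k. (\<tau> / 2) ^ (n - k) * \<delta> \<le> b n"
      using lower[of "\<tau> / 2"] \<tau> by auto
    moreover from this have "0 < (\<tau> / 2) ^ (n - k) * \<delta>" using \<tau> by simp
    ultimately show ?thesis using that by (meson less_le_trans)
  qed
  have "0 < \<tau> ^ (k - k) * B" using pos[of k] upper[of k] by (meson less_le_trans order_refl)
  then have B: "0 < B" by simp
  {
    fix a assume "a > ln \<tau>"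
    have "\<forall>\<^sub>F n in sequentially. ((real n - real k) * ln \<tau> + ln B) / real n < a"
      using order_tendstoD(2)[OF lim] \<open>a > ln \<tau>\<close> by blast
    then show "\<forall>\<^sub>F n in sequentially. ln (b n) / real n < a"
      using eventually_ge_at_top[of k] eventually_gt_at_top[of 0]
    proof eventually_elim
      case (elim n)
      have "ln (b n) \<le> ln (\<tau> ^ (n - k) * B)"
        using upper[OF elim(2)] pos[OF elim(2)] \<tau> B by (subst ln_le_cancel_iff) auto
      also have "\<dots> = (real n - real k) * ln \<tau> + ln B"
        using \<tau> B elim(2) by (simp add: ln_mult ln_realpow of_nat_diff)
      finally have "ln (b n) / real n \<le> ((real n - real k) * ln \<tau> + ln B) / real n"
        by (rule divide_right_mono) simp
      then show ?case using elim(1) by simp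
    qed
  next
    fix a assume "a < ln \<tau>"
    then obtain a' where a': "a < a'" "a' < ln \<tau>" using dense by blast
    have "exp a' < \<tau>" using a'(2) \<tau> by (metis exp_less_cancel_iff exp_ln)
    then obtain \<delta> where \<delta>: "0 < \<delta>" "\<forall>n\<ge>k. exp a' ^ (n - k) * \<delta> \<le> b n"
      using lower[of "exp a'"] by auto
    have "\<forall>\<^sub>F n in sequentially. a < ((real n - real k) * a' + ln \<delta>) / real n"
      using order_tendstoD(1)[OF lim] a'(1) by blast
    then show "\<forall>\<^sub>F n in sequentially. a < ln (b n) / real n"
      using eventually_ge_at_top[of k] eventually_gt_at_top[of 0]
    proof eventually_elim
      case (elim n)
      have "(real n - real k) * a' + ln \<delta> = ln (exp a' ^ (n - k) * \<delta>)"
        using \<delta>(1) elim(2) by (simp add: ln_mult ln_realpow of_nat_diff)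
      also have "\<dots> \<le> ln (b n)"
        using \<delta> elim(2) pos[OF elim(2)] by (subst ln_le_cancel_iff) auto
      finally have "((real n - real k) * a' + ln \<delta>) / real n \<le> ln (b n) / real n"
        by (rule divide_right_mono) simp
      then show ?case using elim(1) by simp
    qed
  }
qed

lemma det_power_integral_mono: "A \<subseteq> B \<Longrightarrow> det_power_integral k n A \<le> det_power_integral k n B"
  unfolding det_power_integral_def by (intro nn_integral_mono mult_right_mono) (auto split: split_indicator)

lemma det_power_integral_finite:
  assumes "0 < k" "k \<le> n" "A \<subseteq> corr_mats k" shows "det_power_integral k n A < \<infinity>"
  using det_power_integral_mono[OF assms(3), of k n] measure_gram_distr(2)[of k n "{}"] assms
  by (auto intro: le_less_trans)

lemma cosine_prod_power_split:
  "k \<le> n \<Longrightarrow> cosine_prod k w ^ n = cosine_prod k w ^ (n - k) * cosine_prod k w ^ k"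
  by (simp add: power_add[symmetric])

text \<open>
  Split \<open>g ^ n = g ^ (n - k) * g ^ k\<close> and bound the first factor; the power \<open>k\<close> is the smallest
  one for which integrability is known from the existence of the random matrix in dimension
  \<open>n = k\<close>.
\<close>

lemma det_power_integral_upper:
  assumes k: "0 < k" "k \<le> n" and A: "A \<in> sets (borel_sym_unit k)" "A \<subseteq> corr_mats k" and c: "0 \<le> c"
    and AE: "AE w in leb (upper_pairs k). gnomonic_gram k w \<in> A \<longrightarrow> cosine_prod k w \<le> c"
  shows "enn2real (det_power_integral k n A) \<le> c ^ (n - k) * enn2real (det_power_integral k k A)"
proof -
  have [measurable]: "A \<in> sets (borel_sym_unit k)" by (rule A)
  have "det_power_integral k n A \<le> (\<integral>\<^sup>+w. ennreal (c ^ (n - k)) *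
      (indicator A (gnomonic_gram k w) * ennreal (cosine_prod k w ^ k)) \<partial>leb (upper_pairs k))"
    unfolding det_power_integral_def
  proof (rule nn_integral_mono_AE)
    show "AE w in leb (upper_pairs k). indicator A (gnomonic_gram k w) * ennreal (cosine_prod k w ^ n)
      \<le> ennreal (c ^ (n - k)) * (indicator A (gnomonic_gram k w) * ennreal (cosine_prod k w ^ k))"
      using AE
    proof eventually_elim
      case (elim w)
      have "ennreal (cosine_prod k w ^ n) \<le> ennreal (c ^ (n - k)) * ennreal (cosine_prod k w ^ k)" if "gnomonic_gram k w \<in> A"
        using elim that cosine_prod_pos[of k w] c unfolding cosine_prod_power_split[OF k(2)]
        by (subst ennreal_mult[symmetric]) (auto intro!: ennreal_leI mult_right_mono power_mono)
      then show ?case by (auto split: split_indicator)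
    qed
  qed
  also have "\<dots> = ennreal (c ^ (n - k)) * det_power_integral k k A"
    unfolding det_power_integral_def by (rule nn_integral_cmult) measurable
  finally have "enn2real (det_power_integral k n A) \<le> enn2real (ennreal (c ^ (n - k)) * det_power_integral k k A)"
    using det_power_integral_finite[OF k(1) order_refl A(2)] by (intro enn2real_mono) (auto simp: ennreal_mult_less_top)
  then show ?thesis using c by (simp add: enn2real_mult)
qed

lemma det_power_integral_lower:
  assumes k: "0 < k" and A: "A \<in> sets (borel_sym_unit k)" "A \<subseteq> corr_mats k" and c: "0 \<le> c"
    and nonnull: "\<not> (AE w in leb (upper_pairs k). gnomonic_gram k w \<in> A \<longrightarrow> cosine_prod k w \<le> c)"
  shows "\<exists>\<delta>>0. \<forall>n\<ge>k. c ^ (n - k) * \<delta> \<le> enn2real (det_power_integral k n A)"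
proof -
  have [measurable]: "A \<in> sets (borel_sym_unit k)" by (rule A)
  let ?N = "leb (upper_pairs k)"
  define h where "h w = indicator A (gnomonic_gram k w) * (indicator {c<..} (cosine_prod k w) * ennreal (cosine_prod k w ^ k))" for w
  have [measurable]: "h \<in> borel_measurable ?N" unfolding h_def by measurable
  define D where "D = (\<integral>\<^sup>+w. h w \<partial>?N)"
  have low: "ennreal (c ^ (n - k)) * D \<le> det_power_integral k n A" if n: "n \<ge> k" for n
  proof -
    have "ennreal (c ^ (n - k)) * D = (\<integral>\<^sup>+w. ennreal (c ^ (n - k)) * h w \<partial>?N)"
      unfolding D_def by (rule nn_integral_cmult[symmetric]) measurable
    also have "\<dots> \<le> det_power_integral k n A"
      unfolding det_power_integral_def
    proof (rule nn_integral_mono)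
      fix w
      have "ennreal (c ^ (n - k)) * ennreal (cosine_prod k w ^ k) \<le> ennreal (cosine_prod k w ^ n)" if "c < cosine_prod k w"
        using that cosine_prod_pos[of k w] c unfolding cosine_prod_power_split[OF n]
        by (subst ennreal_mult[symmetric]) (auto intro!: ennreal_leI mult_right_mono power_mono)
      then show "ennreal (c ^ (n - k)) * h w \<le> indicator A (gnomonic_gram k w) * ennreal (cosine_prod k w ^ n)"
        by (auto simp: h_def split: split_indicator)
    qed
    finally show ?thesis .
  qed
  have fin: "D < \<infinity>"
    using low[of k] det_power_integral_finite[OF k order_refl A(2)] by auto
  have "D \<noteq> 0"
  proof
    assume "D = 0"
    then have "AE w in ?N. h w = 0" unfolding D_def by (subst (asm) nn_integral_0_iff_AE) auto
    then have "AE w in ?N. gnomonic_gram k w \<in> A \<longrightarrow> cosine_prod k w \<le> c"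
    proof eventually_elim
      case (elim w)
      have "ennreal (cosine_prod k w ^ k) \<noteq> 0"
        using zero_less_power[OF cosine_prod_pos[of k w], of k] by (simp add: ennreal_eq_0_iff not_le)
      then show ?case using elim by (auto simp: h_def not_less[symmetric] split: split_indicator_asm)
    qed
    then show False using nonnull by simp
  qed
  have "c ^ (n - k) * enn2real D \<le> enn2real (det_power_integral k n A)" if n: "n \<ge> k" for n
    using enn2real_mono[OF low[OF n]] det_power_integral_finite[OF k n A(2)] c by (simp add: enn2real_mult)
  moreover have "0 < enn2real D" using fin \<open>D \<noteq> 0\<close> by (simp add: enn2real_positive_iff zero_less_iff_neq_zero)
  ultimately show ?thesis by blast
qed

text \<open>
  A small cube at the origin has positive volume, and \<open>g\<close> is close to \<open>1\<close> on it.
\<close>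

lemma cosine_prod_near_1:
  assumes "c < 1"
  shows "\<not> (AE w in leb (upper_pairs k). cosine_prod k w \<le> c)"
proof
  assume AE: "AE w in leb (upper_pairs k). cosine_prod k w \<le> c"
  have "((\<lambda>d. (1 / sqrt (1 + real k * d\<^sup>2)) ^ k) \<longlongrightarrow> (1 / sqrt (1 + real k * 0\<^sup>2)) ^ k) (at_right 0)"
    by (intro tendsto_intros) auto
  then have "\<forall>\<^sub>F d in at_right 0. c < (1 / sqrt (1 + real k * d\<^sup>2)) ^ k"
    using assms by (intro order_tendstoD(1)) auto
  then have "\<forall>\<^sub>F d in at_right 0. c < (1 / sqrt (1 + real k * d\<^sup>2)) ^ k \<and> (0 :: real) < d"
    by (rule eventually_conj) (rule eventually_at_right_less)
  then obtain d :: real where d: "c < (1 / sqrt (1 + real k * d\<^sup>2)) ^ k" "0 < d"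
    using eventually_happens'[OF trivial_limit_at_right_real] by blast
  let ?Q = "Pi\<^sub>E (upper_pairs k) (\<lambda>_. {0..d})"
  have big: "c < cosine_prod k w" if w: "w \<in> ?Q" for w
  proof -
    have "1 / sqrt (1 + real k * d\<^sup>2) \<le> cosine (col_pairs i) w" if i: "i < k" for i
    proof -
      have "(\<Sum>p\<in>col_pairs i. (w p)\<^sup>2) \<le> (\<Sum>p\<in>col_pairs i. d\<^sup>2)"
      proof (rule sum_mono)
        fix p assume "p \<in> col_pairs i"
        then have "0 \<le> w p" "w p \<le> d" using w i col_pairs_subset[OF i] by (auto simp: PiE_iff)
        then show "(w p)\<^sup>2 \<le> d\<^sup>2" by (rule power_mono[rotated])
      qed
      also have "\<dots> = real i * d\<^sup>2" by (simp add: card_cartesian_product)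
      also have "\<dots> \<le> real k * d\<^sup>2" using i by (intro mult_right_mono) auto
      finally show ?thesis unfolding cosine_def
        by (intro divide_left_mono mult_pos_pos) (auto simp: add_pos_nonneg sum_nonneg)
    qed
    then have "(\<Prod>i<k. 1 / sqrt (1 + real k * d\<^sup>2)) \<le> cosine_prod k w"
      unfolding cosine_prod_def by (intro prod_mono) auto
    then show ?thesis using d(1) by simp
  qed
  have "AE w in leb (upper_pairs k). w \<notin> ?Q"
    using AE
  proof eventually_elim
    case (elim w)
    then show ?case using big[of w] by linarith
  qed
  then have "emeasure (leb (upper_pairs k)) ?Q = 0"
    by (subst (asm) AE_iff_null_sets[symmetric]) (auto simp: sets_cube null_sets_def)
  then show False using d(2) by (simp add: emeasure_cube)
qed

text \<open>
  This moves the essential supremum from the matrix entries to the coordinates \<open>w\<close>. The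
  exceptional set consists of matrices with positive determinant, hence lies in the range of
  \<open>w \<mapsto> M(w)\<close>, so that null sets can be transferred in both directions.
\<close>

lemma det_null_iff:
  assumes A: "A \<in> sets (borel_sym_unit k)" "A \<subseteq> corr_mats k" and c: "0 \<le> c"
  shows "(AE M in restrict_space (lebesgue_sym_unit k) (corr_mats k). indicator A M * Determinant.det M \<le> c)
     \<longleftrightarrow> (AE w in leb (upper_pairs k). gnomonic_gram k w \<in> A \<longrightarrow> cosine_prod k w \<le> sqrt c)"
proof -
  let ?N = "leb (upper_pairs k)" and ?S = "space (leb (upper_pairs k))"
  note [measurable] = A(1) measurable_det
  define D where "D = {M \<in> space (borel_sym_unit k). M \<in> A \<and> c < Determinant.det M}"
  have D [measurable]: "D \<in> sets (borel_sym_unit k)" unfolding D_def by measurable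
  define X where "X = mat_of_upper k -` D \<inter> ?S"
  have X: "X \<in> sets ?N" unfolding X_def by measurable
  have sets_leb: "sets (lebesgue_sym_unit k) = sets (borel_sym_unit k)" by (simp add: lebesgue_sym_unit_def)
  have "(AE M in restrict_space (lebesgue_sym_unit k) (corr_mats k). indicator A M * Determinant.det M \<le> c)
     \<longleftrightarrow> (AE M in lebesgue_sym_unit k. M \<in> corr_mats k \<longrightarrow> indicator A M * Determinant.det M \<le> c)"
    by (rule AE_restrict_space_iff) (simp add: sets_leb sets.Int_space_eq2 sets_eq_imp_space_eq[OF sets_leb])
  also have "\<dots> \<longleftrightarrow> (AE M in lebesgue_sym_unit k. M \<notin> D)"
    using A(2) c corr_mats_subset
    by (intro AE_cong) (auto simp: D_def space_borel_sym_unit not_less indicator_def sets_eq_imp_space_eq[OF sets_leb])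
  also have "\<dots> \<longleftrightarrow> D \<in> null_sets (lebesgue_sym_unit k)"
    by (rule AE_iff_null_sets[symmetric]) (simp add: sets_leb)
  also have "\<dots> \<longleftrightarrow> X \<in> null_sets ?N"
    using X by (simp add: null_sets_def sets_leb lebesgue_sym_unit_def emeasure_distr X_def)
  also have "\<dots> \<longleftrightarrow> gram_entries k -` X \<inter> ?S \<in> null_sets ?N"
  proof
    assume "gram_entries k -` X \<inter> ?S \<in> null_sets ?N"
    moreover have "X \<subseteq> gram_entries k ` ?S"
    proof
      fix x assume x: "x \<in> X"
      then have "mat_of_upper k x \<in> corr_mats k" "Determinant.det (mat_of_upper k x) \<noteq> 0"
        using A(2) c by (auto simp: X_def D_def)
      then obtain w where "w \<in> ?S" "mat_of_upper k x = gnomonic_gram k w"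
        by (rule corr_mat_gnomonic_gram)
      then show "x \<in> gram_entries k ` ?S"
        using x upper_entries_mat_of_upper[of x k] upper_entries_gnomonic_gram[of k w] by (auto simp: X_def)
    qed
    ultimately show "X \<in> null_sets ?N" by (intro gram_entries_null_image[OF X])
  qed (rule gram_entries_null_preimage)
  also have "gram_entries k -` X \<inter> ?S = {w \<in> ?S. gnomonic_gram k w \<in> A \<and> sqrt c < cosine_prod k w}"
  proof -
    have "mat_of_upper k (gram_entries k w) = gnomonic_gram k w" for w
      using mat_of_upper_upper_entries[of "gnomonic_gram k w" k] gnomonic_gram_corr corr_mats_subset
        upper_entries_gnomonic_gram[of k w] by auto
    moreover have "c < Determinant.det (gnomonic_gram k w) \<longleftrightarrow> sqrt c < cosine_prod k w" for w
      unfolding det_gnomonic_gram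
      using real_sqrt_less_iff[of c "(cosine_prod k w)\<^sup>2"] cosine_prod_pos[of k w] by simp
    moreover have "gnomonic_gram k w \<in> sym_unit_mats k" for w
      using gnomonic_gram_corr corr_mats_subset by blast
    ultimately show ?thesis
      using measurable_space[OF measurable_gram_entries, of _ k]
      by (auto simp: X_def D_def space_borel_sym_unit)
  qed
  also have "\<dots> \<in> null_sets ?N \<longleftrightarrow> (AE w in ?N. \<not> (gnomonic_gram k w \<in> A \<and> sqrt c < cosine_prod k w))"
  proof -
    have "{w \<in> ?S. \<not> \<not> (gnomonic_gram k w \<in> A \<and> sqrt c < cosine_prod k w)} \<in> sets ?N" by measurable
    then show ?thesis by (subst AE_iff_null) simp_all
  qed
  finally show ?thesis by (simp add: not_less)
qed

lemma measurable_indicator_det: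
  assumes "A \<in> sets (borel_sym_unit k)"
  shows "(\<lambda>M. ereal (indicator A M * Determinant.det M))
     \<in> borel_measurable (restrict_space (lebesgue_sym_unit k) (corr_mats k))"
proof -
  note [measurable] = assms measurable_det
  have "sets (lebesgue_sym_unit k) = sets (borel_sym_unit k)" by (simp add: lebesgue_sym_unit_def)
  moreover have "(\<lambda>M. ereal (indicator A M * Determinant.det M)) \<in> borel_measurable (borel_sym_unit k)"
    by measurable
  ultimately show ?thesis
    by (intro measurable_restrict_space1) (simp add: measurable_cong_sets[of "lebesgue_sym_unit k" "borel_sym_unit k"])
qed

lemma ess_max_le_iff:
  assumes A: "A \<in> sets (borel_sym_unit k)" "A \<subseteq> corr_mats k" and c: "0 \<le> c"
  shows "ess_max k (\<lambda>M. indicator A M * Determinant.det M) \<le> ereal c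
     \<longleftrightarrow> (AE w in leb (upper_pairs k). gnomonic_gram k w \<in> A \<longrightarrow> cosine_prod k w \<le> sqrt c)"
  unfolding det_null_iff[OF A c, symmetric] ess_max_def
proof
  assume le: "esssup (restrict_space (lebesgue_sym_unit k) (corr_mats k)) (\<lambda>M. ereal (indicator A M * Determinant.det M)) \<le> ereal c"
  have "AE M in restrict_space (lebesgue_sym_unit k) (corr_mats k). ereal (indicator A M * Determinant.det M)
     \<le> esssup (restrict_space (lebesgue_sym_unit k) (corr_mats k)) (\<lambda>M. ereal (indicator A M * Determinant.det M))"
    by (rule esssup_AE)
  then show "AE M in restrict_space (lebesgue_sym_unit k) (corr_mats k). indicator A M * Determinant.det M \<le> c"
  proof eventually_elim
    case (elim M)
    have "ereal (indicator A M * Determinant.det M) \<le> ereal c" using elim le by (rule order_trans)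
    then show ?case by simp
  qed
next
  assume "AE M in restrict_space (lebesgue_sym_unit k) (corr_mats k). indicator A M * Determinant.det M \<le> c"
  then show "esssup (restrict_space (lebesgue_sym_unit k) (corr_mats k)) (\<lambda>M. ereal (indicator A M * Determinant.det M)) \<le> ereal c"
    by (intro esssup_I measurable_indicator_det A(1)) simp
qed

lemma ln_det_power_integral_rate:
  assumes k: "0 < k" and A: "A \<in> sets (borel_sym_unit k)" "A \<subseteq> corr_mats k" and \<tau>: "0 < \<tau>"
    and upper: "AE w in leb (upper_pairs k). gnomonic_gram k w \<in> A \<longrightarrow> cosine_prod k w \<le> \<tau>"
    and lower: "\<And>c. 0 < c \<Longrightarrow> c < \<tau> \<Longrightarrow>
      \<not> (AE w in leb (upper_pairs k). gnomonic_gram k w \<in> A \<longrightarrow> cosine_prod k w \<le> c)"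
  shows "(\<lambda>n. ln (enn2real (det_power_integral k n A)) / real n) \<longlonglongrightarrow> ln \<tau>"
    and "n \<ge> k \<Longrightarrow> 0 < enn2real (det_power_integral k n A)"
proof -
  have low: "\<exists>\<delta>>0. \<forall>n\<ge>k. c ^ (n - k) * \<delta> \<le> enn2real (det_power_integral k n A)" if "0 < c" "c < \<tau>" for c
    by (rule det_power_integral_lower[OF k A]) (use that lower in auto)
  show "(\<lambda>n. ln (enn2real (det_power_integral k n A)) / real n) \<longlonglongrightarrow> ln \<tau>"
  proof (rule exponential_rate[where k = k and B = "enn2real (det_power_integral k k A)", OF \<tau>])
    show "enn2real (det_power_integral k n A) \<le> \<tau> ^ (n - k) * enn2real (det_power_integral k k A)" if "n \<ge> k" for n
      by (rule det_power_integral_upper[OF k that A _ upper]) (use \<tau> in simp)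
  qed (rule low)
  assume "n \<ge> k"
  obtain \<delta> where "0 < \<delta>" "\<forall>n\<ge>k. (\<tau> / 2) ^ (n - k) * \<delta> \<le> enn2real (det_power_integral k n A)"
    using low[of "\<tau> / 2"] \<tau> by auto
  moreover from this have "0 < (\<tau> / 2) ^ (n - k) * \<delta>" using \<tau> by simp
  ultimately show "0 < enn2real (det_power_integral k n A)" using \<open>n \<ge> k\<close> by (meson less_le_trans)
qed

theorem theorem2p4:
  fixes k :: nat and A :: "real mat set"
  assumes "k \<ge> 2"
    and "A \<subseteq> corr_mats k" and "A \<in> sets (borel_corr k)"
  shows "(\<lambda>n. ereal (1 / real n) * eln (ereal (measure (gram_distr k n) A)))
           \<longlonglongrightarrow> ereal (1 / 2) * eln (ess_max k (\<lambda>M. indicator A M * Determinant.det M))"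
proof -
  define s where "s = ess_max k (\<lambda>M. indicator A M * Determinant.det M)"
  define a where "a n = enn2real (det_power_integral k n A)" for n
  define z where "z n = enn2real (det_power_integral k n (corr_mats k))" for n
  have k: "0 < k" using assms(1) by simp
  have A: "A \<in> sets (borel_sym_unit k)" "A \<subseteq> corr_mats k" using assms(3) by (auto simp: sets_borel_corr_iff)
  have meas: "measure (gram_distr k n) A = a n / z n" if "n \<ge> k" for n
    using measure_gram_distr(1)[of k n A] that k assms(3) by (simp add: a_def z_def)
  show ?thesis
    unfolding s_def[symmetric]
  proof (cases "s \<le> 0")
    \<comment> \<open>here the restriction of the determinant to \<open>A\<close> vanishes almost everywhere, and both sides are \<open>-\<infinity>\<close>\<close>
    case True
    then have "AE w in leb (upper_pairs k). gnomonic_gram k w \<in> A \<longrightarrow> cosine_prod k w \<le> 0"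
      using ess_max_le_iff[OF A, of 0] by (simp add: s_def zero_ereal_def)
    then have zero: "a n \<le> 0 ^ (n - k) * a k" if "n \<ge> k" for n
      unfolding a_def by (rule det_power_integral_upper[OF k that A order_refl])
    have "\<forall>\<^sub>F n in sequentially. ereal (1 / real n) * eln (ereal (measure (gram_distr k n) A)) = -\<infinity>"
      using eventually_gt_at_top[of k]
    proof eventually_elim
      case (elim n)
      then have "a n \<le> 0" using zero[of n] by (simp add: power_0_left)
      then have "measure (gram_distr k n) A = 0" using meas[of n] elim by (simp add: a_def antisym)
      then show ?case using elim by (simp add: eln_def)
    qed
    moreover have "ereal (1 / 2) * eln s = -\<infinity>" using True by (simp add: eln_def)
    ultimately show "(\<lambda>n. ereal (1 / real n) * eln (ereal (measure (gram_distr k n) A))) \<longlonglongrightarrow> ereal (1 / 2) * eln s"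
      by (simp add: tendsto_eventually)
  next
    case False
    have "s \<le> ereal 1"
      unfolding s_def ess_max_le_iff[OF A zero_le_one] by (simp add: cosine_prod_le_1)
    then obtain \<sigma> where \<sigma>: "s = ereal \<sigma>" "0 < \<sigma>" using False by (cases s) auto
    have "(\<lambda>n. ln (a n) / real n) \<longlonglongrightarrow> ln (sqrt \<sigma>)" and apos: "\<And>n. n \<ge> k \<Longrightarrow> 0 < a n"
    proof -
      have upper: "AE w in leb (upper_pairs k). gnomonic_gram k w \<in> A \<longrightarrow> cosine_prod k w \<le> sqrt \<sigma>"
        using ess_max_le_iff[OF A, of \<sigma>] \<sigma> by (simp add: s_def[symmetric])
      have lower: "\<not> (AE w in leb (upper_pairs k). gnomonic_gram k w \<in> A \<longrightarrow> cosine_prod k w \<le> c)"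
        if "0 < c" "c < sqrt \<sigma>" for c
      proof -
        have "c\<^sup>2 < \<sigma>" using power_strict_mono[OF that(2), of 2] that(1) \<sigma>(2) by simp
        then have "\<not> s \<le> ereal (c\<^sup>2)" using \<sigma>(1) by simp
        then show ?thesis using ess_max_le_iff[OF A, of "c\<^sup>2"] that(1) by (simp add: s_def)
      qed
      have pos: "0 < sqrt \<sigma>" using \<sigma>(2) by simp
      show "(\<lambda>n. ln (a n) / real n) \<longlonglongrightarrow> ln (sqrt \<sigma>)"
        unfolding a_def by (rule ln_det_power_integral_rate(1)[OF k A pos upper]) (erule (1) lower)
      show "0 < a n" if "n \<ge> k" for n
        unfolding a_def by (rule ln_det_power_integral_rate(2)[OF k A pos upper _ that]) (erule (1) lower)
    qed
    moreover have "(\<lambda>n. ln (z n) / real n) \<longlonglongrightarrow> ln 1" and zpos: "\<And>n. n \<ge> k \<Longrightarrow> 0 < z n"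
    proof -
      have upper: "AE w in leb (upper_pairs k). gnomonic_gram k w \<in> corr_mats k \<longrightarrow> cosine_prod k w \<le> 1"
        by (simp add: cosine_prod_le_1)
      have lower: "\<not> (AE w in leb (upper_pairs k). gnomonic_gram k w \<in> corr_mats k \<longrightarrow> cosine_prod k w \<le> c)"
        if "0 < c" "c < 1" for c
        using cosine_prod_near_1[OF that(2)] by (simp add: gnomonic_gram_corr)
      have Z: "corr_mats k \<in> sets (borel_sym_unit k)" "corr_mats k \<subseteq> corr_mats k" "(0 :: real) < 1" by simp_all
      show "(\<lambda>n. ln (z n) / real n) \<longlonglongrightarrow> ln 1"
        unfolding z_def
        by (rule ln_det_power_integral_rate(1)[OF k Z upper]) (erule (1) lower)
      show "0 < z n" if "n \<ge> k" for n
        unfolding z_def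
        by (rule ln_det_power_integral_rate(2)[OF k Z upper _ that]) (erule (1) lower)
    qed
    ultimately have "(\<lambda>n. ln (a n) / real n - ln (z n) / real n) \<longlonglongrightarrow> ln (sqrt \<sigma>) - ln 1"
      by (intro tendsto_diff)
    then have "(\<lambda>n. ereal (ln (a n) / real n - ln (z n) / real n)) \<longlonglongrightarrow> ereal (1 / 2) * eln s"
      using \<sigma> by (simp add: eln_def ln_sqrt)
    moreover have "\<forall>\<^sub>F n in sequentially. ereal (ln (a n) / real n - ln (z n) / real n)
        = ereal (1 / real n) * eln (ereal (measure (gram_distr k n) A))"
      using eventually_ge_at_top[of k]
    proof eventually_elim
      case (elim n)
      have "0 < a n / z n" using apos[OF elim] zpos[OF elim] by simp
      moreover have "ln (a n / z n) = ln (a n) - ln (z n)"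
        using apos[OF elim] zpos[OF elim] by (simp add: ln_div)
      ultimately show ?case
        unfolding meas[OF elim] by (simp add: eln_def diff_divide_distrib not_le)
    qed
    ultimately show "(\<lambda>n. ereal (1 / real n) * eln (ereal (measure (gram_distr k n) A))) \<longlonglongrightarrow> ereal (1 / 2) * eln s"
      by (rule Lim_transform_eventually)
  qed
qed

end
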